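(* Let $\Delta\subseteq K^n$ be an $n$-dimensional compact convex polytope, $n\ge 3$, and assume that $D^1(M)=D^2(M)=0$ for every three-dimensional face $M\le\Delta$. For every two-dimensional face $V\le\Delta$ fix some three-dimensional face $M(V)$ containing $V$. Then $D^2(\Delta)$ is isomorphic to the subspace of $K^{\#\{(0,2,3)\text{-flags}\}}$, with coordinates $s(a,V,M)$ indexed by the flags $a\in V\subset M$ of faces of $\Delta$ of dimensions $0,2,3$, given by the following linear equations: (1) for every flag $(a,F)$ of faces of dimensions $(0,4)$, $$\sum_{a\in V\subseteq F}\Big[s\big(a,V,M^{(V,F)}\big)-s\big(a,V,M_{(V,F)}\big)\Big]=0,$$ the sum running over the two-dimensional faces $V$ of $F$ containing $a$; (2) for every flag $(V,M)$ of faces of dimensions $(2,3)$, the coordinates $s(\cdot,V,M)$ form an affine relation among the vertices of $V$, i.e. $$\sum_{a\in V}s(a,V,M)\cdot[a,1]=0\quad\text{in }K^{n+1},$$ the sum running over the vertices $a$ of $V$; (3) for every flag $(a,V)$ of faces of dimensions $(0,2)$, $s\big(a,V,M(V)\big)=0$.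
   Context: $K$ is a field with $\mathbb{Q}\subseteq K\subseteq\mathbb{R}$; polytopes are compact convex polytopes in finite-dimensional $K$-vector spaces. $\Delta$ is counted as a face of itself. The letters $a,V,M,F$ denote faces of $\Delta$ of dimension $0,2,3,4$, respectively. Notation $M^{(V,F)},M_{(V,F)}$: if $V\subset F$ is a flag of faces of dimensions $(2,4)$, there are exactly two three-dimensional faces between $V$ and $F$; they are denoted $M^{(V,F)}$ and $M_{(V,F)}$, ordered by orientation as follows. Fix an orientation of every two-dimensional face and of every four-dimensional face of $\Delta$. For $V\subset F$, the two orientations induce an orientation of the two-dimensional quotient of the linear direction space of $F$ by that of $V$; the two intermediate faces define two rays in this plane, and they are ordered such that (ray of $M^{(V,F)}$, ray of $M_{(V,F)}$) is positively oriented. Definition of $D^k$. A cohomological system $\mathcal F$ on a finite fan $\Sigma$ is a covariant functor from $\Sigma$ (morphisms: face relations $\tau\le\sigma$) to $K$-vector spaces. Fix an orientation of each cone; for a facet $\tau$ of $\sigma$ let $\varepsilon(\tau,\sigma)=\pm1$ compare the orientation of $\tau$ with the one induced from $\sigma$. Put $C^k(\Sigma,\mathcal F)=\bigoplus_{\sigma\in\Sigma,\dim\sigma=k}\mathcal F(\sigma)$, with differential $C^k\to C^{k+1}$ built from the maps $\varepsilon(\tau,\sigma)\cdot(\mathcal F(\tau)\to\mathcal F(\sigma))$, and let $H^k(\Sigma,\mathcal F)$ be its cohomology. For a polytope $P\subseteq K^m$ (not necessarily full-dimensional) let $\mathrm{cone}(P)\subseteq K^{m+1}$ be the cone over $P\times\{1\}$,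 and $\underline{\mathrm{cone}}(P)$ the fan of all its faces (including $\{0\}$ and $\mathrm{cone}(P)$ itself). Then $D^k(P):=H^{k+1}(\underline{\mathrm{cone}}(P),\mathrm{span})$, where $\mathrm{span}$ sends a cone to its linear span, with inclusions as maps. For non-empty $P$ this equals $H^k(\underline{\mathrm{cone}}(P),K^{m+1}/\mathrm{span})$. *)

theory Defs
  imports
    "Jordan_Normal_Form.Determinant"
    "HOL-Analysis.Analysis"
begin

no_notation Matrix.vec_index (infixl "$" 100)

text \<open>
  A field \<open>K\<close> with \<open>\<rat> \<subseteq> K \<subseteq> \<real>\<close> is an ordered field type \<open>'k\<close> together with its inclusion
  \<open>\<iota>\<close> into the reals; strict monotonicity says that the order of \<open>'k\<close> is the one inherited
  from the reals. The inclusion of the rationals is automatic.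
\<close>

definition subfield_of_reals :: "('k::linordered_field \<Rightarrow> real) \<Rightarrow> bool" where
  "subfield_of_reals \<iota> \<longleftrightarrow>
     \<iota> 1 = 1 \<and> (\<forall>x y. \<iota> (x + y) = \<iota> x + \<iota> y) \<and> (\<forall>x y. \<iota> (x * y) = \<iota> x * \<iota> y) \<and> strict_mono \<iota>"

text \<open>The ambient type \<open>'v\<close> carries no structure of its own, so that cosets can be elements.\<close>

record ('k, 'v) vspace =
  vcarrier :: "'v set"
  vplus :: "'v \<Rightarrow> 'v \<Rightarrow> 'v"
  vscale :: "'k \<Rightarrow> 'v \<Rightarrow> 'v"

definition vquotient :: "('k, 'v) vspace \<Rightarrow> 'v set \<Rightarrow> ('k, 'v set) vspace" where
  "vquotient Z B =
     \<lparr> vcarrier = (\<lambda>z. vplus Z z ` B) ` vcarrier Z,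
       vplus = (\<lambda>X Y. {vplus Z x y | x y. x \<in> X \<and> y \<in> Y}),
       vscale = (\<lambda>c X. {vplus Z (vscale Z c x) b | x b. x \<in> X \<and> b \<in> B}) \<rparr>"

definition vzero_space :: "('k, 'v) vspace \<Rightarrow> bool" where
  "vzero_space V \<longleftrightarrow> (\<exists>z. vcarrier V = {z})"

definition viso :: "('k, 'v) vspace \<Rightarrow> ('k, 'w) vspace \<Rightarrow> bool" where
  "viso V W \<longleftrightarrow> (\<exists>f. bij_betw f (vcarrier V) (vcarrier W) \<and>
     (\<forall>x\<in>vcarrier V. \<forall>y\<in>vcarrier V. f (vplus V x y) = vplus W (f x) (f y)) \<and>
     (\<forall>c. \<forall>x\<in>vcarrier V. f (vscale V c x) = vscale W c (f x)))"

definition ordered_basis :: "('k::field ^ 'm) list \<Rightarrow> ('k ^ 'm) set \<Rightarrow> bool" where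
  "ordered_basis bs U \<longleftrightarrow> distinct bs \<and> vec.independent (set bs) \<and> vec.span (set bs) = U"

text \<open>
  An orientation of a subspace is represented by an ordered basis; \<open>bs\<close> and \<open>cs\<close> represent the
  same orientation if the matrix expressing \<open>cs\<close> in \<open>bs\<close> has positive determinant.
\<close>

definition same_orientation ::
    "('k::linordered_field ^ 'm) list \<Rightarrow> ('k ^ 'm) list \<Rightarrow> bool" where
  "same_orientation bs cs \<longleftrightarrow> length cs = length bs \<and>
     (\<exists>A. (\<forall>j<length bs. cs ! j = (\<Sum>i<length bs. A i j *s bs ! i)) \<and>
          Determinant.det (Matrix.mat (length bs) (length bs) (\<lambda>(i, j). A i j)) > 0)"

definition dot :: "'k::comm_ring_1 ^ 'm \<Rightarrow> 'k ^ 'm \<Rightarrow> 'k" where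
  "dot u x = (\<Sum>i\<in>UNIV. u $ i * x $ i)"

definition Khull :: "('k::linordered_field ^ 'm) set \<Rightarrow> ('k ^ 'm) set" where
  "Khull S = {\<Sum>x\<in>S. u x *s x | u. (\<forall>x\<in>S. 0 \<le> u x) \<and> sum u S = 1}"

definition Kpolytope :: "('k::linordered_field ^ 'm) set \<Rightarrow> bool" where
  "Kpolytope P \<longleftrightarrow> (\<exists>S. finite S \<and> P = Khull S)"

text \<open>Linear space parallel to the affine hull of a non-empty set.\<close>

definition direction :: "('k::field ^ 'm) set \<Rightarrow> ('k ^ 'm) set" where
  "direction P = vec.span {x - y | x y. x \<in> P \<and> y \<in> P}"

definition face :: "('k::linordered_field ^ 'm) set \<Rightarrow> ('k ^ 'm) set \<Rightarrow> bool" where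
  "face Q P \<longleftrightarrow> (\<exists>u c. (\<forall>x\<in>P. dot u x \<le> c) \<and> Q = {x\<in>P. dot u x = c})"

text \<open>The empty face, whose direction would also have dimension 0, is excluded.\<close>

definition faces :: "('k::linordered_field ^ 'm) set \<Rightarrow> nat \<Rightarrow> ('k ^ 'm) set set" where
  "faces P d = {Q. face Q P \<and> Q \<noteq> {} \<and> vec.dim (direction Q) = d}"

definition vertices :: "('k::linordered_field ^ 'm) set \<Rightarrow> ('k ^ 'm) set" where
  "vertices P = {a. {a} \<in> faces P 0}"

definition cone_face :: "('k::linordered_field ^ 'm) set \<Rightarrow> ('k ^ 'm) set \<Rightarrow> bool" where
  "cone_face \<tau> \<sigma> \<longleftrightarrow> (\<exists>u. (\<forall>x\<in>\<sigma>. 0 \<le> dot u x) \<and> \<tau> = {x\<in>\<sigma>. dot u x = 0})"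

definition face_fan :: "('k::linordered_field ^ 'm) set \<Rightarrow> ('k ^ 'm) set set" where
  "face_fan \<sigma> = {\<tau>. cone_face \<tau> \<sigma>}"

text \<open>
  \<open>\<omega> \<sigma>\<close> is an ordered basis of the span of \<open>\<sigma>\<close>. A facet \<open>\<tau>\<close> of \<open>\<sigma>\<close> gets the boundary
  orientation, outward vector first; for \<open>w\<close> in \<open>\<sigma> - \<tau>\<close> the vector \<open>- w\<close> points outward.
\<close>

definition incidence :: "(('k::linordered_field ^ 'm) set \<Rightarrow> ('k ^ 'm) list) \<Rightarrow>
    ('k ^ 'm) set \<Rightarrow> ('k ^ 'm) set \<Rightarrow> 'k" where
  "incidence \<omega> \<tau> \<sigma> = (if \<exists>w\<in>\<sigma> - \<tau>. same_orientation (\<omega> \<sigma>) (- w # \<omega> \<tau>) then 1 else - 1)"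

text \<open>
  A cohomological system on a fan \<open>\<Sigma>\<close> is given by its objects \<open>F \<sigma>\<close>, which are subspaces of an
  ambient coordinate space, and its maps \<open>\<rho> \<tau> \<sigma> : F \<tau> \<rightarrow> F \<sigma>\<close>. Cochains of degree \<open>k\<close> are families
  indexed by all sets and vanishing off the \<open>k\<close>-dimensional cones of \<open>\<Sigma>\<close>.
\<close>

type_synonym ('k, 'm, 'w) cochain = "('k ^ 'm) set \<Rightarrow> 'k ^ 'w"

definition cochains :: "('k::linordered_field ^ 'm) set set \<Rightarrow> (('k ^ 'm) set \<Rightarrow> ('k ^ 'w) set) \<Rightarrow>
    nat \<Rightarrow> ('k, 'm, 'w) cochain set" where
  "cochains \<Sigma> F k =
     {f. \<forall>\<sigma>. if \<sigma> \<in> \<Sigma> \<and> vec.dim \<sigma> = k then f \<sigma> \<in> F \<sigma> else f \<sigma> = 0}"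

definition coboundary :: "(('k::linordered_field ^ 'm) set \<Rightarrow> ('k ^ 'm) list) \<Rightarrow>
    ('k ^ 'm) set set \<Rightarrow> (('k ^ 'm) set \<Rightarrow> ('k ^ 'm) set \<Rightarrow> 'k ^ 'w \<Rightarrow> 'k ^ 'w) \<Rightarrow>
    nat \<Rightarrow> ('k, 'm, 'w) cochain \<Rightarrow> ('k, 'm, 'w) cochain" where
  "coboundary \<omega> \<Sigma> \<rho> k f = (\<lambda>\<sigma>.
     if \<sigma> \<in> \<Sigma> \<and> vec.dim \<sigma> = Suc k
     then \<Sum>\<tau> | \<tau> \<in> \<Sigma> \<and> cone_face \<tau> \<sigma> \<and> vec.dim \<tau> = k. incidence \<omega> \<tau> \<sigma> *s \<rho> \<tau> \<sigma> (f \<tau>)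
     else 0)"

definition cocycles where
  "cocycles \<omega> \<Sigma> F \<rho> k = {f \<in> cochains \<Sigma> F k. coboundary \<omega> \<Sigma> \<rho> k f = (\<lambda>_. 0)}"

fun coboundaries where
  "coboundaries \<omega> \<Sigma> F \<rho> 0 = {\<lambda>_. 0}"
| "coboundaries \<omega> \<Sigma> F \<rho> (Suc k) = coboundary \<omega> \<Sigma> \<rho> k ` cochains \<Sigma> F k"

definition cohomology :: "(('k::linordered_field ^ 'm) set \<Rightarrow> ('k ^ 'm) list) \<Rightarrow>
    ('k ^ 'm) set set \<Rightarrow> (('k ^ 'm) set \<Rightarrow> ('k ^ 'w) set) \<Rightarrow>
    (('k ^ 'm) set \<Rightarrow> ('k ^ 'm) set \<Rightarrow> 'k ^ 'w \<Rightarrow> 'k ^ 'w) \<Rightarrow>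
    nat \<Rightarrow> ('k, ('k, 'm, 'w) cochain set) vspace" where
  "cohomology \<omega> \<Sigma> F \<rho> k = vquotient
     \<lparr> vcarrier = cocycles \<omega> \<Sigma> F \<rho> k,
       vplus = (\<lambda>f g \<sigma>. f \<sigma> + g \<sigma>),
       vscale = (\<lambda>c f \<sigma>. c *s f \<sigma>) \<rparr>
     (coboundaries \<omega> \<Sigma> F \<rho> k)"

text \<open>\<open>K\<^sup>m\<^sup>+\<^sup>1\<close> is \<open>'k ^ 'm option\<close>, the coordinate \<open>None\<close> being the additional one.\<close>

definition lift :: "'k::field ^ 'm \<Rightarrow> 'k ^ 'm option" where
  "lift a = (\<chi> i. case i of None \<Rightarrow> 1 | Some j \<Rightarrow> a $ j)"

definition cone_over :: "('k::linordered_field ^ 'm) set \<Rightarrow> ('k ^ 'm option) set" where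
  "cone_over P = insert 0 {t *s lift x | t x. 0 \<le> t \<and> x \<in> P}"

definition Dspace :: "(('k::linordered_field ^ 'm option) set \<Rightarrow> ('k ^ 'm option) list) \<Rightarrow>
    nat \<Rightarrow> ('k ^ 'm) set \<Rightarrow> ('k, ('k, 'm option, 'm option) cochain set) vspace" where
  "Dspace \<omega> k P = cohomology \<omega> (face_fan (cone_over P)) vec.span (\<lambda>\<tau> \<sigma> x. x) (Suc k)"

text \<open>
  \<open>\<theta>\<close> assigns ordered bases of the directions of the faces. As both the direction of \<open>V\<close> and
  the quotient are two-dimensional, the induced orientation of the quotient does not depend on
  whether the basis of the direction of \<open>V\<close> is put first or last. For \<open>x\<close> in \<open>V\<close> and \<open>p\<close> in
  \<open>M - V\<close>, the class of \<open>p - x\<close> spans the ray of \<open>M\<close>.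
\<close>

definition positive_pair :: "(('k::linordered_field ^ 'm) set \<Rightarrow> ('k ^ 'm) list) \<Rightarrow>
    ('k ^ 'm) set \<Rightarrow> ('k ^ 'm) set \<Rightarrow> ('k ^ 'm) set \<Rightarrow> ('k ^ 'm) set \<Rightarrow> bool" where
  "positive_pair \<theta> V F M N \<longleftrightarrow>
     (\<exists>x\<in>V. \<exists>p\<in>M - V. \<exists>q\<in>N - V. same_orientation (\<theta> F) (\<theta> V @ [p - x, q - x]))"

definition intermediate_pair :: "('k::linordered_field ^ 'm) set \<Rightarrow>
    (('k ^ 'm) set \<Rightarrow> ('k ^ 'm) list) \<Rightarrow> ('k ^ 'm) set \<Rightarrow> ('k ^ 'm) set \<Rightarrow>
    ('k ^ 'm) set \<times> ('k ^ 'm) set" where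
  "intermediate_pair \<Delta> \<theta> V F = (THE (M, N).
     M \<in> faces \<Delta> 3 \<and> V \<subset> M \<and> M \<subset> F \<and> N \<in> faces \<Delta> 3 \<and> V \<subset> N \<and> N \<subset> F \<and>
     positive_pair \<theta> V F M N)"

definition M_upper where "M_upper \<Delta> \<theta> V F = fst (intermediate_pair \<Delta> \<theta> V F)"

definition M_lower where "M_lower \<Delta> \<theta> V F = snd (intermediate_pair \<Delta> \<theta> V F)"

definition flags023 :: "('k::linordered_field ^ 'm) set \<Rightarrow>
    (('k ^ 'm) \<times> ('k ^ 'm) set \<times> ('k ^ 'm) set) set" where
  "flags023 \<Delta> = {(a, V, M). a \<in> vertices \<Delta> \<and> V \<in> faces \<Delta> 2 \<and> M \<in> faces \<Delta> 3 \<and> a \<in> V \<and> V \<subset> M}"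

definition solution_space :: "('k::linordered_field ^ 'm) set \<Rightarrow>
    (('k ^ 'm) set \<Rightarrow> ('k ^ 'm) list) \<Rightarrow> (('k ^ 'm) set \<Rightarrow> ('k ^ 'm) set) \<Rightarrow>
    ('k, ('k ^ 'm) \<times> ('k ^ 'm) set \<times> ('k ^ 'm) set \<Rightarrow> 'k) vspace" where
  "solution_space \<Delta> \<theta> MV =
     \<lparr> vcarrier = {s. (\<forall>\<phi>. \<phi> \<notin> flags023 \<Delta> \<longrightarrow> s \<phi> = 0) \<and>
         (\<forall>a\<in>vertices \<Delta>. \<forall>F\<in>faces \<Delta> 4. a \<in> F \<longrightarrow>
            (\<Sum>V | V \<in> faces \<Delta> 2 \<and> a \<in> V \<and> V \<subseteq> F.
               s (a, V, M_upper \<Delta> \<theta> V F) - s (a, V, M_lower \<Delta> \<theta> V F)) = 0) \<and>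
         (\<forall>V\<in>faces \<Delta> 2. \<forall>M\<in>faces \<Delta> 3. V \<subset> M \<longrightarrow>
            (\<Sum>a | a \<in> vertices \<Delta> \<and> a \<in> V. s (a, V, M) *s lift a) = 0) \<and>
         (\<forall>a\<in>vertices \<Delta>. \<forall>V\<in>faces \<Delta> 2. a \<in> V \<longrightarrow> s (a, V, MV V) = 0)},
       vplus = (\<lambda>s t \<phi>. s \<phi> + t \<phi>),
       vscale = (\<lambda>c s \<phi>. c * s \<phi>) \<rparr>"

end

theory Submission
  imports Defs
begin

text \<open>
  Let \<open>R(Q)\<close> be the space of affine relations among the vertices of a face \<open>Q\<close>, that is, the kernel
  of the map from functions on the vertices of \<open>Q\<close> onto the span of its cone. The system of functions
  on vertices is a sum over the vertices \<open>a\<close>, and the summand of \<open>a\<close> is the cochain complex of the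
  faces containing \<open>a\<close>, which is exact. Hence the cohomology of span is that of \<open>R\<close>, shifted by one
  degree. As \<open>R\<close> vanishes on vertices and edges, the vanishing of \<open>D\<^sup>1(M)\<close> and \<open>D\<^sup>2(M)\<close> means
  that \<open>R(M)\<close> is the direct sum of the \<open>R(V)\<close> over the polygons \<open>V\<close> of \<open>M\<close>. A cochain on the
  three-dimensional faces is therefore a family of relations \<open>s(\<cdot>, V, M)\<close>, it is a cocycle iff (1)
  holds, and coboundaries are the families that do not depend on \<open>M\<close>; (3) picks one representative.

  The exactness of intervals of the face lattice is shown by sweeping: for two functionals \<open>\<xi>\<close> and
  \<open>h\<close> the faces are grouped by the minimum of the ratio \<open>\<xi>/h\<close> and by the face where it is attained,
  and every group is of the same kind in a lower dimension.
\<close>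

section \<open>Linear functionals and faces of cones\<close>

text \<open>The two vanishing conditions have separate roles. On a three-dimensional face M the
  complex of R is just the map from the sum of the R(V) to R(M); its kernel is D^1(M) and its
  cokernel is D^2(M). Injectivity makes the normalised family unique, surjectivity makes it exist.

  The obstacle is exactness over a bare ordered field, without spheres or limits. A sweep meets
  ties; they are not perturbed away but collected in the face where the ratio is attained. The
  induction has to treat the faces on the positive side of a functional and not intervals alone,
  because each group of the sweep has that shape: \<xi> - c h is positive on its members off the tie
  face, but may be negative elsewhere on the big cone.

  The other difficulty is signs. The cohomology uses orientations of cones, equation (1) uses
  orientations of faces of dimensions 2 and 4. The two differ by a factor depending on V and one
  depending on F, so rescaling s by the sign of V reconciles them.\<close>

lemma dot_add_right: "dot u (x + y) = dot u x + dot u y"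
  by (simp add: dot_def algebra_simps sum.distrib)
lemma dot_scale_right: "dot u (c *s x) = c * dot u x"
  by (simp add: dot_def algebra_simps sum_distrib_left)
lemma dot_add_left: "dot (u + v) x = dot u x + dot v x"
  by (simp add: dot_def algebra_simps sum.distrib)
lemma dot_scale_left: "dot (c *s u) x = c * dot u x"
  by (simp add: dot_def algebra_simps sum_distrib_left)
lemma dot_zero_right: "dot u 0 = 0"
  by (simp add: dot_def)
lemma dot_zero_left: "dot 0 x = 0"
  by (simp add: dot_def)
lemma dot_minus_right: "dot u (- x) = - dot u x"
  by (simp add: dot_def sum_negf)
lemma dot_minus_left: "dot (- u) x = - dot u x"
  by (simp add: dot_def sum_negf)
lemma dot_diff_right: "dot u (x - y) = dot u x - dot u y"
  by (simp add: dot_def algebra_simps sum_subtractf)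
lemma dot_diff_left: "dot (u - v) x = dot u x - dot v x"
  by (simp add: dot_def algebra_simps sum_subtractf)
lemma dot_sum_right: "dot u (\<Sum>x\<in>A. f x) = (\<Sum>x\<in>A. dot u (f x))"
  by (induction A rule: infinite_finite_induct) (auto simp: dot_zero_right dot_add_right)

lemmas dot_simps = dot_add_right dot_scale_right dot_add_left dot_scale_left dot_zero_right
  dot_zero_left dot_minus_right dot_minus_left dot_diff_right dot_diff_left dot_sum_right

lemma dot_eq_on_span:
  assumes "\<And>s. s \<in> S \<Longrightarrow> dot u s = dot v s" "x \<in> vec.span S"
  shows "dot u x = dot v x"
  using assms(2)
proof (induction rule: vec.span_induct_alt)
  case base then show ?case by (simp add: dot_simps)
next
  case (step c a y) then show ?case using assms(1) by (simp add: dot_simps)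
qed

lemma dot_zero_on_span:
  assumes "\<And>s. s \<in> S \<Longrightarrow> dot u s = 0" "x \<in> vec.span S"
  shows "dot u x = 0"
  using dot_eq_on_span[of S u 0 x] assms by (simp add: dot_simps)

lemma separating_functional:
  fixes x :: "'k::linordered_field ^ 'm"
  assumes "x \<notin> vec.span S"
  obtains u where "\<And>s. s \<in> S \<Longrightarrow> dot u s = 0" "dot u x = 1"
proof -
  obtain B where B: "B \<subseteq> S" "vec.independent B" "S \<subseteq> vec.span B"
    using vec.maximal_independent_subset by blast
  have sp: "vec.span B = vec.span S"
    using B by (metis vec.span_mono vec.span_span subset_antisym)
  have xB: "x \<notin> vec.span B" using assms sp by simp
  have ind: "vec.independent (insert x B)"
    using xB B(2) vec.independent_insertI by blast
  \<comment> \<open>Any coordinate will do: \<open>f\<close> maps \<open>x\<close> to the unit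
    vector in direction \<open>i\<close>, and the functional is row \<open>i\<close> of its
    matrix.\<close>
  fix i :: 'm
  obtain f where f: "Vector_Spaces.linear (*s) (*s) f"
    "\<And>y. y \<in> insert x B \<Longrightarrow> f y = (if y = x then axis i 1 else (0::'k^'m))"
    using vec.linear_independent_extend[OF ind, of "\<lambda>y. if y = x then axis i 1 else (0::'k^'m)"] by metis
  define u where "u = (\<chi> j. matrix f $ i $ j)"
  have du: "dot u y = f y $ i" for y
    unfolding matrix_works[OF f(1), of y, symmetric]
    by (simp add: dot_def u_def matrix_vector_mult_def)
  have "dot u s = 0" if "s \<in> S" for s
  proof (rule dot_zero_on_span)
    show "s \<in> vec.span B" using B(3) that by auto
    fix b assume "b \<in> B"
    moreover have "b \<noteq> x" using \<open>b \<in> B\<close> xB vec.span_base by blast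
    ultimately show "dot u b = 0" by (simp add: du f(2))
  qed
  moreover have "dot u x = 1" by (simp add: du f(2))
  ultimately show ?thesis using that by blast
qed

section \<open>Finitely generated cones and their faces\<close>

definition gencone :: "('k::linordered_field ^ 'm) set \<Rightarrow> ('k ^ 'm) set" where
  "gencone X = {\<Sum>x\<in>X. t x *s x | t. \<forall>x\<in>X. 0 \<le> t x}"

lemma gencone_superset: "finite X \<Longrightarrow> X \<subseteq> gencone X"
proof
  fix x assume X: "finite X" "x \<in> X"
  have "(\<Sum>y\<in>X. (if y = x then 1 else 0) *s y) = x"
    using X by (simp add: if_distrib[of "\<lambda>c. c *s _"] cong: if_cong)
  then show "x \<in> gencone X" unfolding gencone_def by (force intro!: exI[of _ "\<lambda>y. if y = x then 1 else 0"])
qed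

lemma zero_in_gencone: "0 \<in> gencone X"
  unfolding gencone_def by (force intro!: exI[of _ "\<lambda>y. 0"])

lemma gencone_subset_span: "gencone X \<subseteq> vec.span X"
  unfolding gencone_def by (auto intro: vec.span_sum vec.span_scale vec.span_base)

lemma gencone_scale: "x \<in> gencone X \<Longrightarrow> 0 \<le> c \<Longrightarrow> c *s x \<in> gencone X"
  unfolding gencone_def
proof clarify
  fix t assume "0 \<le> c" "\<forall>x\<in>X. (0::'a) \<le> t x" 
  then show "\<exists>v. c *s (\<Sum>x\<in>X. t x *s x) = (\<Sum>x\<in>X. v x *s x) \<and> (\<forall>x\<in>X. 0 \<le> v x)"
    by (intro exI[of _ "\<lambda>x. c * t x"]) (auto simp: vec.scale_sum_right)
qed

lemma dot_nonneg_gencone: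
  "(\<And>x. x \<in> X \<Longrightarrow> 0 \<le> dot u x) \<Longrightarrow> y \<in> gencone X \<Longrightarrow> 0 \<le> dot u y"
  unfolding gencone_def by (auto simp: dot_simps intro!: sum_nonneg mult_nonneg_nonneg)

text \<open>A sum of nonnegative terms vanishes only if every term does, so only generators with
  value 0 can occur.\<close>

lemma gencone_zero_locus:
  assumes X: "finite X" and u: "\<And>x. x \<in> X \<Longrightarrow> 0 \<le> dot u x"
  shows "{y \<in> gencone X. dot u y = 0} = gencone {x \<in> X. dot u x = 0}"
proof (intro subset_antisym subsetI)
  fix y assume "y \<in> {y \<in> gencone X. dot u y = 0}"
  then obtain t where t: "\<And>x. x \<in> X \<Longrightarrow> 0 \<le> t x" "y = (\<Sum>x\<in>X. t x *s x)" "dot u y = 0"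
    unfolding gencone_def by auto
  have "(\<Sum>x\<in>X. t x * dot u x) = 0" using t(2,3) by (simp add: dot_simps)
  then have z: "t x * dot u x = 0" if "x \<in> X" for x
    using X that t(1) u by (simp add: sum_nonneg_eq_0_iff)
  have "y = (\<Sum>x\<in>{x \<in> X. dot u x = 0}. t x *s x)"
    unfolding t(2) using X z by (intro sum.mono_neutral_right) auto
  then show "y \<in> gencone {x \<in> X. dot u x = 0}" unfolding gencone_def using t(1) by auto
next
  fix y assume "y \<in> gencone {x \<in> X. dot u x = 0}"
  then obtain t where t: "\<And>x. x \<in> X \<Longrightarrow> dot u x = 0 \<Longrightarrow> 0 \<le> t x" "y = (\<Sum>x\<in>{x \<in> X. dot u x = 0}. t x *s x)"
    unfolding gencone_def by auto
  have "y = (\<Sum>x\<in>X. (if dot u x = 0 then t x else 0) *s x)"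
    unfolding t(2) using X by (intro sum.mono_neutral_cong_left) auto
  then have "y \<in> gencone X" unfolding gencone_def using t(1) by auto
  moreover have "dot u y = 0" unfolding t(2) by (simp add: dot_simps)
  ultimately show "y \<in> {y \<in> gencone X. dot u y = 0}" by auto
qed

definition fgcone :: "('k::linordered_field ^ 'm) set \<Rightarrow> bool" where
  "fgcone \<sigma> \<longleftrightarrow> (\<exists>X. finite X \<and> \<sigma> = gencone X)"

text \<open>A face is determined by the generators in it. This makes the fan finite and lets
  equality of faces be tested on generators.\<close>

lemma gencone_face_eq:
  assumes X: "finite X" and "cone_face \<tau> (gencone X)"
  shows "\<tau> = gencone (X \<inter> \<tau>)"
proof -
  obtain u where u: "\<And>x. x \<in> gencone X \<Longrightarrow> 0 \<le> dot u x" "\<tau> = {x \<in> gencone X. dot u x = 0}"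
    using assms(2) unfolding cone_face_def by auto
  have XX: "X \<subseteq> gencone X" using gencone_superset X by auto
  have "\<tau> = gencone {x \<in> X. dot u x = 0}"
    using gencone_zero_locus[OF X, of u] u XX by blast
  also have "{x \<in> X. dot u x = 0} = X \<inter> \<tau>" using u(2) XX by auto
  finally show ?thesis .
qed

lemma fgcone_face: "fgcone \<sigma> \<Longrightarrow> cone_face \<tau> \<sigma> \<Longrightarrow> fgcone \<tau>"
  unfolding fgcone_def using gencone_face_eq by (metis finite_Int)

lemma cone_face_subset: "cone_face \<tau> \<sigma> \<Longrightarrow> \<tau> \<subseteq> \<sigma>"
  by (auto simp: cone_face_def)

lemma cone_face_refl: "cone_face \<sigma> \<sigma>"
  unfolding cone_face_def by (intro exI[of _ 0]) (auto simp: dot_simps)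

lemma finite_face_fan: assumes "fgcone \<sigma>" shows "finite (face_fan \<sigma>)"
proof -
  obtain X where X: "finite X" "\<sigma> = gencone X" using assms by (auto simp: fgcone_def)
  have "face_fan \<sigma> \<subseteq> gencone ` Pow X"
    unfolding face_fan_def X(2) using gencone_face_eq[OF X(1)] by blast
  then show ?thesis using X(1) finite_surj by blast
qed

lemma cone_face_trans:
  assumes fg: "fgcone \<sigma>" and 1: "cone_face \<tau> \<sigma>" and 2: "cone_face \<rho> \<tau>"
  shows "cone_face \<rho> \<sigma>"
proof -
  obtain X where X: "finite X" "\<sigma> = gencone X" using fg by (auto simp: fgcone_def)
  have XX: "X \<subseteq> \<sigma>" using gencone_superset X by auto
  obtain u where u: "\<And>x. x \<in> \<sigma> \<Longrightarrow> 0 \<le> dot u x" "\<tau> = {x \<in> \<sigma>. dot u x = 0}"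
    using 1 unfolding cone_face_def by auto
  obtain w where w: "\<And>x. x \<in> \<tau> \<Longrightarrow> 0 \<le> dot w x" "\<rho> = {x \<in> \<tau>. dot w x = 0}"
    using 2 unfolding cone_face_def by auto
  \<comment> \<open>On generators off \<open>\<tau>\<close> the functional \<open>u\<close> is
    strictly positive, so a large multiple of it outweighs the negative values of \<open>w\<close>;
    finitely many generators give the bound.\<close>
  obtain N where N: "N > 0" "\<And>x. x \<in> X - \<tau> \<Longrightarrow> - dot w x / dot u x < N"
  proof -
    let ?A = "insert 0 ((\<lambda>x. - dot w x / dot u x) ` (X - \<tau>))"
    have "finite ?A" using X by auto
    then have "\<forall>a\<in>?A. a < Max ?A + 1"
      by (meson Max_ge le_less_trans less_add_one)
    then show ?thesis using that[of "Max ?A + 1"] by auto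
  qed
  have pos: "0 < dot (N *s u + w) x" if "x \<in> X - \<tau>" for x
  proof -
    have "dot u x > 0" using that u XX by (metis (mono_tags, lifting) DiffD1 DiffD2 mem_Collect_eq order_le_less subsetD)
    then show ?thesis using N(2)[OF that] by (simp add: dot_simps field_simps)
  qed
  have nn: "0 \<le> dot (N *s u + w) x" if "x \<in> X" for x
  proof (cases "x \<in> \<tau>")
    case True then show ?thesis using u w by (auto simp: dot_simps)
  next
    case False then show ?thesis using pos that by fastforce
  qed
  have "{y \<in> \<sigma>. dot (N *s u + w) y = 0} = gencone {x \<in> X. dot (N *s u + w) x = 0}"
    unfolding X(2) by (rule gencone_zero_locus[OF X(1) nn])
  also have "{x \<in> X. dot (N *s u + w) x = 0} = X \<inter> \<rho>"
  proof -
    have "x \<in> X \<Longrightarrow> dot (N *s u + w) x = 0 \<longleftrightarrow> x \<in> \<rho>" for x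
      using pos[of x] u(2) w(2) by (cases "x \<in> \<tau>") (auto simp: dot_simps)
    then show ?thesis by auto
  qed
  also have "X \<inter> \<rho> = (X \<inter> \<tau>) \<inter> \<rho>" using w(2) by auto
  also have "gencone \<dots> = \<rho>"
    using gencone_face_eq[of "X \<inter> \<tau>" \<rho>] gencone_face_eq[of X \<tau>] X 1 2 by simp
  finally have "\<rho> = {y \<in> \<sigma>. dot (N *s u + w) y = 0}" by simp
  moreover have "\<forall>x\<in>\<sigma>. 0 \<le> dot (N *s u + w) x"
    using dot_nonneg_gencone[OF nn] X(2) by blast
  ultimately show ?thesis unfolding cone_face_def by blast
qed

lemma cone_face_mono: "cone_face \<tau> \<sigma> \<Longrightarrow> \<mu> \<subseteq> \<sigma> \<Longrightarrow> \<tau> \<subseteq> \<mu> \<Longrightarrow> cone_face \<tau> \<mu>"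
  unfolding cone_face_def by blast

lemma cone_face_in_fan:
  "\<tau> \<in> face_fan \<sigma> \<Longrightarrow> \<mu> \<in> face_fan \<sigma> \<Longrightarrow> cone_face \<tau> \<mu> \<longleftrightarrow> \<tau> \<subseteq> \<mu>"
  unfolding face_fan_def using cone_face_mono cone_face_subset by blast

text \<open>The functional defining a face vanishes on its span. Hence nested faces with equal spans
  coincide, which is why dimension is strictly monotone on faces.\<close>

lemma cone_face_span_Int: "cone_face \<tau> \<sigma> \<Longrightarrow> \<tau> = \<sigma> \<inter> vec.span \<tau>"
  unfolding cone_face_def by (auto intro: vec.span_base dot_zero_on_span)

lemma vdim_strict:
  assumes "cone_face \<tau> \<sigma>" "\<tau> \<noteq> \<sigma>" shows "vec.dim \<tau> < vec.dim \<sigma>"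
proof -
  have "\<tau> \<subseteq> \<sigma>" using assms cone_face_subset by auto
  then have le: "vec.dim \<tau> \<le> vec.dim \<sigma>" by (rule vec.dim_subset)
  have "vec.span \<tau> = vec.span \<sigma>" if "vec.dim \<sigma> \<le> vec.dim \<tau>"
    using \<open>\<tau> \<subseteq> \<sigma>\<close> that vec.dim_eq_span by blast
  then show ?thesis using cone_face_span_Int[OF assms(1)] assms(2) le
    by (metis inf.absorb1 not_le vec.span_superset)
qed

section \<open>Faces where the ratio of two functionals is extremal\<close>

lemma face_span_pair:
  fixes \<sigma> :: "('k::linordered_field^'m) set"
  assumes "\<tau> \<subseteq> \<sigma>" "vec.dim \<tau> + 2 \<le> vec.dim \<sigma>" "x \<in> \<sigma>"
  obtains y where "y \<in> \<sigma>" "y \<notin> vec.span (insert x \<tau>)"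
proof -
  have "vec.dim (insert x \<tau>) \<le> vec.dim \<tau> + 1" by (simp add: vec.dim_insert)
  then have "\<not> \<sigma> \<subseteq> vec.span (insert x \<tau>)"
    using assms(2) vec.dim_mono[of \<sigma> "insert x \<tau>"] by (metis add_2_eq_Suc' not_less_eq_eq Suc_eq_plus1 le_trans)
  then show ?thesis using that by auto
qed

text \<open>No completeness of the field is involved: the minimum over the finitely many generators
  with \<open>dot u z > 0\<close> is the minimum on the whole cone. On the other generators both
  functionals vanish, so the inequality holds there too.\<close>

lemma ratio_face_min:
  fixes \<nu> :: "('k::linordered_field ^ 'm) set"
  assumes fg: "fgcone \<nu>"
    and u: "\<And>z. z \<in> \<nu> \<Longrightarrow> 0 \<le> dot u z"
    and w: "\<And>z. z \<in> \<nu> \<Longrightarrow> dot u z = 0 \<Longrightarrow> dot w z = 0"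
    and ne: "x \<in> \<nu>" "dot u x > 0"
  obtains p a where "p \<in> \<nu>" "dot u p > 0" "dot w p = a * dot u p"
    "\<forall>z\<in>\<nu>. a * dot u z \<le> dot w z"
proof -
  obtain X where X: "finite X" "\<nu> = gencone X" using fg by (auto simp: fgcone_def)
  have XX: "X \<subseteq> \<nu>" using gencone_superset X by auto
  define Y where "Y = {z \<in> X. dot u z > 0}"
  have "Y \<noteq> {}"
  proof
    assume "Y = {}"
    then have "dot u z = 0" if "z \<in> X" for z
      using u[of z] that XX by (auto simp: Y_def order_le_less)
    moreover have "x \<in> vec.span X" using ne(1) X(2) gencone_subset_span by auto
    ultimately have "dot u x = 0" by (rule dot_zero_on_span)
    then show False using ne by simp
  qed
  define r where "r = (\<lambda>z. dot w z / dot u z)"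
  have fY: "finite Y" using X by (simp add: Y_def)
  have "Min (r ` Y) \<in> r ` Y" using fY \<open>Y \<noteq> {}\<close> by (intro Min_in) auto
  then obtain p where p: "p \<in> Y" "r p = Min (r ` Y)" by auto
  have le: "r p \<le> r z" if "z \<in> Y" for z using p(2) fY that by auto
  have "0 \<le> dot (w - r p *s u) z" if "z \<in> X" for z
  proof (cases "z \<in> Y")
    case True
    then show ?thesis using le[OF True] by (simp add: r_def Y_def dot_simps field_simps)
  next
    case False
    then have "dot u z = 0" using u[of z] that XX by (auto simp: Y_def order_le_less)
    then show ?thesis using w[of z] that XX by (auto simp: dot_simps)
  qed
  then have "0 \<le> dot (w - r p *s u) z" if "z \<in> \<nu>" for z
    using dot_nonneg_gencone that X(2) by blast
  then show ?thesis using p(1) XX that[of p "r p"]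
    by (auto simp: dot_simps r_def Y_def)
qed

lemma ratio_face:
  assumes "\<forall>z\<in>\<nu>. a * dot u z \<le> dot w z"
  shows "cone_face {z \<in> \<nu>. dot w z = a * dot u z} \<nu>"
  unfolding cone_face_def using assms by (intro exI[of _ "w - a *s u"]) (auto simp: dot_simps)

lemma face_functional:
  assumes "cone_face \<tau> \<nu>" "\<tau> \<noteq> \<nu>"
  obtains u x where "\<And>z. z \<in> \<nu> \<Longrightarrow> 0 \<le> dot u z" "\<tau> = {z \<in> \<nu>. dot u z = 0}" "x \<in> \<nu>" "dot u x > 0"
proof -
  obtain u where u: "\<And>z. z \<in> \<nu> \<Longrightarrow> 0 \<le> dot u z" "\<tau> = {z \<in> \<nu>. dot u z = 0}"
    using assms unfolding cone_face_def by blast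
  then obtain x where "x \<in> \<nu>" "dot u x \<noteq> 0" using assms(2) by blast
  then show ?thesis using that[of u x] u by (simp add: order_less_le)
qed

text \<open>Modulo the span of \<open>\<tau>\<close> the cone still has dimension at least 2. The
  ratio \<open>w/u\<close> is 0 at \<open>x\<close> and nonzero at \<open>y\<close>, so it is not
  constant and its extreme values are attained on proper faces.\<close>

lemma transverse_functional:
  fixes \<nu> :: "('k::linordered_field ^ 'm) set"
  assumes f: "cone_face \<tau> \<nu>" and d: "vec.dim \<tau> + 2 \<le> vec.dim \<nu>"
  obtains u w x y where "\<forall>z\<in>\<nu>. 0 \<le> dot u z" "\<tau> = {z \<in> \<nu>. dot u z = 0}"
    "\<forall>z\<in>\<tau>. dot w z = 0" "x \<in> \<nu>" "y \<in> \<nu>" "dot u x > 0" "dot w x = 0" "dot w y = 1"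
    "y \<notin> vec.span (insert x \<tau>)" "x \<notin> \<tau>"
proof -
  have ne: "\<tau> \<noteq> \<nu>" using d by auto
  obtain u x where u: "\<And>z. z \<in> \<nu> \<Longrightarrow> 0 \<le> dot u z" "\<tau> = {z \<in> \<nu>. dot u z = 0}"
    and x: "x \<in> \<nu>" "dot u x > 0"
    using face_functional[OF f ne] by metis
  obtain y where y: "y \<in> \<nu>" "y \<notin> vec.span (insert x \<tau>)"
    using face_span_pair[OF cone_face_subset[OF f] d x(1)] .
  obtain w where w: "\<And>s. s \<in> insert x \<tau> \<Longrightarrow> dot w s = 0" "dot w y = 1"
    using separating_functional[OF y(2)] by metis
  have "x \<notin> \<tau>" using u(2) x by auto
  then show ?thesis using that[OF _ u(2) _ x(1) y(1) x(2) _ w(2) y(2)] w(1) u(1) by blast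
qed

text \<open>The face where \<open>w/u\<close> is minimal contains \<open>\<tau>\<close> because both
  functionals vanish there, contains more because the minimum is attained off \<open>\<tau>\<close>,
  and is proper because the ratio is not constant.\<close>

lemma intermediate_face:
  fixes \<nu> :: "('k::linordered_field ^ 'm) set"
  assumes fg: "fgcone \<nu>" and f: "cone_face \<tau> \<nu>" and d: "vec.dim \<tau> + 2 \<le> vec.dim \<nu>"
  obtains \<mu> where "cone_face \<mu> \<nu>" "\<tau> \<subset> \<mu>" "\<mu> \<subset> \<nu>"
proof -
  obtain u w x y where u': "\<forall>z\<in>\<nu>. 0 \<le> dot u z" and u2: "\<tau> = {z \<in> \<nu>. dot u z = 0}"
    and w': "\<forall>z\<in>\<tau>. dot w z = 0" and xy: "x \<in> \<nu>" "y \<in> \<nu>" "dot u x > 0" "dot w x = 0" "dot w y = 1"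
    "y \<notin> vec.span (insert x \<tau>)" "x \<notin> \<tau>"
    by (rule transverse_functional[OF f d])
  note u = u'[rule_format] u2 and w = w'[rule_format]
  have wz: "\<And>z. z \<in> \<nu> \<Longrightarrow> dot u z = 0 \<Longrightarrow> dot w z = 0" using u(2) w by auto
  obtain p a where a: "p \<in> \<nu>" "dot u p > 0" "dot w p = a * dot u p"
    "\<forall>z\<in>\<nu>. a * dot u z \<le> dot w z"
    by (rule ratio_face_min[OF fg u(1) wz xy(1) xy(3)])
  let ?\<mu> = "{z \<in> \<nu>. dot w z = a * dot u z}"
  have "\<not> (x \<in> ?\<mu> \<and> y \<in> ?\<mu>)" using xy(3-5) by (cases "a = 0") auto
  then have "?\<mu> \<subset> \<nu>" using xy(1,2) by blast
  moreover have "\<tau> \<subset> ?\<mu>"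
  proof
    show "\<tau> \<subseteq> ?\<mu>" using u(2) w by auto
    have "p \<in> ?\<mu>" "p \<notin> \<tau>" using a(1-3) u(2) by auto
    then show "\<tau> \<noteq> ?\<mu>" by blast
  qed
  ultimately show ?thesis using that[OF ratio_face[OF a(4)]] by blast
qed

text \<open>Modulo the span of \<open>\<tau>\<close> the cone is a planar sector. Its two edges are
  the faces where \<open>w/u\<close> is minimal and where it is maximal.\<close>

lemma diamond:
  fixes \<nu> :: "('k::linordered_field ^ 'm) set"
  assumes fg: "fgcone \<nu>" and f: "cone_face \<tau> \<nu>" and d: "vec.dim \<nu> = vec.dim \<tau> + 2"
  obtains \<mu>1 \<mu>2 where "\<mu>1 \<noteq> \<mu>2" "{\<mu>. cone_face \<mu> \<nu> \<and> \<tau> \<subset> \<mu> \<and> \<mu> \<subset> \<nu>} = {\<mu>1, \<mu>2}" "\<mu>1 \<inter> \<mu>2 = \<tau>"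
proof -
  obtain u w x y where u': "\<forall>z\<in>\<nu>. 0 \<le> dot u z" and u2: "\<tau> = {z \<in> \<nu>. dot u z = 0}"
    and w': "\<forall>z\<in>\<tau>. dot w z = 0" and xy: "x \<in> \<nu>" "y \<in> \<nu>" "dot u x > 0" "dot w x = 0" "dot w y = 1"
    "y \<notin> vec.span (insert x \<tau>)" "x \<notin> \<tau>"
    by (rule transverse_functional[OF f]) (use d in auto)
  note u = u'[rule_format] u2 and w = w'[rule_format]
  have wz: "\<And>z. z \<in> \<nu> \<Longrightarrow> dot u z = 0 \<Longrightarrow> dot w z = 0" using u(2) w by auto
  then have wz': "\<And>z. z \<in> \<nu> \<Longrightarrow> dot u z = 0 \<Longrightarrow> dot (- w) z = 0" by (simp add: dot_simps)
  obtain p a where a: "p \<in> \<nu>" "dot u p > 0" "dot w p = a * dot u p"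
    "\<forall>z\<in>\<nu>. a * dot u z \<le> dot w z"
    by (rule ratio_face_min[OF fg u(1) wz xy(1) xy(3)])
  obtain q b where b: "q \<in> \<nu>" "dot u q > 0" "dot (- w) q = b * dot u q"
    "\<forall>z\<in>\<nu>. b * dot u z \<le> dot (- w) z"
    by (rule ratio_face_min[OF fg u(1) wz' xy(1) xy(3)])
  define \<mu>1 \<mu>2 where d1: "\<mu>1 = {z \<in> \<nu>. dot w z = a * dot u z}"
    and d2: "\<mu>2 = {z \<in> \<nu>. dot (- w) z = b * dot u z}"
  \<comment> \<open>Equality would make the minimum and the maximum of \<open>w/u\<close> agree, so
    the ratio would be constant.\<close>
  have ab: "a \<noteq> - b"
  proof
    assume ab: "a = - b"
    have "dot w z = a * dot u z" if "z \<in> \<nu>" for z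
      using a(4)[rule_format, OF that] b(4)[rule_format, OF that] ab by (simp add: dot_simps)
    from this[OF xy(1)] this[OF xy(2)] xy(3-5) show False by simp
  qed
  have int: "\<mu>1 \<inter> \<mu>2 = \<tau>"
  proof -
    have "dot u z = 0" if "dot w z = a * dot u z" "dot (- w) z = b * dot u z" for z
    proof -
      have "(a + b) * dot u z = 0" using that by (simp add: dot_simps algebra_simps)
      then show ?thesis using ab by (simp add: eq_neg_iff_add_eq_0)
    qed
    then show ?thesis unfolding d1 d2 using u(2) w by (auto simp: dot_simps)
  qed
  have p: "p \<in> \<mu>1" "p \<notin> \<tau>" and q: "q \<in> \<mu>2" "q \<notin> \<tau>" unfolding d1 d2 using a(1-3) b(1-3) u(2) by auto
  have xyn: "\<not> (x \<in> \<mu>1 \<and> y \<in> \<mu>1)" "\<not> (x \<in> \<mu>2 \<and> y \<in> \<mu>2)"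
    unfolding d1 d2 using xy(3-5) by (cases "a = 0"; cases "b = 0"; simp add: dot_simps)+
  have 1: "cone_face \<mu>1 \<nu> \<and> \<tau> \<subset> \<mu>1 \<and> \<mu>1 \<subset> \<nu>"
  proof (intro conjI psubsetI)
    show "cone_face \<mu>1 \<nu>" unfolding d1 by (rule ratio_face[OF a(4)])
    show "\<tau> \<subseteq> \<mu>1" using int by blast
    show "\<tau> \<noteq> \<mu>1" using p by metis
    show "\<mu>1 \<subseteq> \<nu>" unfolding d1 by (rule Collect_restrict)
    show "\<mu>1 \<noteq> \<nu>" using xyn(1) xy(1,2) by metis
  qed
  have 2: "cone_face \<mu>2 \<nu> \<and> \<tau> \<subset> \<mu>2 \<and> \<mu>2 \<subset> \<nu>"
  proof (intro conjI psubsetI)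
    show "cone_face \<mu>2 \<nu>" unfolding d2 by (rule ratio_face[OF b(4)])
    show "\<tau> \<subseteq> \<mu>2" using int by blast
    show "\<tau> \<noteq> \<mu>2" using q by metis
    show "\<mu>2 \<subseteq> \<nu>" unfolding d2 by (rule Collect_restrict)
    show "\<mu>2 \<noteq> \<nu>" using xyn(2) xy(1,2) by metis
  qed
  \<comment> \<open>\<open>\<tau>\<close>, \<open>x\<close> and \<open>y\<close> span everything by
    a dimension count, so a functional vanishing on \<open>\<tau>\<close> is determined on
    \<open>\<nu>\<close> by its values at \<open>x\<close> and \<open>y\<close>.\<close>
  have sp: "\<nu> \<subseteq> vec.span (insert y (insert x \<tau>))"
  proof -
    have sub: "insert y (insert x \<tau>) \<subseteq> \<nu>" using xy cone_face_subset[OF f] by auto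
    have "x \<notin> vec.span \<tau>" using xy(1,7) cone_face_span_Int[OF f] by auto
    then have "vec.dim (insert y (insert x \<tau>)) = vec.dim \<nu>"
      using xy(6) d by (simp add: vec.dim_insert)
    then show ?thesis using vec.dim_eq_span[OF sub] by (metis eq_imp_le vec.span_superset)
  qed
  have any: "\<mu> = \<mu>1 \<or> \<mu> = \<mu>2" if \<mu>: "cone_face \<mu> \<nu>" "\<tau> \<subset> \<mu>" "\<mu> \<subset> \<nu>" for \<mu>
  proof -
    obtain v where v: "\<And>z. z \<in> \<nu> \<Longrightarrow> 0 \<le> dot v z" "\<mu> = {z \<in> \<nu>. dot v z = 0}"
      using \<mu>(1) unfolding cone_face_def by blast
    \<comment> \<open>Solves \<open>v = c u + e w\<close> at \<open>x\<close>, where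
      \<open>w\<close> is 0, and then at \<open>y\<close>, where \<open>w\<close> is 1. The sign of
      \<open>e\<close> decides which of the two edges \<open>v\<close> cuts out.\<close>
    define c e where "c = dot v x / dot u x" and "e = dot v y - c * dot u y"
    have veq: "dot v z = c * dot u z + e * dot w z" if "z \<in> \<nu>" for z
    proof -
      have "dot v z = dot (c *s u + e *s w) z"
      proof (rule dot_eq_on_span)
        show "z \<in> vec.span (insert y (insert x \<tau>))" using that sp by auto
        fix s assume "s \<in> insert y (insert x \<tau>)"
        moreover have "dot v s = 0 \<and> dot u s = 0 \<and> dot w s = 0" if "s \<in> \<tau>"
          using that \<mu>(2) v(2) u(2) w by blast
        ultimately show "dot v s = dot (c *s u + e *s w) s"
          using xy(3-5) by (elim insertE) (auto simp: dot_simps c_def e_def)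
      qed
      then show ?thesis by (simp add: dot_simps)
    qed
    obtain z0 where z0: "z0 \<in> \<mu>" "z0 \<notin> \<tau>" using \<mu>(2) by blast
    have z0': "z0 \<in> \<nu>" "dot v z0 = 0" using z0 v(2) by auto
    have uz0: "dot u z0 > 0" using z0(2) z0'(1) u(1)[OF z0'(1)] unfolding u(2) by (simp add: order_less_le)
    have e0: "c * dot u z0 + e * dot w z0 = 0" using veq[OF z0'(1)] z0'(2) by simp
    have "e \<noteq> 0"
    proof
      assume "e = 0"
      then have "c = 0" using e0 uz0 by simp
      then have "\<mu> = \<nu>" unfolding v(2) using veq \<open>e = 0\<close> by auto
      then show False using \<mu>(3) by simp
    qed
    then consider "e > 0" | "e < 0" by linarith
    then show ?thesis
    proof cases
      case 1
      \<comment> \<open>Nonnegativity of \<open>v\<close> at the minimiser \<open>p\<close> gives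
        \<open>c + e a \<ge> 0\<close>; its vanishing at \<open>z0\<close>, a point of
        \<open>\<mu>\<close> off \<open>\<tau>\<close>, gives the reverse inequality.\<close>
      have "0 \<le> c * dot u p + e * dot w p" using veq[OF a(1)] v(1)[OF a(1)] by simp
      then have "0 \<le> (c + e * a) * dot u p" using a(3) by (simp add: algebra_simps)
      then have A: "0 \<le> c + e * a" using a(2) by (simp add: zero_le_mult_iff)
      have "e * (a * dot u z0) \<le> e * dot w z0" using a(4)[rule_format, OF z0'(1)] 1 by simp
      then have "(c + e * a) * dot u z0 \<le> 0" using e0 by (simp add: algebra_simps)
      then have "c + e * a = 0" using A uz0 by (simp add: mult_le_0_iff)
      then have c: "c = - (e * a)" by (simp add: eq_neg_iff_add_eq_0)
      have "dot v z = 0 \<longleftrightarrow> dot w z = a * dot u z" if "z \<in> \<nu>" for z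
      proof -
        have "dot v z = e * (dot w z - a * dot u z)" using veq[OF that] c by (simp add: algebra_simps)
        then show ?thesis using 1 by simp
      qed
      then have "\<mu> = \<mu>1" unfolding v(2) d1 by (intro Collect_cong) blast
      then show ?thesis by (rule disjI1)
    next
      case 2
      have "0 \<le> c * dot u q + e * dot w q" using veq[OF b(1)] v(1)[OF b(1)] by simp
      moreover have wq: "dot w q = - (b * dot u q)" using b(3) by (simp add: dot_simps minus_equation_iff[of "dot w q"])
      ultimately have "0 \<le> (c - e * b) * dot u q" by (simp add: algebra_simps)
      then have A: "0 \<le> c - e * b" using b(2) by (simp add: zero_le_mult_iff)
      have "- e * (b * dot u z0) \<le> - e * (- dot w z0)"
        using b(4)[rule_format, OF z0'(1)] 2 by (intro mult_left_mono) (auto simp: dot_simps)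
      then have "(c - e * b) * dot u z0 \<le> 0" using e0 by (simp add: algebra_simps)
      then have "c - e * b = 0" using A uz0 by (simp add: mult_le_0_iff)
      then have c: "c = e * b" by simp
      have "dot v z = 0 \<longleftrightarrow> dot (- w) z = b * dot u z" if "z \<in> \<nu>" for z
      proof -
        have "dot v z = e * (b * dot u z - dot (- w) z)" using veq[OF that] c
          by (simp add: algebra_simps dot_simps)
        then show ?thesis using 2 by auto
      qed
      then have "\<mu> = \<mu>2" unfolding v(2) d2 by (intro Collect_cong) blast
      then show ?thesis by (rule disjI2)
    qed
  qed
  have ne: "\<mu>1 \<noteq> \<mu>2" using int p by (metis Int_absorb)
  have eq: "{\<mu>. cone_face \<mu> \<nu> \<and> \<tau> \<subset> \<mu> \<and> \<mu> \<subset> \<nu>} = {\<mu>1, \<mu>2}"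
  proof (intro subset_antisym subsetI)
    fix \<mu> assume "\<mu> \<in> {\<mu>. cone_face \<mu> \<nu> \<and> \<tau> \<subset> \<mu> \<and> \<mu> \<subset> \<nu>}"
    then show "\<mu> \<in> {\<mu>1, \<mu>2}" using any by blast
  next
    fix \<mu> assume "\<mu> \<in> {\<mu>1, \<mu>2}"
    then show "\<mu> \<in> {\<mu>. cone_face \<mu> \<nu> \<and> \<tau> \<subset> \<mu> \<and> \<mu> \<subset> \<nu>}" using 1 2 by blast
  qed
  show ?thesis using that[OF ne eq int] .
qed

section \<open>Orientations and determinants\<close>

text \<open>Keeps the determinant itself where \<open>same_orientation\<close> records only its
  sign, so that changes of basis compose by multiplication. The list \<open>bs\<close> may be
  dependent; \<open>theta_degenerate\<close> relies on that.\<close>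

definition rel_det :: "('k::linordered_field ^ 'm) list \<Rightarrow> ('k ^ 'm) list \<Rightarrow> 'k \<Rightarrow> bool" where
  "rel_det bs cs d \<longleftrightarrow> length cs = length bs \<and>
     (\<exists>A. (\<forall>j<length bs. cs ! j = (\<Sum>i<length bs. A i j *s bs ! i)) \<and>
          d = Determinant.det (Matrix.mat (length bs) (length bs) (\<lambda>(i, j). A i j)))"

lemma same_orientation_rel_det: "same_orientation bs cs \<longleftrightarrow> (\<exists>d>0. rel_det bs cs d)"
  unfolding same_orientation_def rel_det_def by auto

lemma rel_det_trans:
  assumes "rel_det bs cs d" "rel_det cs ds e" shows "rel_det bs ds (d * e)"
proof -
  let ?n = "length bs"
  obtain A where A: "length cs = ?n" "\<forall>j<?n. cs ! j = (\<Sum>i<?n. A i j *s bs ! i)"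
    "d = Determinant.det (Matrix.mat ?n ?n (\<lambda>(i, j). A i j))"
    using assms(1) unfolding rel_det_def by auto
  obtain B where B: "length ds = ?n" "\<forall>j<?n. ds ! j = (\<Sum>i<?n. B i j *s cs ! i)"
    "e = Determinant.det (Matrix.mat ?n ?n (\<lambda>(i, j). B i j))"
    using assms(2) A(1) unfolding rel_det_def by auto
  let ?C = "\<lambda>i l. \<Sum>j<?n. A i j * B j l"
  have "ds ! l = (\<Sum>i<?n. ?C i l *s bs ! i)" if "l < ?n" for l
  proof -
    have "ds ! l = (\<Sum>j<?n. B j l *s (\<Sum>i<?n. A i j *s bs ! i))"
      using that A(2) B(2) by simp
    also have "\<dots> = (\<Sum>j<?n. \<Sum>i<?n. (A i j * B j l) *s bs ! i)"
      by (simp add: vec.scale_sum_right mult.commute)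
    also have "\<dots> = (\<Sum>i<?n. ?C i l *s bs ! i)"
      by (subst sum.swap) (simp add: vec.scale_sum_left)
    finally show ?thesis .
  qed
  moreover have "Matrix.mat ?n ?n (\<lambda>(i, j). ?C i j) =
      Matrix.mat ?n ?n (\<lambda>(i, j). A i j) * Matrix.mat ?n ?n (\<lambda>(i, j). B i j)"
    by (rule eq_matI) (auto simp: scalar_prod_def atLeast0LessThan)
  then have "d * e = Determinant.det (Matrix.mat ?n ?n (\<lambda>(i, j). ?C i j))"
    using det_mult[of "Matrix.mat ?n ?n (\<lambda>(i, j). A i j)" ?n "Matrix.mat ?n ?n (\<lambda>(i, j). B i j)"]
    by (simp add: A(3) B(3))
  ultimately show ?thesis unfolding rel_det_def using B(1) by (intro conjI exI[of _ ?C]) auto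
qed

lemma list_coords_zero:
  fixes bs :: "('k::field ^ 'm) list"
  assumes "distinct bs" "vec.independent (set bs)" "(\<Sum>i<length bs. a i *s bs ! i) = 0" "i < length bs"
  shows "a i = 0"
proof -
  let ?n = "length bs"
  have bij: "bij_betw ((!) bs) {..<?n} (set bs)" using bij_betw_nth[OF assms(1)] by auto
  define f where "f = (\<lambda>b. a (the_inv_into {..<?n} ((!) bs) b))"
  have fi: "f (bs ! i) = a i" if "i < ?n" for i
    unfolding f_def using bij that by (simp add: bij_betw_def the_inv_into_f_f)
  have "(\<Sum>b\<in>set bs. f b *s b) = (\<Sum>i<?n. f (bs ! i) *s bs ! i)"
    by (rule sum.reindex_bij_betw[OF bij, symmetric])
  also have "\<dots> = 0" using assms(3) fi by simp
  finally have "f (bs ! i) = 0"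
    using vec.independentD[OF assms(2) finite_set subset_refl] assms(4) by simp
  then show ?thesis using fi assms(4) by simp
qed

lemma rel_det_unique:
  assumes "distinct bs" "vec.independent (set bs)" "rel_det bs cs d" "rel_det bs cs e"
  shows "d = e"
proof -
  let ?n = "length bs"
  obtain A where A: "\<forall>j<?n. cs ! j = (\<Sum>i<?n. A i j *s bs ! i)"
    "d = Determinant.det (Matrix.mat ?n ?n (\<lambda>(i, j). A i j))"
    using assms(3) unfolding rel_det_def by auto
  obtain B where B: "\<forall>j<?n. cs ! j = (\<Sum>i<?n. B i j *s bs ! i)"
    "e = Determinant.det (Matrix.mat ?n ?n (\<lambda>(i, j). B i j))"
    using assms(4) unfolding rel_det_def by auto
  have "A i j = B i j" if "i < ?n" "j < ?n" for i j
  proof -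
    have "(\<Sum>i<?n. (A i j - B i j) *s bs ! i) = 0"
      using A(1) B(1) that(2) by (simp add: vec.scale_left_diff_distrib sum_subtractf)
    from list_coords_zero[OF assms(1,2) this that(1)] show ?thesis by simp
  qed
  then have "Matrix.mat ?n ?n (\<lambda>(i, j). A i j) = Matrix.mat ?n ?n (\<lambda>(i, j). B i j)"
    by (intro eq_matI) auto
  then show ?thesis using A(2) B(2) by simp
qed

lemma span_list_coords:
  assumes "x \<in> vec.span (set bs)"
  shows "\<exists>a. x = (\<Sum>i<length bs. a i *s bs ! i)"
  using assms
proof (induction bs arbitrary: x)
  case Nil then show ?case by simp
next
  case (Cons b bs)
  then obtain k where "x - k *s b \<in> vec.span (set bs)" by (auto simp: vec.span_insert)
  then obtain a where a: "x - k *s b = (\<Sum>i<length bs. a i *s bs ! i)" using Cons.IH by blast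
  have "x = (\<Sum>i<length (b # bs). (case i of 0 \<Rightarrow> k | Suc j \<Rightarrow> a j) *s (b # bs) ! i)"
    using a by (simp add: sum.lessThan_Suc_shift del: sum.lessThan_Suc) (metis add.commute diff_add_cancel)
  then show ?case by blast
qed

lemma rel_det_exists:
  assumes "length cs = length bs" "set cs \<subseteq> vec.span (set bs)"
  shows "\<exists>d. rel_det bs cs d"
proof -
  have "\<exists>a. cs ! j = (\<Sum>i<length bs. a i *s bs ! i)" if "j < length bs" for j
    using span_list_coords[of "cs ! j" bs] assms that by (metis nth_mem subsetD)
  then obtain A where "\<forall>j<length bs. cs ! j = (\<Sum>i<length bs. A j i *s bs ! i)" by metis
  then show ?thesis unfolding rel_det_def using assms(1)
    by (intro exI conjI) (auto intro!: exI[of _ "\<lambda>i j. A j i"])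
qed

lemma rel_det_refl: "rel_det bs bs 1"
proof -
  let ?n = "length bs"
  have "Matrix.mat ?n ?n (\<lambda>(i, j). if i = j then 1 else 0) = (1\<^sub>m ?n :: 'a mat)"
    by (rule eq_matI) auto
  then show ?thesis unfolding rel_det_def
    by (intro conjI exI[of _ "\<lambda>i j. if i = j then 1 else 0"])
      (auto simp: if_distrib[of "\<lambda>c. c *s _"] cong: if_cong)
qed

text \<open>Only the coefficient at the replaced vector counts. This is the tool for all
  independence statements: of the chosen outward vector, of the base point of a face, and of
  translating points into differences.\<close>

lemma rel_det_transvection:
  assumes "y \<in> vec.span (set bs)"
  shows "rel_det (b # bs) ((t *s b + y) # bs) t"
proof -
  obtain a where a: "y = (\<Sum>i<length bs. a i *s bs ! i)" using span_list_coords[OF assms] by blast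
  let ?n = "Suc (length bs)"
  let ?A = "\<lambda>i j. if j = 0 then (case i of 0 \<Rightarrow> t | Suc k \<Rightarrow> a k) else if i = j then 1 else 0"
  let ?M = "Matrix.mat ?n ?n (\<lambda>(i, j). ?A i j)"
  \<comment> \<open>Only the first column differs from the identity matrix, so the matrix is lower
    triangular.\<close>
  have "Determinant.det ?M = prod_list (diag_mat ?M)"
    by (rule det_lower_triangular[of ?n]) auto
  also have "\<dots> = (\<Prod>i<?n. ?A i i)"
    by (simp add: prod_list_diag_prod atLeast0LessThan del: prod.lessThan_Suc)
  also have "\<dots> = t" by (simp add: prod.lessThan_Suc_shift del: prod.lessThan_Suc)
  finally have "t = Determinant.det ?M" by simp
  moreover have "((t *s b + y) # bs) ! j = (\<Sum>i<?n. ?A i j *s (b # bs) ! i)" if "j < ?n" for j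
  proof (cases j)
    case 0
    then show ?thesis by (simp add: sum.lessThan_Suc_shift a del: sum.lessThan_Suc)
  next
    case (Suc k)
    then show ?thesis using that
      by (simp add: sum.lessThan_Suc_shift if_distrib[of "\<lambda>c. c *s _"] del: sum.lessThan_Suc cong: if_cong)
  qed
  ultimately show ?thesis unfolding rel_det_def by (intro conjI exI[of _ ?A]) auto
qed

lemma rel_det_swap:
  fixes x y :: "'k::linordered_field ^ 'm"
  shows "rel_det (x # y # bs) (y # x # bs) (- 1)"
proof -
  let ?n = "length (x # y # bs)"
  let ?A = "\<lambda>i j. if 0 = i \<and> Suc 0 = j \<or> 0 = j \<and> Suc 0 = i \<or> i = j \<and> i \<noteq> 0 \<and> i \<noteq> Suc 0 then 1 else (0::'k)"
  have "Determinant.det (Matrix.mat ?n ?n (\<lambda>(i, j). ?A i j)) = - 1"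
    using det_swaprows_mat[of 0 ?n "Suc 0"] unfolding swaprows_mat_def by simp
  moreover have "(y # x # bs) ! j = (\<Sum>i<?n. ?A i j *s (x # y # bs) ! i)" if "j < ?n" for j
  proof -
    consider "j = 0" | "j = Suc 0" | k where "j = Suc (Suc k)" by (metis nat.exhaust)
    then show ?thesis
      using that by cases (simp_all add: sum.lessThan_Suc_shift if_distrib[of "\<lambda>c. c *s _"]
          del: sum.lessThan_Suc cong: if_cong)
  qed
  ultimately show ?thesis unfolding rel_det_def
    by (intro conjI exI[of _ ?A]) (simp_all del: sum.lessThan_Suc)
qed

lemma rel_det_Cons:
  assumes "rel_det bs cs d" shows "rel_det (x # bs) (x # cs) d"
proof -
  let ?n = "length bs"
  obtain A where A: "length cs = ?n" "\<forall>j<?n. cs ! j = (\<Sum>i<?n. A i j *s bs ! i)"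
    "d = Determinant.det (Matrix.mat ?n ?n (\<lambda>(i, j). A i j))"
    using assms(1) unfolding rel_det_def by auto
  let ?A = "\<lambda>i j. case i of 0 \<Rightarrow> (case j of 0 \<Rightarrow> 1 | Suc _ \<Rightarrow> 0) | Suc i' \<Rightarrow> (case j of 0 \<Rightarrow> 0 | Suc j' \<Rightarrow> A i' j')"
  have "Matrix.mat (Suc ?n) (Suc ?n) (\<lambda>(i, j). ?A i j) =
      four_block_mat (1\<^sub>m 1) (0\<^sub>m 1 ?n) (0\<^sub>m ?n 1) (Matrix.mat ?n ?n (\<lambda>(i, j). A i j))"
    by (rule eq_matI) (auto split: nat.split)
  then have "d = Determinant.det (Matrix.mat (Suc ?n) (Suc ?n) (\<lambda>(i, j). ?A i j))"
    using A(3) det_four_block_mat_lower_left_zero[of "1\<^sub>m 1" 1 "0\<^sub>m 1 ?n" ?n "0\<^sub>m ?n 1"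
        "Matrix.mat ?n ?n (\<lambda>(i, j). A i j)"] by simp
  moreover have "(x # cs) ! j = (\<Sum>i<Suc ?n. ?A i j *s (x # bs) ! i)" if "j < Suc ?n" for j
    using that A(2) by (cases j) (simp_all add: sum.lessThan_Suc_shift del: sum.lessThan_Suc)
  ultimately show ?thesis unfolding rel_det_def using A(1) by (intro conjI exI[of _ ?A]) auto
qed

lemma rel_det_rotate: "rel_det (x # bs) (bs @ [x]) ((- 1) ^ length bs)"
proof (induction bs)
  case Nil show ?case using rel_det_refl[of "[x]"] by simp
next
  case (Cons b bs)
  show ?case using rel_det_trans[OF rel_det_swap rel_det_Cons[OF Cons.IH]] by simp
qed

lemma rel_det_nonzero:
  assumes "ordered_basis bs U" "ordered_basis cs U" "rel_det bs cs d"
  shows "d \<noteq> 0"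
proof -
  have b: "distinct bs" "vec.independent (set bs)" "vec.span (set bs) = U"
    and c: "vec.span (set cs) = U" using assms unfolding ordered_basis_def by auto
  have "length bs = length cs" using assms(3) unfolding rel_det_def by simp
  moreover have "set bs \<subseteq> vec.span (set cs)" using b(3) c vec.span_superset by blast
  ultimately obtain e where "rel_det cs bs e" using rel_det_exists by blast
  then have "rel_det bs bs (d * e)" using rel_det_trans assms(3) by blast
  then have "d * e = 1" using rel_det_unique[OF b(1,2)] rel_det_refl by blast
  then show ?thesis by auto
qed

lemma ordered_basis_length:
  assumes "ordered_basis bs U" shows "length bs = vec.dim U"
  using assms unfolding ordered_basis_def
  by (metis distinct_card vec.dim_eq_card_independent vec.dim_span)

lemma rel_det_bases:
  assumes "ordered_basis bs U" "ordered_basis cs U"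
  obtains d where "rel_det bs cs d" "d \<noteq> 0"
proof -
  have "length cs = length bs" using assms ordered_basis_length by metis
  moreover have "set cs \<subseteq> vec.span (set bs)"
    using assms unfolding ordered_basis_def using vec.span_superset by blast
  ultimately show ?thesis using rel_det_exists rel_det_nonzero[OF assms] that by blast
qed

lemma ordered_basis_Cons:
  assumes "ordered_basis bs U" "x \<notin> U"
  shows "ordered_basis (x # bs) (vec.span (insert x U))"
proof -
  have *: "distinct bs" "vec.independent (set bs)" "vec.span (set bs) = U"
    using assms(1) unfolding ordered_basis_def by auto
  have "x \<notin> set bs" using assms(2) *(3) vec.span_base by blast
  moreover have "vec.independent (insert x (set bs))"
    using * assms(2) vec.independent_insertI by blast
  moreover have "vec.span (insert x (set bs)) = vec.span (insert x U)"
    unfolding *(3)[symmetric] by (simp only: vec.span_insert vec.span_span)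
  ultimately show ?thesis unfolding ordered_basis_def using * by simp
qed

text \<open>\<open>incidence\<close> asks for some outward vector. All vectors of
  \<open>\<sigma>\<close> off \<open>\<tau>\<close> lie on the same side of the span of
  \<open>\<tau>\<close>, hence are positive multiples of each other modulo that span, and each of
  them yields the same sign.\<close>

lemma incidence_rel_det:
  fixes \<omega> :: "('k::linordered_field ^ 'm) set \<Rightarrow> ('k ^ 'm) list"
  assumes f: "cone_face \<tau> \<sigma>" and d: "vec.dim \<sigma> = vec.dim \<tau> + 1"
    and o: "ordered_basis (\<omega> \<sigma>) (vec.span \<sigma>)" "ordered_basis (\<omega> \<tau>) (vec.span \<tau>)"
    and w: "w \<in> \<sigma>" "w \<notin> \<tau>"
  obtains e where "rel_det (\<omega> \<sigma>) (- w # \<omega> \<tau>) e" "e \<noteq> 0" "incidence \<omega> \<tau> \<sigma> = sgn e"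
proof -
  have ob: "ordered_basis (- v # \<omega> \<tau>) (vec.span \<sigma>)" if v: "v \<in> \<sigma>" "v \<notin> \<tau>" for v
  proof -
    have nv: "v \<notin> vec.span \<tau>" using v equalityD2[OF cone_face_span_Int[OF f]] by blast
    then have nv': "- v \<notin> vec.span \<tau>" using vec.span_neg[of "- v" \<tau>] by (metis minus_minus)
    have "vec.span (insert (- v) (vec.span \<tau>)) = vec.span \<sigma>"
    proof -
      have sub: "insert (- v) (vec.span \<tau>) \<subseteq> vec.span \<sigma>"
        using vec.span_neg[OF vec.span_base[OF v(1)]] vec.span_mono[OF cone_face_subset[OF f]] by blast
      have "vec.dim (vec.span \<sigma>) \<le> vec.dim (insert (- v) (vec.span \<tau>))"
        using d nv' by (simp add: vec.dim_insert vec.span_span vec.dim_span)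
      from vec.dim_eq_span[OF sub this] show ?thesis by (simp add: vec.span_span)
    qed
    then show ?thesis using ordered_basis_Cons[OF o(2) nv'] by simp
  qed
  obtain e where e: "rel_det (\<omega> \<sigma>) (- w # \<omega> \<tau>) e" "e \<noteq> 0"
    using rel_det_bases[OF o(1) ob[OF w]] .
  obtain u where u: "\<And>x. x \<in> \<sigma> \<Longrightarrow> 0 \<le> dot u x" "\<tau> = {x \<in> \<sigma>. dot u x = 0}"
    using f unfolding cone_face_def by blast
  have spo: "vec.span (set (\<omega> \<tau>)) = vec.span \<tau>" "vec.independent (set (\<omega> \<sigma>))" "distinct (\<omega> \<sigma>)"
    using o unfolding ordered_basis_def by auto
  have pos: "e > 0" if v: "v \<in> \<sigma>" "v \<notin> \<tau>" and so: "same_orientation (\<omega> \<sigma>) (- v # \<omega> \<tau>)" for v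
  proof -
    obtain c where c: "c > 0" "rel_det (\<omega> \<sigma>) (- v # \<omega> \<tau>) c"
      using so unfolding same_orientation_rel_det by metis
    have uv: "dot u v > 0" and uw: "dot u w > 0"
      using u(1)[OF v(1)] u(1)[OF w(1)] v w unfolding u(2) by (auto simp: order_less_le)
    have "- w \<in> vec.span (insert (- v) (set (\<omega> \<tau>)))"
    proof -
      have "vec.span (insert (- v) (set (\<omega> \<tau>))) = vec.span \<sigma>"
        using ob[OF v] unfolding ordered_basis_def by simp
      then show ?thesis using vec.span_neg[OF vec.span_base[OF w(1)]] by simp
    qed
    \<comment> \<open>\<open>t\<close> is the factor between \<open>w\<close> and \<open>v\<close>
      modulo the span of \<open>\<tau>\<close>; evaluating the functional \<open>u\<close> of the
      facet shows that it is positive.\<close>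
    then obtain t where "- w - t *s - v \<in> vec.span (set (\<omega> \<tau>))" unfolding vec.span_insert by blast
    then have y: "- w - t *s - v \<in> vec.span \<tau>" using spo by simp
    have "dot u (- w - t *s - v) = 0" by (rule dot_zero_on_span[OF _ y]) (simp add: u(2))
    then have "t * dot u v = dot u w" by (simp add: dot_simps)
    then have "t > 0" using uv uw by (metis zero_less_mult_pos2)
    moreover have "rel_det (- v # \<omega> \<tau>) ((t *s - v + (- w - t *s - v)) # \<omega> \<tau>) t"
      by (rule rel_det_transvection) (use y spo in simp)
    then have "rel_det (- v # \<omega> \<tau>) (- w # \<omega> \<tau>) t" by simp
    then have "rel_det (\<omega> \<sigma>) (- w # \<omega> \<tau>) (c * t)" using rel_det_trans c(2) by blast
    then have "e = c * t" using rel_det_unique[OF spo(3,2)] e(1) by blast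
    ultimately show ?thesis using c(1) by simp
  qed
  have "incidence \<omega> \<tau> \<sigma> = sgn e"
  proof (cases "e > 0")
    case True
    then have "same_orientation (\<omega> \<sigma>) (- w # \<omega> \<tau>)" using e unfolding same_orientation_rel_det by blast
    then have "\<exists>w\<in>\<sigma> - \<tau>. same_orientation (\<omega> \<sigma>) (- w # \<omega> \<tau>)" using w by blast
    then show ?thesis using True unfolding incidence_def by simp
  next
    case False
    then have "\<not> (\<exists>w\<in>\<sigma> - \<tau>. same_orientation (\<omega> \<sigma>) (- w # \<omega> \<tau>))" using pos by blast
    then show ?thesis using False e(2) unfolding incidence_def by (simp add: sgn_if)
  qed
  then show ?thesis by (rule that[OF e])
qed

section \<open>Exactness of intervals of the face lattice\<close>

locale oriented_fan =
  fixes \<sigma> :: "('k::linordered_field ^ 'm) set"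
    and \<omega> :: "('k ^ 'm) set \<Rightarrow> ('k ^ 'm) list"
  assumes fg: "fgcone \<sigma>"
    and orient: "\<And>\<tau>. \<tau> \<in> face_fan \<sigma> \<Longrightarrow> ordered_basis (\<omega> \<tau>) (vec.span \<tau>)"
begin

abbreviation "\<Phi> \<equiv> face_fan \<sigma>"

lemma finite_fan: "finite \<Phi>"
  using finite_face_fan[OF fg] .

lemma fan_fg: "\<tau> \<in> \<Phi> \<Longrightarrow> fgcone \<tau>"
  using fgcone_face[OF fg] by (simp add: face_fan_def)

lemma fan_face: "\<tau> \<in> \<Phi> \<Longrightarrow> \<mu> \<in> \<Phi> \<Longrightarrow> \<tau> \<subseteq> \<mu> \<Longrightarrow> cone_face \<tau> \<mu>"
  by (simp add: cone_face_in_fan)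

lemma fan_trans: "\<mu> \<in> \<Phi> \<Longrightarrow> cone_face \<tau> \<mu> \<Longrightarrow> \<tau> \<in> \<Phi>"
  using cone_face_trans[OF fg] by (auto simp: face_fan_def)

lemma fan_subset: "\<tau> \<in> \<Phi> \<Longrightarrow> \<tau> \<subseteq> \<sigma>"
  by (simp add: face_fan_def cone_face_subset)

lemma top_in_fan: "\<sigma> \<in> \<Phi>"
  by (simp add: face_fan_def cone_face_refl)

lemma fan_dim: "\<tau> \<in> \<Phi> \<Longrightarrow> \<mu> \<in> \<Phi> \<Longrightarrow> \<tau> \<subset> \<mu> \<Longrightarrow> vec.dim \<tau> < vec.dim \<mu>"
  using vdim_strict fan_face by blast

lemma incidence_cases: "incidence \<omega> \<tau> \<mu> = 1 \<or> incidence \<omega> \<tau> \<mu> = - 1"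
  by (simp add: incidence_def)

text \<open>Along either path from \<open>\<tau>\<close> to \<open>\<nu>\<close> the basis of
  \<open>\<tau>\<close> is extended by the same two vectors \<open>- v1\<close> and
  \<open>- v2\<close>, but in opposite order. The transposition gives the minus sign that makes the
  coboundary square to zero.\<close>

lemma diamond_incidence:
  assumes t: "\<tau> \<in> \<Phi>" "\<nu> \<in> \<Phi>" "\<tau> \<subseteq> \<nu>" and d: "vec.dim \<nu> = vec.dim \<tau> + 2"
  obtains \<mu>1 \<mu>2 where "\<mu>1 \<noteq> \<mu>2" "{\<mu> \<in> \<Phi>. \<tau> \<subset> \<mu> \<and> \<mu> \<subset> \<nu>} = {\<mu>1, \<mu>2}" "\<mu>1 \<inter> \<mu>2 = \<tau>"
    "vec.dim \<mu>1 = vec.dim \<tau> + 1" "vec.dim \<mu>2 = vec.dim \<tau> + 1"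
    "incidence \<omega> \<tau> \<mu>1 * incidence \<omega> \<mu>1 \<nu> = - (incidence \<omega> \<tau> \<mu>2 * incidence \<omega> \<mu>2 \<nu>)"
proof -
  obtain \<mu>1 \<mu>2 where m: "\<mu>1 \<noteq> \<mu>2" "{\<mu>. cone_face \<mu> \<nu> \<and> \<tau> \<subset> \<mu> \<and> \<mu> \<subset> \<nu>} = {\<mu>1, \<mu>2}" "\<mu>1 \<inter> \<mu>2 = \<tau>"
    by (rule diamond[OF fan_fg[OF t(2)] fan_face[OF t] d])
  have eq: "{\<mu>. cone_face \<mu> \<nu> \<and> \<tau> \<subset> \<mu> \<and> \<mu> \<subset> \<nu>} = {\<mu> \<in> \<Phi>. \<tau> \<subset> \<mu> \<and> \<mu> \<subset> \<nu>}"
    using fan_trans[OF t(2)] fan_face[OF _ t(2)] by blast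
  have in1: "\<mu>1 \<in> \<Phi>" "\<tau> \<subset> \<mu>1" "\<mu>1 \<subset> \<nu>" and in2: "\<mu>2 \<in> \<Phi>" "\<tau> \<subset> \<mu>2" "\<mu>2 \<subset> \<nu>"
  proof -
    have "\<mu>1 \<in> {\<mu> \<in> \<Phi>. \<tau> \<subset> \<mu> \<and> \<mu> \<subset> \<nu>}" "\<mu>2 \<in> {\<mu> \<in> \<Phi>. \<tau> \<subset> \<mu> \<and> \<mu> \<subset> \<nu>}"
      unfolding m(2)[unfolded eq] by simp_all
    then show "\<mu>1 \<in> \<Phi>" "\<tau> \<subset> \<mu>1" "\<mu>1 \<subset> \<nu>" "\<mu>2 \<in> \<Phi>" "\<tau> \<subset> \<mu>2" "\<mu>2 \<subset> \<nu>" by simp_all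
  qed
  have dims: "vec.dim \<mu>1 = vec.dim \<tau> + 1" "vec.dim \<mu>2 = vec.dim \<tau> + 1"
    using fan_dim[OF t(1) in1(1,2)] fan_dim[OF in1(1) t(2) in1(3)]
      fan_dim[OF t(1) in2(1,2)] fan_dim[OF in2(1) t(2) in2(3)] d by auto
  obtain v1 where v1: "v1 \<in> \<mu>1" "v1 \<notin> \<tau>" using in1 by blast
  obtain v2 where v2: "v2 \<in> \<mu>2" "v2 \<notin> \<tau>" using in2 by blast
  have v12: "v1 \<notin> \<mu>2" "v2 \<notin> \<mu>1" using m(3) v1 v2 by blast+
  have f: "cone_face \<tau> \<mu>1" "cone_face \<tau> \<mu>2" "cone_face \<mu>1 \<nu>" "cone_face \<mu>2 \<nu>"
    using fan_face t in1 in2 by blast+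
  have dn: "vec.dim \<nu> = vec.dim \<mu>1 + 1" "vec.dim \<nu> = vec.dim \<mu>2 + 1" using dims d by auto
  have vn: "v1 \<in> \<nu>" "v2 \<in> \<nu>" using v1 v2 in1 in2 by blast+
  obtain d1 where d1: "rel_det (\<omega> \<nu>) (- v2 # \<omega> \<mu>1) d1" "d1 \<noteq> 0" "incidence \<omega> \<mu>1 \<nu> = sgn d1"
    by (rule incidence_rel_det[OF f(3) dn(1) orient[OF t(2)] orient[OF in1(1)] vn(2) v12(2)])
  obtain d2 where d2: "rel_det (\<omega> \<nu>) (- v1 # \<omega> \<mu>2) d2" "d2 \<noteq> 0" "incidence \<omega> \<mu>2 \<nu> = sgn d2"
    by (rule incidence_rel_det[OF f(4) dn(2) orient[OF t(2)] orient[OF in2(1)] vn(1) v12(1)])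
  obtain e1 where e1: "rel_det (\<omega> \<mu>1) (- v1 # \<omega> \<tau>) e1" "e1 \<noteq> 0" "incidence \<omega> \<tau> \<mu>1 = sgn e1"
    by (rule incidence_rel_det[OF f(1) dims(1) orient[OF in1(1)] orient[OF t(1)] v1])
  obtain e2 where e2: "rel_det (\<omega> \<mu>2) (- v2 # \<omega> \<tau>) e2" "e2 \<noteq> 0" "incidence \<omega> \<tau> \<mu>2 = sgn e2"
    by (rule incidence_rel_det[OF f(2) dims(2) orient[OF in2(1)] orient[OF t(1)] v2])
  have r1: "rel_det (\<omega> \<nu>) (- v2 # - v1 # \<omega> \<tau>) (d1 * e1)"
    by (rule rel_det_trans[OF d1(1) rel_det_Cons[OF e1(1)]])
  have r2: "rel_det (\<omega> \<nu>) (- v1 # - v2 # \<omega> \<tau>) (d2 * e2)"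
    by (rule rel_det_trans[OF d2(1) rel_det_Cons[OF e2(1)]])
  have r3: "rel_det (\<omega> \<nu>) (- v1 # - v2 # \<omega> \<tau>) (d1 * e1 * - 1)"
    by (rule rel_det_trans[OF r1 rel_det_swap])
  have "d2 * e2 = d1 * e1 * - 1"
    using rel_det_unique[OF _ _ r2 r3] orient[OF t(2)] unfolding ordered_basis_def by blast
  then have "sgn (d2 * e2) = - sgn (d1 * e1)" by (simp add: sgn_minus)
  then have "incidence \<omega> \<tau> \<mu>1 * incidence \<omega> \<mu>1 \<nu> = - (incidence \<omega> \<tau> \<mu>2 * incidence \<omega> \<mu>2 \<nu>)"
    by (simp add: d1(3) d2(3) e1(3) e2(3) sgn_mult mult.commute)
  then show ?thesis using that[OF m(1) m(2)[unfolded eq] m(3) dims] by blast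
qed

text \<open>Extending the incidence number by zero lets sums run over whole families of faces, so
  that double sums can be swapped without conditions on dimensions.\<close>

definition inc :: "('k ^ 'm) set \<Rightarrow> ('k ^ 'm) set \<Rightarrow> 'k" where
  "inc \<tau> \<mu> = (if \<tau> \<subset> \<mu> \<and> vec.dim \<mu> = vec.dim \<tau> + 1 then incidence \<omega> \<tau> \<mu> else 0)"

definition \<delta> :: "('k ^ 'm) set set \<Rightarrow> (('k ^ 'm) set \<Rightarrow> 'k) \<Rightarrow> ('k ^ 'm) set \<Rightarrow> 'k" where
  "\<delta> S f \<mu> = (\<Sum>\<tau>\<in>S. inc \<tau> \<mu> * f \<tau>)"

text \<open>Order-convex families are the subquotients of the face complex. Convexity keeps both
  middle faces of every diamond in \<open>S\<close>, which is what \<open>\<delta>_\<delta>\<close>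
  depends on.\<close>

definition interval_closed :: "('k ^ 'm) set set \<Rightarrow> bool" where
  "interval_closed S \<longleftrightarrow> S \<subseteq> \<Phi> \<and> (\<forall>\<tau>\<in>S. \<forall>\<nu>\<in>S. \<forall>\<mu>\<in>\<Phi>. \<tau> \<subseteq> \<mu> \<longrightarrow> \<mu> \<subseteq> \<nu> \<longrightarrow> \<mu> \<in> S)"

text \<open>The grading is ignored: \<open>\<delta>\<close> raises the dimension by one anyway.\<close>

definition exact :: "('k ^ 'm) set set \<Rightarrow> bool" where
  "exact S \<longleftrightarrow> (\<forall>f. (\<forall>\<nu>\<in>S. \<delta> S f \<nu> = 0) \<longrightarrow> (\<exists>g. \<forall>\<mu>\<in>S. f \<mu> = \<delta> S g \<mu>))"

lemma interval_closed_finite: "interval_closed S \<Longrightarrow> finite S"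
  unfolding interval_closed_def using finite_fan finite_subset by blast

lemma inc_inc_sum:
  assumes S: "interval_closed S" and t: "\<tau> \<in> S" "\<nu> \<in> S"
  shows "(\<Sum>\<mu>\<in>S. inc \<tau> \<mu> * inc \<mu> \<nu>) = 0"
proof (cases "\<tau> \<subseteq> \<nu> \<and> vec.dim \<nu> = vec.dim \<tau> + 2")
  case True
  have t': "\<tau> \<in> \<Phi>" "\<nu> \<in> \<Phi>" using S t unfolding interval_closed_def by blast+
  obtain \<mu>1 \<mu>2 where m: "\<mu>1 \<noteq> \<mu>2" "{\<mu> \<in> \<Phi>. \<tau> \<subset> \<mu> \<and> \<mu> \<subset> \<nu>} = {\<mu>1, \<mu>2}"
    and d: "vec.dim \<mu>1 = vec.dim \<tau> + 1" "vec.dim \<mu>2 = vec.dim \<tau> + 1"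
    and e: "incidence \<omega> \<tau> \<mu>1 * incidence \<omega> \<mu>1 \<nu> = - (incidence \<omega> \<tau> \<mu>2 * incidence \<omega> \<mu>2 \<nu>)"
    by (rule diamond_incidence[OF t' conjunct1[OF True] conjunct2[OF True]])
  have in12: "\<mu>1 \<in> \<Phi>" "\<tau> \<subset> \<mu>1" "\<mu>1 \<subset> \<nu>" "\<mu>2 \<in> \<Phi>" "\<tau> \<subset> \<mu>2" "\<mu>2 \<subset> \<nu>"
  proof -
    have "\<mu>1 \<in> {\<mu> \<in> \<Phi>. \<tau> \<subset> \<mu> \<and> \<mu> \<subset> \<nu>}" "\<mu>2 \<in> {\<mu> \<in> \<Phi>. \<tau> \<subset> \<mu> \<and> \<mu> \<subset> \<nu>}"
      unfolding m(2) by simp_all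
    then show "\<mu>1 \<in> \<Phi>" "\<tau> \<subset> \<mu>1" "\<mu>1 \<subset> \<nu>" "\<mu>2 \<in> \<Phi>" "\<tau> \<subset> \<mu>2" "\<mu>2 \<subset> \<nu>" by simp_all
  qed
  have icl: "\<mu> \<in> S" if "\<mu> \<in> \<Phi>" "\<tau> \<subset> \<mu>" "\<mu> \<subset> \<nu>" for \<mu>
    using S t that unfolding interval_closed_def by blast
  have inS: "\<mu>1 \<in> S" "\<mu>2 \<in> S" using icl in12 by blast+
  have "inc \<tau> \<mu> * inc \<mu> \<nu> = 0" if "\<mu> \<in> S - {\<mu>1, \<mu>2}" for \<mu>
  proof -
    have "\<mu> \<in> \<Phi>" using that S unfolding interval_closed_def by blast
    moreover have "\<mu> \<notin> {\<mu> \<in> \<Phi>. \<tau> \<subset> \<mu> \<and> \<mu> \<subset> \<nu>}" unfolding m(2) using that by simp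
    ultimately have "\<not> (\<tau> \<subset> \<mu> \<and> \<mu> \<subset> \<nu>)" by simp
    then show ?thesis unfolding inc_def by auto
  qed
  then have "(\<Sum>\<mu>\<in>S. inc \<tau> \<mu> * inc \<mu> \<nu>) = (\<Sum>\<mu>\<in>{\<mu>1, \<mu>2}. inc \<tau> \<mu> * inc \<mu> \<nu>)"
    using interval_closed_finite[OF S] inS by (intro sum.mono_neutral_right) auto
  also have "\<dots> = 0" using m(1) in12 d e True by (simp add: inc_def)
  finally show ?thesis .
next
  case False
  have "inc \<tau> \<mu> * inc \<mu> \<nu> = 0" for \<mu> using False unfolding inc_def by auto
  then show ?thesis by (intro sum.neutral ballI)
qed

lemma \<delta>_\<delta>:
  assumes "interval_closed S" "\<nu> \<in> S" shows "\<delta> S (\<delta> S f) \<nu> = 0"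
proof -
  have "\<delta> S (\<delta> S f) \<nu> = (\<Sum>\<tau>\<in>S. (\<Sum>\<mu>\<in>S. inc \<tau> \<mu> * inc \<mu> \<nu>) * f \<tau>)"
  proof -
    have "\<delta> S (\<delta> S f) \<nu> = (\<Sum>\<mu>\<in>S. \<Sum>\<tau>\<in>S. inc \<tau> \<mu> * inc \<mu> \<nu> * f \<tau>)"
      unfolding \<delta>_def sum_distrib_left by (intro sum.cong refl) (simp only: mult_ac)
    also have "\<dots> = (\<Sum>\<tau>\<in>S. \<Sum>\<mu>\<in>S. inc \<tau> \<mu> * inc \<mu> \<nu> * f \<tau>)" by (rule sum.swap)
    finally show ?thesis by (simp only: sum_distrib_right)
  qed
  also have "\<dots> = 0" using inc_inc_sum[OF assms(1) _ assms(2)] by simp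
  finally show ?thesis .
qed

text \<open>No member of \<open>B\<close> lies below a member of \<open>A\<close>, so cochains
  supported on \<open>B\<close> form a subcomplex with quotient \<open>A\<close>. Exactness of both
  gives exactness of the whole, as in a long exact sequence.\<close>

lemma exact_Un:
  assumes S: "interval_closed S" and AB: "S = A \<union> B" "A \<inter> B = {}"
    and no: "\<And>a b. a \<in> A \<Longrightarrow> b \<in> B \<Longrightarrow> \<not> b \<subset> a" and ex: "exact A" "exact B"
  shows "exact S"
  unfolding exact_def
proof (intro allI impI)
  fix f assume f: "\<forall>\<nu>\<in>S. \<delta> S f \<nu> = 0"
  have fin: "finite A" "finite B" using interval_closed_finite[OF S] AB(1) by auto
  have split: "\<delta> S g \<mu> = \<delta> A g \<mu> + \<delta> B g \<mu>" for g \<mu>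
    unfolding \<delta>_def AB(1) by (rule sum.union_disjoint[OF fin AB(2)])
  have inc0: "inc b a = 0" if "a \<in> A" "b \<in> B" for a b using no[OF that] by (simp add: inc_def)
  have dBA: "\<delta> B g a = 0" if "a \<in> A" for g a unfolding \<delta>_def using inc0[OF that] by simp
  have "\<forall>a\<in>A. \<delta> A f a = 0" using f split dBA AB(1) by (metis UnI1 add.right_neutral)
  then obtain g where g: "\<forall>a\<in>A. f a = \<delta> A g a" using ex(1) unfolding exact_def by blast
  define g1 where "g1 = (\<lambda>\<tau>. if \<tau> \<in> A then g \<tau> else 0)"
  have g1A: "\<delta> A g1 \<mu> = \<delta> A g \<mu>" for \<mu> unfolding \<delta>_def g1_def by simp
  have g1B: "\<delta> B g1 \<mu> = 0" for \<mu> unfolding \<delta>_def g1_def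
    using AB(2) by (intro sum.neutral) auto
  \<comment> \<open>Subtracting the coboundary of a primitive on \<open>A\<close> leaves a cocycle
    that vanishes on \<open>A\<close> and so lives on \<open>B\<close>.\<close>
  define f2 where "f2 = (\<lambda>\<mu>. f \<mu> - \<delta> S g1 \<mu>)"
  have f2A: "f2 a = 0" if "a \<in> A" for a using g that by (simp add: f2_def split g1A g1B)
  have "\<delta> B f2 b = 0" if b: "b \<in> B" for b
  proof -
    have "\<delta> B f2 b = \<delta> S f2 b" unfolding split using f2A by (simp add: \<delta>_def)
    also have "\<dots> = \<delta> S f b - \<delta> S (\<delta> S g1) b"
      unfolding f2_def by (simp add: \<delta>_def algebra_simps sum_subtractf)
    also have "\<dots> = 0" using f \<delta>_\<delta>[OF S] b AB(1) by simp
    finally show ?thesis .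
  qed
  then obtain h where h: "\<forall>b\<in>B. f2 b = \<delta> B h b" using ex(2) unfolding exact_def by blast
  define g2 where "g2 = (\<lambda>\<tau>. g1 \<tau> + (if \<tau> \<in> B then h \<tau> else 0))"
  have g2: "\<delta> S g2 \<mu> = \<delta> S g1 \<mu> + \<delta> B h \<mu>" for \<mu>
  proof -
    have "\<delta> S g2 \<mu> = \<delta> S g1 \<mu> + \<delta> S (\<lambda>\<tau>. if \<tau> \<in> B then h \<tau> else 0) \<mu>"
      unfolding g2_def by (simp add: \<delta>_def algebra_simps sum.distrib)
    also have "\<delta> S (\<lambda>\<tau>. if \<tau> \<in> B then h \<tau> else 0) \<mu> = \<delta> B h \<mu>"
      unfolding split using AB(2) by (auto simp: \<delta>_def intro!: sum.neutral)
    finally show ?thesis .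
  qed
  have "f \<mu> = \<delta> S g2 \<mu>" if "\<mu> \<in> S" for \<mu>
  proof (cases "\<mu> \<in> A")
    case True
    then show ?thesis using f2A[OF True] dBA[OF True] by (simp add: g2 f2_def)
  next
    case False
    then have "f2 \<mu> = \<delta> B h \<mu>" using h that AB(1) by blast
    then show ?thesis by (simp add: g2 f2_def)
  qed
  then show "\<exists>g. \<forall>\<mu>\<in>S. f \<mu> = \<delta> S g \<mu>" by blast
qed

text \<open>The fibres of \<open>(c, G)\<close> are split off by decreasing \<open>c\<close>, then by increasing \<open>G\<close>.\<close>

lemma exact_fibres:
  fixes c :: "('k ^ 'm) set \<Rightarrow> 'k" and G :: "('k ^ 'm) set \<Rightarrow> ('k ^ 'm) set"
  assumes "interval_closed S"
    and "\<forall>\<tau>\<in>S. \<forall>\<mu>\<in>S. \<tau> \<subset> \<mu> \<longrightarrow> c \<mu> \<le> c \<tau> \<and> (c \<mu> = c \<tau> \<longrightarrow> G \<tau> \<subseteq> G \<mu>)"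
    and "\<forall>\<tau>\<in>S. exact {\<mu> \<in> S. c \<mu> = c \<tau> \<and> G \<mu> = G \<tau>}"
  shows "exact S"
  using assms
proof (induction "card S" arbitrary: S rule: less_induct)
  case less
  note S = less.prems(1) and mono = less.prems(2) and fib = less.prems(3)
  have fin: "finite S" using interval_closed_finite[OF S] .
  show ?case
  proof (cases "S = {}")
    case True then show ?thesis by (simp add: exact_def)
  next
    case False
    define C where "C = Max (c ` S)"
    have Cin: "C \<in> c ` S" unfolding C_def using fin False by (intro Max_in) auto
    have Cge: "c \<tau> \<le> C" if "\<tau> \<in> S" for \<tau> unfolding C_def using fin that by auto
    have "finite (G ` {\<tau> \<in> S. c \<tau> = C})" "G ` {\<tau> \<in> S. c \<tau> = C} \<noteq> {}" using fin Cin by auto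
    from finite_has_minimal[OF this] obtain G0 where G0: "G0 \<in> G ` {\<tau> \<in> S. c \<tau> = C}"
      and G0min: "\<forall>H\<in>G ` {\<tau> \<in> S. c \<tau> = C}. H \<subseteq> G0 \<longrightarrow> G0 = H" by (elim bexE) (rule that)
    obtain \<tau>0 where t0: "\<tau>0 \<in> S" "c \<tau>0 = C" and tG: "G0 = G \<tau>0" using G0 by blast
    have min: "\<forall>\<tau>\<in>S. c \<tau> = C \<longrightarrow> G \<tau> \<subseteq> G \<tau>0 \<longrightarrow> G \<tau> = G \<tau>0"
    proof (intro ballI impI)
      fix \<tau> assume "\<tau> \<in> S" "c \<tau> = C" "G \<tau> \<subseteq> G \<tau>0"
      then show "G \<tau> = G \<tau>0" using bspec[OF G0min, of "G \<tau>"] tG by simp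
    qed
    define A where "A = {\<mu> \<in> S. c \<mu> = c \<tau>0 \<and> G \<mu> = G \<tau>0}"
    \<comment> \<open>Below a member of \<open>A\<close> the value of \<open>c\<close> can only
      grow, but it is already maximal; then \<open>G\<close> can only shrink, but it is already
      minimal. So \<open>A\<close> is a lower set of \<open>S\<close>.\<close>
    have down: "b \<in> A" if "a \<in> A" "b \<in> S" "b \<subset> a" for a b
    proof -
      have a: "a \<in> S" "c a = C" "G a = G \<tau>0" using that(1) t0(2) unfolding A_def by simp_all
      have m: "c a \<le> c b \<and> (c a = c b \<longrightarrow> G b \<subseteq> G a)"
        using bspec[OF bspec[OF mono that(2)] a(1)] that(3) by (rule mp)
      then have cb: "c b = C" using Cge[OF that(2)] a(2) by simp
      then have "G b \<subseteq> G \<tau>0" using m a(2,3) by simp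
      then have "G b = G \<tau>0" using min that(2) cb by blast
      then show ?thesis unfolding A_def using that(2) cb t0(2) by simp
    qed
    have icB: "interval_closed (S - A)"
      unfolding interval_closed_def
    proof (intro conjI ballI impI)
      show "S - A \<subseteq> \<Phi>" using S unfolding interval_closed_def by blast
      fix \<tau> \<nu> \<mu> assume *: "\<tau> \<in> S - A" "\<nu> \<in> S - A" "\<mu> \<in> \<Phi>" "\<tau> \<subseteq> \<mu>" "\<mu> \<subseteq> \<nu>"
      then have "\<mu> \<in> S" using S unfolding interval_closed_def by blast
      moreover have "\<mu> \<notin> A" using down[of \<mu> \<tau>] * by blast
      ultimately show "\<mu> \<in> S - A" by blast
    qed
    have "card (S - A) < card S" using t0 fin by (intro psubset_card_mono) (auto simp: A_def)
    moreover have "exact {\<mu> \<in> S - A. c \<mu> = c \<tau> \<and> G \<mu> = G \<tau>}" if "\<tau> \<in> S - A" for \<tau>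
    proof -
      have "{\<mu> \<in> S - A. c \<mu> = c \<tau> \<and> G \<mu> = G \<tau>} = {\<mu> \<in> S. c \<mu> = c \<tau> \<and> G \<mu> = G \<tau>}"
        using that by (auto simp: A_def)
      then show ?thesis using fib that by simp
    qed
    ultimately have "exact (S - A)" using less.hyps[OF _ icB] mono by simp
    moreover have "exact A" unfolding A_def using bspec[OF fib t0(1)] .
    moreover have "S = A \<union> (S - A)" by (auto simp: A_def)
    moreover have "\<not> b \<subset> a" if "a \<in> A" "b \<in> S - A" for a b using down[OF that(1)] that(2) by blast
    ultimately show ?thesis by (intro exact_Un[OF S _ Diff_disjoint])
  qed
qed

definition positive_faces :: "('k ^ 'm) set \<Rightarrow> ('k ^ 'm) set \<Rightarrow> 'k ^ 'm \<Rightarrow> ('k ^ 'm) set set" where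
  "positive_faces \<tau> \<nu> \<xi> = {\<mu> \<in> \<Phi>. \<tau> \<subseteq> \<mu> \<and> \<mu> \<subseteq> \<nu> \<and> (\<forall>x\<in>\<mu>. x \<notin> \<tau> \<longrightarrow> dot \<xi> x > 0)}"

lemma interval_closed_positive_faces: "interval_closed (positive_faces \<tau> \<nu> \<xi>)"
  unfolding interval_closed_def positive_faces_def by blast

lemma exact_edge:
  assumes t: "\<tau> \<in> \<Phi>" "\<nu> \<in> \<Phi>" "\<tau> \<subset> \<nu>" and d: "vec.dim \<nu> = vec.dim \<tau> + 1"
  shows "exact {\<mu> \<in> \<Phi>. \<tau> \<subseteq> \<mu> \<and> \<mu> \<subseteq> \<nu>}"
proof -
  have S: "{\<mu> \<in> \<Phi>. \<tau> \<subseteq> \<mu> \<and> \<mu> \<subseteq> \<nu>} = {\<tau>, \<nu>}"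
  proof (intro subset_antisym subsetI)
    fix \<mu> assume "\<mu> \<in> {\<mu> \<in> \<Phi>. \<tau> \<subseteq> \<mu> \<and> \<mu> \<subseteq> \<nu>}"
    then have m: "\<mu> \<in> \<Phi>" "\<tau> \<subseteq> \<mu>" "\<mu> \<subseteq> \<nu>" by simp_all
    have "\<not> (\<tau> \<subset> \<mu> \<and> \<mu> \<subset> \<nu>)"
    proof
      assume "\<tau> \<subset> \<mu> \<and> \<mu> \<subset> \<nu>"
      then have "vec.dim \<tau> < vec.dim \<mu>" "vec.dim \<mu> < vec.dim \<nu>"
        using fan_dim[OF t(1) m(1)] fan_dim[OF m(1) t(2)] by simp_all
      then show False using d by simp
    qed
    then show "\<mu> \<in> {\<tau>, \<nu>}" using m(2,3) by blast
  next
    fix \<mu> assume "\<mu> \<in> {\<tau>, \<nu>}"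
    then show "\<mu> \<in> {\<mu> \<in> \<Phi>. \<tau> \<subseteq> \<mu> \<and> \<mu> \<subseteq> \<nu>}" using t by auto
  qed
  have ne: "\<tau> \<noteq> \<nu>" using t(3) by blast
  have e: "inc \<tau> \<nu> \<noteq> 0" using t(3) d incidence_cases[of \<tau> \<nu>] by (auto simp: inc_def)
  have z: "inc \<mu> \<tau> = 0" if "\<mu> \<in> {\<tau>, \<nu>}" for \<mu>
    using that t(3) d unfolding inc_def by auto
  have zn: "inc \<nu> \<nu> = 0" by (simp add: inc_def)
  show ?thesis unfolding S exact_def
  proof (intro allI impI)
    fix f assume "\<forall>\<mu>\<in>{\<tau>, \<nu>}. \<delta> {\<tau>, \<nu>} f \<mu> = 0"
    then have "\<delta> {\<tau>, \<nu>} f \<nu> = 0" by simp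
    then have "f \<tau> = 0" using e ne zn by (simp add: \<delta>_def)
    \<comment> \<open>Only the value of the primitive at \<open>\<tau>\<close> matters, as nothing
      in the family lies above \<open>\<nu>\<close>; a constant function therefore suffices.\<close>
    then have "\<forall>\<mu>\<in>{\<tau>, \<nu>}. f \<mu> = \<delta> {\<tau>, \<nu>} (\<lambda>_. f \<nu> / inc \<tau> \<nu>) \<mu>"
      using e ne zn z by (simp add: \<delta>_def)
    then show "\<exists>g. \<forall>\<mu>\<in>{\<tau>, \<nu>}. f \<mu> = \<delta> {\<tau>, \<nu>} g \<mu>" by blast
  qed
qed

text \<open>
  Let \<open>T\<close> be the face where \<open>\<xi>/h\<close> takes its maximum \<open>C\<close>. The members contained in \<open>T\<close> are the
  interval from \<open>\<tau>\<close> to \<open>T\<close>. For the others let \<open>c\<close> be the minimum of \<open>\<xi>/h\<close> and \<open>G\<close> the face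
  where it is attained; those with given \<open>c\<close> and \<open>G\<close> are \<open>positive_faces G \<nu> (\<xi> - c h)\<close>.
\<close>

lemma exact_positive_faces_step:
  assumes t: "\<tau> \<in> \<Phi>" "\<nu> \<in> \<Phi>" "\<tau> \<subset> \<nu>"
    and h: "\<forall>x\<in>\<nu>. 0 \<le> dot h x" "\<tau> = {x \<in> \<nu>. dot h x = 0}"
    and l0: "\<forall>x\<in>\<tau>. dot \<xi> x = 0" and lp: "x0 \<in> \<nu>" "dot \<xi> x0 > 0"
    and np: "\<forall>c. \<exists>x\<in>\<nu>. dot \<xi> x \<noteq> c * dot h x"
    and IH: "\<And>\<tau>' \<nu>' \<xi>'. \<tau>' \<in> \<Phi> \<Longrightarrow> \<nu>' \<in> \<Phi> \<Longrightarrow> \<tau>' \<subset> \<nu>' \<Longrightarrow>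
      vec.dim \<nu>' - vec.dim \<tau>' < vec.dim \<nu> - vec.dim \<tau> \<Longrightarrow> \<forall>x\<in>\<tau>'. dot \<xi>' x = 0 \<Longrightarrow>
      \<exists>x\<in>\<nu>'. dot \<xi>' x > 0 \<Longrightarrow> exact (positive_faces \<tau>' \<nu>' \<xi>')"
  shows "exact (positive_faces \<tau> \<nu> \<xi>)"
proof -
  have hz: "x \<in> \<tau> \<longleftrightarrow> dot h x = 0" if "x \<in> \<nu>" for x unfolding h(2) using that by simp
  have hpos: "dot h x > 0" if "x \<in> \<nu>" "x \<notin> \<tau>" for x
    using bspec[OF h(1) that(1)] hz[OF that(1)] that(2) by simp
  \<comment> \<open>\<open>ratio_face_min\<close> yields minima, so the maximum \<open>C\<close> of
    \<open>\<xi>/h\<close> is obtained as minus the minimum for \<open>- \<xi>\<close>.\<close>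
  have hl: "\<And>x. x \<in> \<nu> \<Longrightarrow> dot h x = 0 \<Longrightarrow> dot (- \<xi>) x = 0"
    using l0 hz by (simp add: dot_simps)
  have hx0: "dot h x0 > 0" using hpos[OF lp(1)] l0 lp(2) by force
  obtain q b where q: "q \<in> \<nu>" "dot h q > 0" "dot (- \<xi>) q = b * dot h q"
    and b: "\<forall>z\<in>\<nu>. b * dot h z \<le> dot (- \<xi>) z"
    by (rule ratio_face_min[OF fan_fg[OF t(2)] bspec[OF h(1)] hl lp(1) hx0])
  define C where "C = - b"
  have Cq: "dot \<xi> q = C * dot h q" using q(3) by (simp add: C_def dot_simps minus_equation_iff[of "dot \<xi> q"])
  have Cle: "dot \<xi> z \<le> C * dot h z" if "z \<in> \<nu>" for z
    using bspec[OF b that] by (simp add: C_def dot_simps)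
  have "0 < C * dot h x0" using Cle[OF lp(1)] lp(2) by simp
  \<comment> \<open>Positivity of \<open>C\<close> makes \<open>\<xi> = C h\<close> positive on
    \<open>T\<close> off \<open>\<tau>\<close>, so every face between \<open>\<tau>\<close> and
    \<open>T\<close> belongs to the family.\<close>
  then have Cpos: "C > 0" using hx0 by (simp add: zero_less_mult_iff)
  define T where "T = {z \<in> \<nu>. dot \<xi> z = C * dot h z}"
  have "T = {z \<in> \<nu>. dot (- \<xi>) z = b * dot h z}" unfolding T_def C_def
    by (intro Collect_cong conj_cong refl) (auto simp: dot_simps)
  then have Tf: "cone_face T \<nu>" using ratio_face[OF b] by simp
  have TPhi: "T \<in> \<Phi>" by (rule fan_trans[OF t(2) Tf])
  have tT: "\<tau> \<subseteq> T" unfolding T_def using h(2) l0 by auto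
  have qT: "q \<in> T" "q \<notin> \<tau>" unfolding T_def using q(1,2) Cq hz[OF q(1)] by simp_all
  have tT': "\<tau> \<subset> T" using tT qT by blast
  \<comment> \<open>Here the hypothesis that \<open>\<xi>\<close> is not proportional to
    \<open>h\<close> enters: \<open>T\<close> is proper, so the interval up to \<open>T\<close> is
    covered by the induction hypothesis.\<close>
  have Tn: "T \<subset> \<nu>"
  proof -
    obtain x where "x \<in> \<nu>" "dot \<xi> x \<noteq> C * dot h x" using np by blast
    then show ?thesis unfolding T_def by blast
  qed
  define A where "A = positive_faces \<tau> T h"
  have "exact A" unfolding A_def
  proof (rule IH[OF t(1) TPhi tT'])
    show "vec.dim T - vec.dim \<tau> < vec.dim \<nu> - vec.dim \<tau>"
      using fan_dim[OF TPhi t(2) Tn] fan_dim[OF t(1) TPhi tT'] by simp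
    show "\<forall>x\<in>\<tau>. dot h x = 0" using h(2) by simp
    show "\<exists>x\<in>T. dot h x > 0" using qT q(2) by blast
  qed
  define S where "S = positive_faces \<tau> \<nu> \<xi>"
  have icS: "interval_closed S" unfolding S_def by (rule interval_closed_positive_faces)
  have Sm: "\<mu> \<in> \<Phi>" "\<tau> \<subseteq> \<mu>" "\<mu> \<subseteq> \<nu>" "\<And>x. x \<in> \<mu> \<Longrightarrow> x \<notin> \<tau> \<Longrightarrow> dot \<xi> x > 0" if "\<mu> \<in> S" for \<mu>
    using that unfolding S_def positive_faces_def by blast+
  have A_eq: "A = {\<mu> \<in> S. \<mu> \<subseteq> T}"
  proof (intro subset_antisym subsetI)
    fix \<mu> assume "\<mu> \<in> A"
    then have m: "\<mu> \<in> \<Phi>" "\<tau> \<subseteq> \<mu>" "\<mu> \<subseteq> T" unfolding A_def positive_faces_def by blast+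
    have "dot \<xi> x > 0" if "x \<in> \<mu>" "x \<notin> \<tau>" for x
    proof -
      have "x \<in> T" using that(1) m(3) by blast
      then have "x \<in> \<nu>" "dot \<xi> x = C * dot h x" unfolding T_def by simp_all
      then show ?thesis using hpos[of x] that(2) Cpos by simp
    qed
    then show "\<mu> \<in> {\<mu> \<in> S. \<mu> \<subseteq> T}" using m Tn unfolding S_def positive_faces_def by blast
  next
    fix \<mu> assume "\<mu> \<in> {\<mu> \<in> S. \<mu> \<subseteq> T}"
    then show "\<mu> \<in> A" using Sm[of \<mu>] hpos unfolding A_def positive_faces_def by blast
  qed
  define B where "B = {\<mu> \<in> S. \<not> \<mu> \<subseteq> T}"
  have SAB: "S = A \<union> B" "A \<inter> B = {}" unfolding A_eq B_def by blast+
  have noBA: "\<not> y \<subset> x" if "x \<in> A" "y \<in> B" for x y using that unfolding A_eq B_def by blast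
  have icB: "interval_closed B" using icS unfolding interval_closed_def B_def by blast
  have "\<exists>c. \<exists>p\<in>\<mu>. dot h p > 0 \<and> dot \<xi> p = c * dot h p \<and> (\<forall>z\<in>\<mu>. c * dot h z \<le> dot \<xi> z)"
    if "\<mu> \<in> B" for \<mu>
  proof -
    have mS: "\<mu> \<in> S" and mT: "\<not> \<mu> \<subseteq> T" using that unfolding B_def by blast+
    obtain x where x: "x \<in> \<mu>" "x \<notin> T" using mT by blast
    have xn: "x \<in> \<nu>" "x \<notin> \<tau>" using x Sm(3)[OF mS] tT by blast+
    have h': "\<And>z. z \<in> \<mu> \<Longrightarrow> 0 \<le> dot h z" using h(1) Sm(3)[OF mS] by blast
    have l': "\<And>z. z \<in> \<mu> \<Longrightarrow> dot h z = 0 \<Longrightarrow> dot \<xi> z = 0"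
      using hz l0 Sm(3)[OF mS] by blast
    obtain p a where "p \<in> \<mu>" "dot h p > 0" "dot \<xi> p = a * dot h p" "\<forall>z\<in>\<mu>. a * dot h z \<le> dot \<xi> z"
      by (rule ratio_face_min[OF fan_fg[OF Sm(1)[OF mS]] h' l' x(1) hpos[OF xn]])
    then show ?thesis by blast
  qed
  then have "\<forall>\<mu>\<in>B. \<exists>c p. p \<in> \<mu> \<and> dot h p > 0 \<and> dot \<xi> p = c * dot h p \<and> (\<forall>z\<in>\<mu>. c * dot h z \<le> dot \<xi> z)"
    by blast
  then obtain c where "\<forall>\<mu>\<in>B. \<exists>p. p \<in> \<mu> \<and> dot h p > 0 \<and> dot \<xi> p = c \<mu> * dot h p \<and> (\<forall>z\<in>\<mu>. c \<mu> * dot h z \<le> dot \<xi> z)"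
    using bchoice[of B "\<lambda>\<mu> c. \<exists>p. p \<in> \<mu> \<and> dot h p > 0 \<and> dot \<xi> p = c * dot h p \<and> (\<forall>z\<in>\<mu>. c * dot h z \<le> dot \<xi> z)"]
    by blast
  then obtain p where "\<forall>\<mu>\<in>B. p \<mu> \<in> \<mu> \<and> dot h (p \<mu>) > 0 \<and> dot \<xi> (p \<mu>) = c \<mu> * dot h (p \<mu>) \<and> (\<forall>z\<in>\<mu>. c \<mu> * dot h z \<le> dot \<xi> z)"
    using bchoice[of B "\<lambda>\<mu> p. p \<in> \<mu> \<and> dot h p > 0 \<and> dot \<xi> p = c \<mu> * dot h p \<and> (\<forall>z\<in>\<mu>. c \<mu> * dot h z \<le> dot \<xi> z)"]
    by blast
  then have p: "p \<mu> \<in> \<mu>" "dot h (p \<mu>) > 0" "dot \<xi> (p \<mu>) = c \<mu> * dot h (p \<mu>)"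
    and c: "\<And>z. z \<in> \<mu> \<Longrightarrow> c \<mu> * dot h z \<le> dot \<xi> z" if "\<mu> \<in> B" for \<mu>
    using that by blast+
  define G where "G \<mu> = {z \<in> \<mu>. dot \<xi> z = c \<mu> * dot h z}" for \<mu>
  have BS: "\<mu> \<in> S" if "\<mu> \<in> B" for \<mu> using that by (simp add: B_def)
  \<comment> \<open>\<open>c\<close> comes from a choice; it is pinned down as the ratio at any
    point where a lower bound is attained.\<close>
  have cunique: "c \<mu> = a" if "\<mu> \<in> B" "z \<in> \<mu>" "dot h z > 0" "dot \<xi> z = a * dot h z"
    "\<And>z. z \<in> \<mu> \<Longrightarrow> a * dot h z \<le> dot \<xi> z" for \<mu> a z
  proof (rule order_antisym)
    show "c \<mu> \<le> a" using c[OF that(1,2)] that(3,4) by simp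
    show "a \<le> c \<mu>" using that(5)[OF p(1)[OF that(1)]] p(2,3)[OF that(1)] by simp
  qed
  have mono: "c \<mu>' \<le> c \<mu> \<and> (c \<mu>' = c \<mu> \<longrightarrow> G \<mu> \<subseteq> G \<mu>')" if "\<mu> \<in> B" "\<mu>' \<in> B" "\<mu> \<subset> \<mu>'" for \<mu> \<mu>'
  proof
    have "p \<mu> \<in> \<mu>'" using p(1)[OF that(1)] that(3) by blast
    from c[OF that(2) this] show "c \<mu>' \<le> c \<mu>" using p(2,3)[OF that(1)] by simp
    show "c \<mu>' = c \<mu> \<longrightarrow> G \<mu> \<subseteq> G \<mu>'" unfolding G_def using that(3) by auto
  qed
  have fibre: "exact {\<mu>' \<in> B. c \<mu>' = c \<mu> \<and> G \<mu>' = G \<mu>}" if mB: "\<mu> \<in> B" for \<mu>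
  proof -
    note mS = BS[OF mB]
    have pn: "p \<mu> \<in> \<nu>" using p(1)[OF mB] Sm(3)[OF mS] by blast
    have pt: "p \<mu> \<notin> \<tau>" using hz[OF pn] p(2)[OF mB] by simp
    have "0 < dot \<xi> (p \<mu>)" using Sm(4)[OF mS p(1)[OF mB] pt] .
    \<comment> \<open>Used for the converse inclusion below: \<open>\<xi> \<ge> c h\<close> with
      \<open>c > 0\<close> makes \<open>\<xi>\<close> positive off \<open>\<tau>\<close> on every
      member of the group.\<close>
    then have cpos: "c \<mu> > 0" using p(2,3)[OF mB] by (simp add: zero_less_mult_iff)
    have cC: "c \<mu> < C"
    proof -
      obtain x where x: "x \<in> \<mu>" "x \<notin> T" using mB unfolding B_def by blast
      have xn: "x \<in> \<nu>" "x \<notin> \<tau>" using x Sm(3)[OF mS] tT by blast+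
      have "dot \<xi> x < C * dot h x" using Cle[OF xn(1)] x(2) xn(1) unfolding T_def by simp
      then have "c \<mu> * dot h x < C * dot h x" using c[OF mB x(1)] by simp
      then show ?thesis using hpos[OF xn] by simp
    qed
    have pG: "p \<mu> \<in> G \<mu>" unfolding G_def using p[OF mB] by simp
    have Gsub: "G \<mu> \<subseteq> \<mu>" unfolding G_def by blast
    have Gl: "dot \<xi> z = c \<mu> * dot h z" if "z \<in> G \<mu>" for z using that unfolding G_def by simp
    have cb: "\<forall>z\<in>\<mu>. c \<mu> * dot h z \<le> dot \<xi> z" using c[OF mB] by blast
    have GPhi: "G \<mu> \<in> \<Phi>" using fan_trans[OF Sm(1)[OF mS] ratio_face[OF cb]] unfolding G_def .
    have tG: "\<tau> \<subseteq> G \<mu>" unfolding G_def using Sm(2)[OF mS] h(2) l0 by auto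
    have tG': "\<tau> \<subset> G \<mu>" using tG pG pt by blast
    \<comment> \<open>The point \<open>q\<close> of maximal ratio serves twice: it shows that
      \<open>G\<close> is proper in \<open>\<nu>\<close>, and that \<open>\<xi> - c h\<close> is
      positive somewhere on \<open>\<nu>\<close>.\<close>
    have qG: "q \<notin> G \<mu>" using Gl[of q] Cq cC q(2) by auto
    have Gn: "G \<mu> \<subset> \<nu>" using Gsub Sm(3)[OF mS] qG q(1) by blast
    define l2 where "l2 = \<xi> - c \<mu> *s h"
    have l2: "dot l2 z = dot \<xi> z - c \<mu> * dot h z" for z by (simp add: l2_def dot_simps)
    have "exact (positive_faces (G \<mu>) \<nu> l2)"
    proof (rule IH[OF GPhi t(2) Gn])
      show "vec.dim \<nu> - vec.dim (G \<mu>) < vec.dim \<nu> - vec.dim \<tau>"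
        using fan_dim[OF t(1) GPhi tG'] fan_dim[OF GPhi t(2) Gn] by simp
      show "\<forall>x\<in>G \<mu>. dot l2 x = 0" using Gl l2 by simp
      have "dot l2 q = (C - c \<mu>) * dot h q" using l2[of q] Cq by (simp add: algebra_simps)
      then have "dot l2 q > 0" using cC q(2) by simp
      then show "\<exists>x\<in>\<nu>. dot l2 x > 0" using q(1) by blast
    qed
    also have "positive_faces (G \<mu>) \<nu> l2 = {\<mu>' \<in> B. c \<mu>' = c \<mu> \<and> G \<mu>' = G \<mu>}"
    proof (intro subset_antisym subsetI)
      fix \<mu>' assume "\<mu>' \<in> positive_faces (G \<mu>) \<nu> l2"
      then have m': "\<mu>' \<in> \<Phi>" "G \<mu> \<subseteq> \<mu>'" "\<mu>' \<subseteq> \<nu>"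
        and l2p: "\<And>x. x \<in> \<mu>' \<Longrightarrow> x \<notin> G \<mu> \<Longrightarrow> dot l2 x > 0"
        unfolding positive_faces_def by blast+
      have ge: "c \<mu> * dot h z \<le> dot \<xi> z" if "z \<in> \<mu>'" for z
        using l2p[OF that] Gl[of z] l2[of z] by (cases "z \<in> G \<mu>") auto
      have m'S: "\<mu>' \<in> S" unfolding S_def positive_faces_def
      proof (intro CollectI conjI ballI impI)
        show "\<mu>' \<in> \<Phi>" "\<mu>' \<subseteq> \<nu>" "\<tau> \<subseteq> \<mu>'" using m' tG by blast+
        fix x assume x: "x \<in> \<mu>'" "x \<notin> \<tau>"
        have "x \<in> \<nu>" using x(1) m'(3) by blast
        then have "0 < c \<mu> * dot h x" using hpos[OF _ x(2)] cpos by simp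
        then show "0 < dot \<xi> x" using ge[OF x(1)] by simp
      qed
      have pm': "p \<mu> \<in> \<mu>'" using pG m'(2) by blast
      have "p \<mu> \<notin> T" unfolding T_def using p(2,3)[OF mB] cC by simp
      then have m'B: "\<mu>' \<in> B" unfolding B_def using m'S pm' by blast
      have ceq: "c \<mu>' = c \<mu>" by (rule cunique[OF m'B pm' p(2,3)[OF mB] ge])
      have "z \<in> G \<mu>" if "z \<in> G \<mu>'" for z
      proof (rule ccontr)
        assume "z \<notin> G \<mu>"
        moreover have "z \<in> \<mu>'" "dot \<xi> z = c \<mu> * dot h z" using that ceq unfolding G_def by simp_all
        ultimately show False using l2p[of z] l2[of z] by simp
      qed
      moreover have "z \<in> G \<mu>'" if "z \<in> G \<mu>" for z
      proof -
        have "z \<in> \<mu>'" using that m'(2) by blast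
        then show ?thesis unfolding G_def[of \<mu>'] using Gl[OF that] ceq by simp
      qed
      ultimately have "G \<mu>' = G \<mu>" by blast
      then show "\<mu>' \<in> {\<mu>' \<in> B. c \<mu>' = c \<mu> \<and> G \<mu>' = G \<mu>}" using m'B ceq by simp
    next
      fix \<mu>' assume "\<mu>' \<in> {\<mu>' \<in> B. c \<mu>' = c \<mu> \<and> G \<mu>' = G \<mu>}"
      then have m': "\<mu>' \<in> B" "c \<mu>' = c \<mu>" "G \<mu>' = G \<mu>" by simp_all
      have "G \<mu> \<subseteq> \<mu>'" using m'(3) unfolding G_def by blast
      moreover have "dot l2 x > 0" if "x \<in> \<mu>'" "x \<notin> G \<mu>" for x
      proof -
        have "x \<notin> G \<mu>'" using that(2) m'(3) by simp
        then have "dot \<xi> x \<noteq> c \<mu> * dot h x" using that(1) m'(2) unfolding G_def by simp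
        moreover have "c \<mu> * dot h x \<le> dot \<xi> x" using c[OF m'(1) that(1)] m'(2) by simp
        ultimately show ?thesis using l2[of x] by simp
      qed
      ultimately show "\<mu>' \<in> positive_faces (G \<mu>) \<nu> l2"
        using Sm(1,3)[OF BS[OF m'(1)]] unfolding positive_faces_def by blast
    qed
    finally show ?thesis .
  qed
  have mono': "\<forall>\<mu>\<in>B. \<forall>\<mu>'\<in>B. \<mu> \<subset> \<mu>' \<longrightarrow> c \<mu>' \<le> c \<mu> \<and> (c \<mu>' = c \<mu> \<longrightarrow> G \<mu> \<subseteq> G \<mu>')"
    by (intro ballI impI) (rule mono)
  have fibre': "\<forall>\<mu>\<in>B. exact {\<mu>' \<in> B. c \<mu>' = c \<mu> \<and> G \<mu>' = G \<mu>}"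
    by (intro ballI) (rule fibre)
  have "exact B" by (rule exact_fibres[OF icB mono' fibre'])
  then show ?thesis using exact_Un[OF icS SAB noBA \<open>exact A\<close>] unfolding S_def by simp
qed

lemma exact_positive_faces:
  assumes "\<tau> \<in> \<Phi>" "\<nu> \<in> \<Phi>" "\<tau> \<subset> \<nu>" "\<forall>x\<in>\<tau>. dot \<xi> x = 0" "\<exists>x\<in>\<nu>. dot \<xi> x > 0"
  shows "exact (positive_faces \<tau> \<nu> \<xi>)"
  using assms
proof (induction "vec.dim \<nu> - vec.dim \<tau>" arbitrary: \<tau> \<nu> \<xi> rule: less_induct)
  case less
  note t = less.prems(1-3) and l0 = less.prems(4)
  obtain x0 where x0: "x0 \<in> \<nu>" "dot \<xi> x0 > 0" using less.prems(5) by blast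
  have f: "cone_face \<tau> \<nu>" using fan_face[OF t(1,2)] t(3) by blast
  then obtain h where h: "\<forall>x\<in>\<nu>. 0 \<le> dot h x" and h0: "\<tau> = {x \<in> \<nu>. dot h x = 0}"
    unfolding cone_face_def by blast
  have hz: "x \<in> \<tau> \<longleftrightarrow> dot h x = 0" if "x \<in> \<nu>" for x unfolding h0 using that by simp
  have hpos: "dot h x > 0" if "x \<in> \<nu>" "x \<notin> \<tau>" for x
    using bspec[OF h that(1)] hz[OF that(1)] that(2) by simp
  note step = exact_positive_faces_step[OF t h h0, OF _ _ _ _ less.hyps]
  show ?case
  proof (cases "\<forall>c. \<exists>x\<in>\<nu>. dot \<xi> x \<noteq> c * dot h x")
    case True
    show ?thesis by (rule step[OF l0 x0 True])
  next
    case False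
    \<comment> \<open>Only the interval from \<open>\<tau>\<close> to \<open>\<nu>\<close> matters, so \<open>\<xi>\<close> may be replaced by any functional that is
      positive off \<open>\<tau>\<close> but not proportional to \<open>h\<close>.\<close>
    then obtain c where c: "\<forall>x\<in>\<nu>. dot \<xi> x = c * dot h x" by blast
    have x0t: "x0 \<notin> \<tau>" using l0 x0(2) by force
    have "c > 0" using x0 bspec[OF c x0(1)] hpos[OF x0(1) x0t] by (simp add: zero_less_mult_iff)
    then have lpos: "dot \<xi> x > 0" if "x \<in> \<nu>" "x \<notin> \<tau>" for x
      using bspec[OF c that(1)] hpos[OF that] by simp
    have I: "positive_faces \<tau> \<nu> l = {\<mu> \<in> \<Phi>. \<tau> \<subseteq> \<mu> \<and> \<mu> \<subseteq> \<nu>}"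
      if "\<And>x. x \<in> \<nu> \<Longrightarrow> x \<notin> \<tau> \<Longrightarrow> dot l x > 0" for l
      unfolding positive_faces_def using that by blast
    show ?thesis
    proof (cases "vec.dim \<nu> = vec.dim \<tau> + 1")
      case True
      show ?thesis using exact_edge[OF t True] I[OF lpos] by simp
    next
      case False
      then have d2: "vec.dim \<tau> + 2 \<le> vec.dim \<nu>" using fan_dim[OF t] by simp
      obtain \<mu> where m: "cone_face \<mu> \<nu>" "\<tau> \<subset> \<mu>" "\<mu> \<subset> \<nu>"
        by (rule intermediate_face[OF fan_fg[OF t(2)] f d2])
      obtain h1 where h1: "\<forall>x\<in>\<nu>. 0 \<le> dot h1 x" "\<mu> = {x \<in> \<nu>. dot h1 x = 0}"
        using m(1) unfolding cone_face_def by blast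
      have h1z: "x \<in> \<mu> \<longleftrightarrow> dot h1 x = 0" if "x \<in> \<nu>" for x unfolding h1(2) using that by simp
      have h1t: "dot h1 x = 0" if "x \<in> \<tau>" for x
        using that m(2,3) h1z by blast
      have h1t': "\<And>x. x \<in> \<nu> \<Longrightarrow> dot h x = 0 \<Longrightarrow> dot (- h1) x = 0"
        using h1t hz by (simp add: dot_simps)
      obtain p a where a: "\<forall>z\<in>\<nu>. a * dot h z \<le> dot (- h1) z"
        by (rule ratio_face_min[OF fan_fg[OF t(2)] bspec[OF h] h1t' x0(1) hpos[OF x0(1) x0t]])
      \<comment> \<open>As \<open>a\<close> is the minimum of \<open>- h1/h\<close>, the functional
        \<open>- h1 - a h\<close> is nonnegative; adding \<open>h\<close> makes it positive off
        \<open>\<tau>\<close>. It is not a multiple of \<open>h\<close>, because \<open>h1\<close>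
        vanishes on \<open>\<mu>\<close>, which is larger than \<open>\<tau>\<close>, but not on all
        of \<open>\<nu>\<close>.\<close>
      define l where "l = (1 - a) *s h - h1"
      have l: "dot l x = dot h x - a * dot h x - dot h1 x" for x by (simp add: l_def dot_simps algebra_simps)
      have lp: "dot l x > 0" if "x \<in> \<nu>" "x \<notin> \<tau>" for x
        using bspec[OF a that(1)] hpos[OF that] l[of x] by (simp add: dot_simps)
      have lt: "\<forall>x\<in>\<tau>. dot l x = 0"
      proof
        fix x assume "x \<in> \<tau>"
        moreover have "x \<in> \<nu>" using \<open>x \<in> \<tau>\<close> t(3) by blast
        ultimately show "dot l x = 0" using h1t hz l[of x] by simp
      qed
      have "\<exists>x\<in>\<nu>. dot l x \<noteq> e * dot h x" for e
      proof (rule ccontr)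
        assume "\<not> ?thesis"
        then have e: "dot h1 x = (1 - a - e) * dot h x" if "x \<in> \<nu>" for x
          using that l[of x] by (simp add: algebra_simps)
        obtain x where x: "x \<in> \<nu>" "x \<notin> \<mu>" using m(3) by blast
        obtain y where y: "y \<in> \<mu>" "y \<notin> \<tau>" using m(2) by blast
        have yn: "y \<in> \<nu>" using y m(3) by blast
        have "1 - a - e = 0" using e[OF yn] h1z[OF yn] y hpos[OF yn] by simp
        then have "dot h1 x = 0" using e[OF x(1)] by simp
        then show False using h1z[OF x(1)] x(2) by simp
      qed
      then have "exact (positive_faces \<tau> \<nu> l)" using step[OF lt x0(1) lp[OF x0(1) x0t]] by blast
      then show ?thesis using I[OF lp] I[OF lpos] by simp
    qed
  qed
qed

text \<open>The functional that cuts \<open>\<tau>\<close> out of \<open>\<nu>\<close> is positive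
  off \<open>\<tau>\<close>, so for it the positive faces are the whole interval.\<close>

lemma exact_interval:
  assumes t: "\<tau> \<in> \<Phi>" "\<nu> \<in> \<Phi>" "\<tau> \<subset> \<nu>"
  shows "exact {\<mu> \<in> \<Phi>. \<tau> \<subseteq> \<mu> \<and> \<mu> \<subseteq> \<nu>}"
proof -
  have f: "cone_face \<tau> \<nu>" using fan_face[OF t(1,2)] t(3) by blast
  then obtain h where h: "\<forall>x\<in>\<nu>. 0 \<le> dot h x" and h0: "\<tau> = {x \<in> \<nu>. dot h x = 0}"
    unfolding cone_face_def by blast
  have hpos: "dot h x > 0" if "x \<in> \<nu>" "x \<notin> \<tau>" for x
    using bspec[OF h that(1)] that(2) unfolding h0 using that(1) by (simp add: order_less_le)
  obtain x where "x \<in> \<nu>" "x \<notin> \<tau>" using t(3) by blast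
  then have "exact (positive_faces \<tau> \<nu> h)"
    using exact_positive_faces[OF t, of h] hpos h0 by blast
  moreover have "positive_faces \<tau> \<nu> h = {\<mu> \<in> \<Phi>. \<tau> \<subseteq> \<mu> \<and> \<mu> \<subseteq> \<nu>}"
    unfolding positive_faces_def using hpos by blast
  ultimately show ?thesis by simp
qed

end

section \<open>Functions on the rays\<close>

definition ray :: "'k::linordered_field ^ 'm \<Rightarrow> ('k ^ 'm) set" where
  "ray a = {t *s a | t. 0 \<le> t}"

text \<open>\<open>A\<close> holds one generator for each ray; for the cone over a polytope these
  are the lifted vertices.\<close>

locale rayed_fan = oriented_fan \<sigma> \<omega>
  for \<sigma> :: "('k::linordered_field ^ 'm) set" and \<omega> +
  fixes A :: "('k ^ 'm) set"
  assumes finite_A: "finite A"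
    and zero_face: "{0} \<in> face_fan \<sigma>"
    and ray_face: "a \<in> A \<Longrightarrow> ray a \<in> face_fan \<sigma>"
    and nonzero: "a \<in> A \<Longrightarrow> a \<noteq> 0"
    and ray_cover: "\<tau> \<in> face_fan \<sigma> \<Longrightarrow> vec.dim \<tau> = 1 \<Longrightarrow> \<exists>a\<in>A. \<tau> = ray a"
    and ray_inj: "a \<in> A \<Longrightarrow> b \<in> A \<Longrightarrow> ray a = ray b \<Longrightarrow> a = b"
begin

lemma in_ray: "a \<in> ray a"
  unfolding ray_def by (auto intro!: exI[of _ 1])

lemma dim_ray: "a \<in> A \<Longrightarrow> vec.dim (ray a) = 1"
proof -
  assume a: "a \<in> A"
  have "vec.span (ray a) = vec.span {a}"
  proof (rule subset_antisym)
    have "ray a \<subseteq> vec.span {a}" unfolding ray_def by (auto intro: vec.span_scale vec.span_base)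
    then show "vec.span (ray a) \<subseteq> vec.span {a}" by (rule vec.span_minimal) (rule vec.subspace_span)
    show "vec.span {a} \<subseteq> vec.span (ray a)" using in_ray by (intro vec.span_mono) simp
  qed
  then have "vec.dim (ray a) = vec.dim {a}" by (metis vec.dim_span)
  also have "\<dots> = 1" using nonzero[OF a] by (simp add: vec.dim_insert)
  finally show ?thesis .
qed

lemma ray_subset_iff:
  assumes "\<tau> \<in> \<Phi>" shows "ray a \<subseteq> \<tau> \<longleftrightarrow> a \<in> \<tau>"
proof
  assume "a \<in> \<tau>"
  obtain X where X: "\<tau> = gencone X" using fan_fg[OF assms] by (auto simp: fgcone_def)
  show "ray a \<subseteq> \<tau>" using \<open>a \<in> \<tau>\<close> gencone_scale unfolding ray_def X by auto
qed (use in_ray in blast)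

lemma zero_in_fan: "\<tau> \<in> \<Phi> \<Longrightarrow> 0 \<in> \<tau>"
  using fan_fg zero_in_gencone unfolding fgcone_def by blast

lemma facet_exists:
  assumes "\<kappa> \<in> \<Phi>" "\<tau> \<in> \<Phi>" "\<kappa> \<subset> \<tau>"
  shows "\<exists>\<mu>\<in>\<Phi>. \<mu> \<subset> \<tau> \<and> vec.dim \<tau> = vec.dim \<mu> + 1"
  using assms
proof (induction "vec.dim \<tau> - vec.dim \<kappa>" arbitrary: \<kappa> rule: less_induct)
  case less
  note k = less.prems
  show ?case
  proof (cases "vec.dim \<tau> = vec.dim \<kappa> + 1")
    case True then show ?thesis using k by blast
  next
    case False
    then have d: "vec.dim \<kappa> + 2 \<le> vec.dim \<tau>" using fan_dim[OF k] by simp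
    have f: "cone_face \<kappa> \<tau>" using fan_face[OF k(1,2)] k(3) by blast
    obtain \<mu> where m: "cone_face \<mu> \<tau>" "\<kappa> \<subset> \<mu>" "\<mu> \<subset> \<tau>"
      by (rule intermediate_face[OF fan_fg[OF k(2)] f d])
    have mP: "\<mu> \<in> \<Phi>" by (rule fan_trans[OF k(2) m(1)])
    have "vec.dim \<tau> - vec.dim \<mu> < vec.dim \<tau> - vec.dim \<kappa>"
      using fan_dim[OF k(1) mP m(2)] fan_dim[OF mP k(2) m(3)] by simp
    from less.hyps[OF this mP k(2) m(3)] show ?thesis .
  qed
qed

lemma dim_zero_face: "vec.dim ({0} :: ('k ^ 'm) set) = 0"
  by (simp add: vec.dim_insert vec.span_zero)

lemma pos_dim_zero_psubset:
  assumes "\<tau> \<in> \<Phi>" "vec.dim \<tau> \<ge> 1" shows "{0} \<subset> \<tau>"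
proof -
  have "{0} \<noteq> \<tau>" using assms(2) dim_zero_face by auto
  then show ?thesis using zero_in_fan[OF assms(1)] by blast
qed

text \<open>Induction on the dimension. Above a face of codimension 2 there are two distinct facets,
  both spanned by rays. If the rays of \<open>\<tau>\<close> spanned a proper subspace, it would be
  the span of either facet, and both facets would be the intersection of \<open>\<tau>\<close> with
  it.\<close>

lemma span_rays:
  assumes "\<tau> \<in> \<Phi>" shows "vec.span (A \<inter> \<tau>) = vec.span \<tau>"
  using assms
proof (induction "vec.dim \<tau>" arbitrary: \<tau> rule: less_induct)
  case less
  note t = less.prems
  have sub: "vec.span (A \<inter> \<tau>) \<subseteq> vec.span \<tau>" by (intro vec.span_mono) simp
  consider "vec.dim \<tau> = 0" | "vec.dim \<tau> = 1" | "vec.dim \<tau> \<ge> 2" by linarith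
  then show ?case
  proof cases
    case 1
    then have "\<tau> \<subseteq> {0}" by simp
    then have "vec.span \<tau> \<subseteq> vec.span {}"
      by (intro vec.span_minimal) auto
    also have "\<dots> \<subseteq> vec.span (A \<inter> \<tau>)" by (intro vec.span_mono) simp
    finally show ?thesis using sub by blast
  next
    case 2
    obtain a where a: "a \<in> A" "\<tau> = ray a" using ray_cover[OF t 2] by blast
    have "\<tau> \<subseteq> vec.span {a}" unfolding a(2) ray_def by (auto intro: vec.span_scale vec.span_base)
    also have "\<dots> \<subseteq> vec.span (A \<inter> \<tau>)" using a in_ray by (intro vec.span_mono) simp
    finally have "vec.span \<tau> \<subseteq> vec.span (A \<inter> \<tau>)" by (rule vec.span_minimal) (rule vec.subspace_span)
    then show ?thesis using sub by blast
  next
    case 3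
    obtain \<mu> where m: "\<mu> \<in> \<Phi>" "\<mu> \<subset> \<tau>" "vec.dim \<tau> = vec.dim \<mu> + 1"
      using facet_exists[OF zero_face t pos_dim_zero_psubset[OF t]] 3 by auto
    have "vec.dim \<mu> \<ge> 1" using m(3) 3 by simp
    then obtain \<rho> where r: "\<rho> \<in> \<Phi>" "\<rho> \<subset> \<mu>" "vec.dim \<mu> = vec.dim \<rho> + 1"
      using facet_exists[OF zero_face m(1) pos_dim_zero_psubset[OF m(1)]] by blast
    have rt: "\<rho> \<subseteq> \<tau>" "vec.dim \<tau> = vec.dim \<rho> + 2" using m r by auto
    obtain \<mu>1 \<mu>2 where mm: "\<mu>1 \<noteq> \<mu>2" "{\<mu> \<in> \<Phi>. \<rho> \<subset> \<mu> \<and> \<mu> \<subset> \<tau>} = {\<mu>1, \<mu>2}"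
      and dm: "vec.dim \<mu>1 = vec.dim \<rho> + 1" "vec.dim \<mu>2 = vec.dim \<rho> + 1"
      by (rule diamond_incidence[OF r(1) t rt])
    have in12: "\<mu>1 \<in> {\<mu> \<in> \<Phi>. \<rho> \<subset> \<mu> \<and> \<mu> \<subset> \<tau>}" "\<mu>2 \<in> {\<mu> \<in> \<Phi>. \<rho> \<subset> \<mu> \<and> \<mu> \<subset> \<tau>}"
      unfolding mm(2) by simp_all
    have eq: "\<mu>' = \<tau> \<inter> vec.span (A \<inter> \<tau>)"
      if m': "\<mu>' \<in> \<Phi>" "\<mu>' \<subset> \<tau>" "vec.dim \<mu>' = vec.dim \<rho> + 1" and ne: "vec.span (A \<inter> \<tau>) \<noteq> vec.span \<tau>" for \<mu>'
    proof -
      have "vec.dim (A \<inter> \<tau>) < vec.dim \<tau>"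
        using ne vec.dim_eq_span[of "A \<inter> \<tau>" \<tau>] by (meson inf_le2 not_le)
      then have le: "vec.dim (vec.span (A \<inter> \<tau>)) \<le> vec.dim (vec.span \<mu>')"
        using m'(3) rt(2) by (simp add: vec.dim_span)
      have "vec.span \<mu>' = vec.span (A \<inter> \<mu>')" using less.hyps[OF _ m'(1)] m'(3) rt(2) by simp
      also have "\<dots> \<subseteq> vec.span (A \<inter> \<tau>)" using m'(2) by (intro vec.span_mono) blast
      finally have "vec.span \<mu>' = vec.span (A \<inter> \<tau>)"
        using vec.dim_eq_span[OF _ le] by (simp add: vec.span_span)
      moreover have "cone_face \<mu>' \<tau>" using fan_face[OF m'(1) t] m'(2) by blast
      ultimately show ?thesis using cone_face_span_Int by metis
    qed
    show ?thesis
    proof (rule ccontr)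
      assume "vec.span (A \<inter> \<tau>) \<noteq> vec.span \<tau>"
      then have "\<mu>1 = \<mu>2" using eq[OF _ _ dm(1)] eq[OF _ _ dm(2)] in12 by simp
      then show False using mm(1) by simp
    qed
  qed
qed

text \<open>The vanishing of R on edges: by the diamond between \<open>{0}\<close> and
  \<open>\<tau>\<close> there are at most two rays, and they span a plane.\<close>

lemma independent_rays:
  assumes t: "\<tau> \<in> \<Phi>" and d: "vec.dim \<tau> = 2"
  shows "vec.independent (A \<inter> \<tau>)"
proof -
  have z: "{0} \<subseteq> \<tau>" "vec.dim \<tau> = vec.dim ({0} :: ('k ^ 'm) set) + 2"
    using zero_in_fan[OF t] d dim_zero_face by auto
  obtain \<mu>1 \<mu>2 where mm: "{\<mu> \<in> \<Phi>. {0} \<subset> \<mu> \<and> \<mu> \<subset> \<tau>} = {\<mu>1, \<mu>2}"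
    by (rule diamond_incidence[OF zero_face t z])
  have "ray ` (A \<inter> \<tau>) \<subseteq> {\<mu>1, \<mu>2}"
  proof (intro image_subsetI)
    fix a assume a: "a \<in> A \<inter> \<tau>"
    have "{0} \<subset> ray a" using pos_dim_zero_psubset[OF ray_face] dim_ray a by simp
    moreover have "ray a \<subset> \<tau>"
    proof -
      have "ray a \<noteq> \<tau>" using dim_ray a d by auto
      then show ?thesis using ray_subset_iff[OF t] a by auto
    qed
    ultimately have "ray a \<in> {\<mu> \<in> \<Phi>. {0} \<subset> \<mu> \<and> \<mu> \<subset> \<tau>}" using ray_face a by simp
    then show "ray a \<in> {\<mu>1, \<mu>2}" unfolding mm .
  qed
  then have "card (ray ` (A \<inter> \<tau>)) \<le> card {\<mu>1, \<mu>2}" by (intro card_mono) simp_all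
  moreover have "inj_on ray (A \<inter> \<tau>)" using ray_inj by (intro inj_onI) simp
  ultimately have "card (A \<inter> \<tau>) \<le> 2"
    using card_insert_le_m1[of 2 "{\<mu>2}" \<mu>1] by (simp add: card_image)
  moreover have "A \<inter> \<tau> \<subseteq> vec.span (A \<inter> \<tau>)" by (rule vec.span_superset)
  moreover have "vec.dim (vec.span (A \<inter> \<tau>)) = 2" unfolding span_rays[OF t] using d by (simp add: vec.dim_span)
  ultimately show ?thesis using finite_A by (intro vec.card_le_dim_spanning[of "A \<inter> \<tau>" "vec.span (A \<inter> \<tau>)"]) simp_all
qed

section \<open>Functions on the vertices as a sum of star complexes\<close>

definition star :: "'k ^ 'm \<Rightarrow> ('k ^ 'm) set set" where
  "star a = {\<tau> \<in> \<Phi>. a \<in> \<tau>}"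

lemma interval_closed_star: "interval_closed (star a)"
  unfolding interval_closed_def star_def by blast

lemma \<delta>_star_\<delta>_star: "M \<in> \<Phi> \<Longrightarrow> a \<in> M \<Longrightarrow> \<delta> (star a) (\<delta> (star a) f) M = 0"
  by (rule \<delta>_\<delta>[OF interval_closed_star]) (simp add: star_def)

lemma \<delta>_star_cong:
  assumes "\<And>\<tau>. \<tau> \<in> \<Phi> \<Longrightarrow> a \<in> \<tau> \<Longrightarrow> \<tau> \<subset> M \<Longrightarrow> vec.dim M = vec.dim \<tau> + 1 \<Longrightarrow> f \<tau> = g \<tau>"
  shows "\<delta> (star a) f M = \<delta> (star a) g M"
  unfolding \<delta>_def star_def using assms by (intro sum.cong refl) (auto simp: inc_def)

lemma \<delta>_star_diff: "\<delta> (star a) (\<lambda>\<tau>. f \<tau> - g \<tau>) M = \<delta> (star a) f M - \<delta> (star a) g M"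
  unfolding \<delta>_def by (simp add: algebra_simps sum_subtractf)

text \<open>Exactness of the interval from the ray of \<open>a\<close> to \<open>N\<close>, in a
  single degree \<open>k\<close>. The dimension bound on \<open>N\<close> keeps the ray a proper
  face.\<close>

lemma star_exact:
  assumes N: "N \<in> \<Phi>" "a \<in> A" "a \<in> N" "vec.dim N \<ge> 2"
    and f: "\<And>M. M \<in> \<Phi> \<Longrightarrow> a \<in> M \<Longrightarrow> M \<subseteq> N \<Longrightarrow> vec.dim M = k + 1 \<Longrightarrow> \<delta> (star a) f M = 0"
  shows "\<exists>g. \<forall>M\<in>\<Phi>. a \<in> M \<longrightarrow> M \<subseteq> N \<longrightarrow> vec.dim M = k \<longrightarrow> f M = \<delta> (star a) g M"
proof -
  let ?I = "{\<mu> \<in> \<Phi>. ray a \<subseteq> \<mu> \<and> \<mu> \<subseteq> N}"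
  have "ray a \<noteq> N" using N dim_ray by auto
  then have "ray a \<subset> N" using ray_subset_iff[OF N(1)] N(3) by blast
  from exact_interval[OF ray_face[OF N(2)] N(1) this] have ex: "exact ?I" .
  have I: "M \<in> ?I \<longleftrightarrow> M \<in> \<Phi> \<and> a \<in> M \<and> M \<subseteq> N" for M
    using ray_subset_iff[of M a] by auto
  have dI: "\<delta> ?I h M = \<delta> (star a) h M" if "M \<in> ?I" for h M
    unfolding \<delta>_def
  proof (rule sum.mono_neutral_left)
    show "finite (star a)" using finite_fan unfolding star_def by simp
    show "?I \<subseteq> star a" using I unfolding star_def by blast
    show "\<forall>\<tau>\<in>star a - ?I. inc \<tau> M * h \<tau> = 0"
    proof
      fix \<tau> assume t: "\<tau> \<in> star a - ?I"
      then have "\<not> \<tau> \<subseteq> N" using I[of \<tau>] unfolding star_def by blast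
      then have "\<not> \<tau> \<subset> M" using that I by blast
      then show "inc \<tau> M * h \<tau> = 0" by (simp add: inc_def)
    qed
  qed
  \<comment> \<open>The cocycle condition is known only in degree \<open>k + 1\<close>, while
    \<open>exact\<close> asks for it in all degrees; truncating to degree \<open>k\<close> makes the
    other conditions hold trivially.\<close>
  define f' where "f' = (\<lambda>\<tau>. if vec.dim \<tau> = k then f \<tau> else 0)"
  have "\<delta> ?I f' M = 0" if M: "M \<in> ?I" for M
  proof (cases "vec.dim M = k + 1")
    case True
    have "\<delta> (star a) f' M = \<delta> (star a) f M"
      by (rule \<delta>_star_cong) (use True in \<open>simp add: f'_def\<close>)
    also have "\<dots> = 0" using f[of M] M[unfolded I] True by simp
    finally show ?thesis using dI[OF M] by simp
  next
    case False
    then have "\<delta> (star a) f' M = \<delta> (star a) (\<lambda>_. 0) M"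
      by (intro \<delta>_star_cong) (auto simp: f'_def)
    then show ?thesis using dI[OF M] by (simp add: \<delta>_def)
  qed
  then obtain g where g: "\<forall>M\<in>?I. f' M = \<delta> ?I g M" using ex unfolding exact_def by blast
  have "f M = \<delta> (star a) g M" if "M \<in> \<Phi>" "a \<in> M" "M \<subseteq> N" "vec.dim M = k" for M
  proof -
    have MI: "M \<in> ?I" unfolding I using that by simp
    show ?thesis using bspec[OF g MI] dI[OF MI] that(4) by (simp add: f'_def)
  qed
  then show ?thesis by blast
qed

text \<open>The map from functions on the vertices of \<open>\<tau>\<close> to the span of
  \<open>\<tau>\<close>, whose kernel is the space of relations. The vertex is the first argument of
  \<open>p\<close>, so that \<open>p a\<close> is a cochain on the star of \<open>a\<close>.\<close>

definition syn :: "('k ^ 'm \<Rightarrow> ('k ^ 'm) set \<Rightarrow> 'k) \<Rightarrow> ('k ^ 'm) set \<Rightarrow> 'k ^ 'm" where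
  "syn p \<tau> = (\<Sum>a\<in>A \<inter> \<tau>. p a \<tau> *s a)"

definition D :: "(('k ^ 'm) set \<Rightarrow> 'k ^ 'm) \<Rightarrow> ('k ^ 'm) set \<Rightarrow> 'k ^ 'm" where
  "D e M = (\<Sum>\<tau>\<in>\<Phi>. inc \<tau> M *s e \<tau>)"

lemma D_cong:
  assumes "\<And>\<tau>. \<tau> \<in> \<Phi> \<Longrightarrow> \<tau> \<subset> M \<Longrightarrow> vec.dim M = vec.dim \<tau> + 1 \<Longrightarrow> f \<tau> = g \<tau>"
  shows "D f M = D g M"
  unfolding D_def using assms by (intro sum.cong refl) (auto simp: inc_def)

text \<open>\<open>syn\<close> commutes with the differentials: the double sum is regrouped by
  vertices, and vertices outside \<open>M\<close> drop out since no face containing them lies below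
  \<open>M\<close>.\<close>

lemma D_syn: "D (syn p) M = (\<Sum>a\<in>A \<inter> M. \<delta> (star a) (p a) M *s a)"
proof -
  have "D (syn p) M = (\<Sum>\<tau>\<in>\<Phi>. \<Sum>a\<in>A. (if a \<in> \<tau> then inc \<tau> M * p a \<tau> else 0) *s a)"
    unfolding D_def syn_def
  proof (intro sum.cong refl)
    fix \<tau>
    have "inc \<tau> M *s (\<Sum>a\<in>A \<inter> \<tau>. p a \<tau> *s a) = (\<Sum>a\<in>A \<inter> \<tau>. (inc \<tau> M * p a \<tau>) *s a)"
      by (simp add: vec.scale_sum_right)
    also have "\<dots> = (\<Sum>a\<in>A. (if a \<in> \<tau> then inc \<tau> M * p a \<tau> else 0) *s a)"
      using finite_A by (intro sum.mono_neutral_cong_left) auto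
    finally show "inc \<tau> M *s (\<Sum>a\<in>A \<inter> \<tau>. p a \<tau> *s a) = (\<Sum>a\<in>A. (if a \<in> \<tau> then inc \<tau> M * p a \<tau> else 0) *s a)" .
  qed
  also have "\<dots> = (\<Sum>a\<in>A. (\<Sum>\<tau>\<in>\<Phi>. if a \<in> \<tau> then inc \<tau> M * p a \<tau> else 0) *s a)"
    by (subst sum.swap) (simp add: vec.scale_sum_left)
  also have "\<dots> = (\<Sum>a\<in>A. \<delta> (star a) (p a) M *s a)"
    unfolding \<delta>_def star_def using finite_fan by (simp add: sum.inter_filter)
  also have "\<dots> = (\<Sum>a\<in>A \<inter> M. \<delta> (star a) (p a) M *s a)"
  proof (rule sum.mono_neutral_right[OF finite_A Int_lower1])
    show "\<forall>a\<in>A - A \<inter> M. \<delta> (star a) (p a) M *s a = 0"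
    proof
      fix a assume a: "a \<in> A - A \<inter> M"
      have "\<delta> (star a) (p a) M = 0" unfolding \<delta>_def
      proof (rule sum.neutral, rule ballI)
        fix \<tau> assume "\<tau> \<in> star a"
        then have "\<not> \<tau> \<subset> M" using a unfolding star_def by blast
        then show "inc \<tau> M * p a \<tau> = 0" by (simp add: inc_def)
      qed
      then show "\<delta> (star a) (p a) M *s a = 0" by simp
    qed
  qed
  finally show ?thesis .
qed

lemma syn_in_span: "syn p \<tau> \<in> vec.span \<tau>"
  unfolding syn_def by (intro vec.span_sum vec.span_scale vec.span_base) simp

section \<open>Decomposing relations on a four-dimensional cone\<close>

lemma span_syn:
  assumes "\<And>\<tau>. \<tau> \<in> \<Phi> \<Longrightarrow> Q \<tau> \<Longrightarrow> e \<tau> \<in> vec.span \<tau>"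
  shows "\<exists>p. \<forall>\<tau>\<in>\<Phi>. Q \<tau> \<longrightarrow> syn p \<tau> = e \<tau>"
proof -
  have "\<forall>\<tau>\<in>{\<tau> \<in> \<Phi>. Q \<tau>}. \<exists>u. e \<tau> = (\<Sum>a\<in>A \<inter> \<tau>. u a *s a)"
  proof
    fix \<tau> assume t: "\<tau> \<in> {\<tau> \<in> \<Phi>. Q \<tau>}"
    then have "e \<tau> \<in> vec.span (A \<inter> \<tau>)" using assms span_rays by simp
    then show "\<exists>u. e \<tau> = (\<Sum>a\<in>A \<inter> \<tau>. u a *s a)" using finite_A by (auto simp: vec.span_finite)
  qed
  from bchoice[OF this] obtain u where u: "\<forall>\<tau>\<in>{\<tau> \<in> \<Phi>. Q \<tau>}. e \<tau> = (\<Sum>a\<in>A \<inter> \<tau>. u \<tau> a *s a)" by blast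
  then show ?thesis by (intro exI[of _ "\<lambda>a \<tau>. u \<tau> a"]) (simp add: syn_def)
qed

text \<open>Vanishing of the cohomology of span in degree \<open>k\<close> on the face fan of
  \<open>N\<close>, that is, of D in degree \<open>k - 1\<close>. Cochains are arbitrary functions,
  constrained only on faces of the relevant dimension; \<open>vec.dim \<tau> + 1 = k\<close> avoids
  truncated subtraction.\<close>

definition acyclic_at :: "nat \<Rightarrow> ('k ^ 'm) set \<Rightarrow> bool" where
  "acyclic_at k N \<longleftrightarrow> (\<forall>e. (\<forall>\<tau>\<in>\<Phi>. \<tau> \<subseteq> N \<longrightarrow> vec.dim \<tau> = k \<longrightarrow> e \<tau> \<in> vec.span \<tau>) \<longrightarrow>
     (\<forall>M\<in>\<Phi>. M \<subseteq> N \<longrightarrow> vec.dim M = k + 1 \<longrightarrow> D e M = 0) \<longrightarrow>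
     (\<exists>h. (\<forall>\<tau>\<in>\<Phi>. \<tau> \<subseteq> N \<longrightarrow> vec.dim \<tau> + 1 = k \<longrightarrow> h \<tau> \<in> vec.span \<tau>) \<and>
          (\<forall>E\<in>\<Phi>. E \<subseteq> N \<longrightarrow> vec.dim E = k \<longrightarrow> e E = D h E)))"

lemma acyclic_at_syn:
  assumes ac: "acyclic_at k N"
    and e: "\<And>M. M \<in> \<Phi> \<Longrightarrow> M \<subseteq> N \<Longrightarrow> vec.dim M = k + 1 \<Longrightarrow> D (syn p) M = 0"
  shows "\<exists>q. \<forall>E\<in>\<Phi>. E \<subseteq> N \<longrightarrow> vec.dim E = k \<longrightarrow> syn p E = D (syn q) E"
proof -
  obtain h where h: "\<forall>\<tau>\<in>\<Phi>. \<tau> \<subseteq> N \<longrightarrow> vec.dim \<tau> + 1 = k \<longrightarrow> h \<tau> \<in> vec.span \<tau>"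
    and he: "\<forall>E\<in>\<Phi>. E \<subseteq> N \<longrightarrow> vec.dim E = k \<longrightarrow> syn p E = D h E"
    using ac[unfolded acyclic_at_def, rule_format, of "syn p"] e syn_in_span by blast
  have "\<exists>q. \<forall>\<tau>\<in>\<Phi>. \<tau> \<subseteq> N \<and> vec.dim \<tau> + 1 = k \<longrightarrow> syn q \<tau> = h \<tau>"
    using h by (intro span_syn) simp
  then obtain q where q: "\<forall>\<tau>\<in>\<Phi>. \<tau> \<subseteq> N \<and> vec.dim \<tau> + 1 = k \<longrightarrow> syn q \<tau> = h \<tau>" by blast
  have "syn p E = D (syn q) E" if E: "E \<in> \<Phi>" "E \<subseteq> N" "vec.dim E = k" for E
  proof -
    have "D h E = D (syn q) E" by (rule D_cong) (use q E in auto)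
    then show ?thesis using he E by simp
  qed
  then show ?thesis by blast
qed

lemma syn_diff: "syn (\<lambda>a \<tau>. p a \<tau> - q a \<tau>) \<tau> = syn p \<tau> - syn q \<tau>"
  unfolding syn_def by (simp add: vec.scale_left_diff_distrib sum_subtractf)

lemma D_syn_as_syn: "D (syn q) M = syn (\<lambda>a. \<delta> (star a) (q a)) M"
  unfolding D_syn syn_def ..

lemma syn_cong: "(\<And>a. a \<in> A \<Longrightarrow> a \<in> \<tau> \<Longrightarrow> p a \<tau> = q a \<tau>) \<Longrightarrow> syn p \<tau> = syn q \<tau>"
  unfolding syn_def by (intro sum.cong refl) simp

text \<open>Injectivity of the map from the sum of the R(V) to R(M), with \<open>N\<close> the cone
  over M. A kernel element \<open>t\<close> is \<open>\<delta> q\<close> on each star. Since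
  \<open>t\<close> consists of relations, \<open>syn q\<close> is a cocycle, hence the coboundary of
  some \<open>syn u\<close>. Then \<open>q - \<delta> u\<close> consists of relations on edges, so
  it is zero, and \<open>t = \<delta> \<delta> u = 0\<close>.\<close>

lemma relation_injective:
  assumes N: "N \<in> \<Phi>" "vec.dim N = 4" and ac: "acyclic_at 2 N"
    and t: "\<And>V. V \<in> \<Phi> \<Longrightarrow> V \<subseteq> N \<Longrightarrow> vec.dim V = 3 \<Longrightarrow> syn t V = 0"
    and d: "\<And>a. a \<in> A \<Longrightarrow> a \<in> N \<Longrightarrow> \<delta> (star a) (t a) N = 0"
    and V: "V \<in> \<Phi>" "V \<subseteq> N" "vec.dim V = 3" and a: "a \<in> A" "a \<in> V"
  shows "t a V = 0"
proof -
  have top: "M = N" if "M \<in> \<Phi>" "M \<subseteq> N" "vec.dim M = 3 + 1" for M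
    using fan_dim[OF that(1) N(1)] that N(2) by (cases "M = N") auto
  have "\<forall>a\<in>A \<inter> N. \<exists>g. \<forall>M\<in>\<Phi>. a \<in> M \<longrightarrow> M \<subseteq> N \<longrightarrow> vec.dim M = 3 \<longrightarrow> t a M = \<delta> (star a) g M"
  proof
    fix a assume a: "a \<in> A \<inter> N"
    show "\<exists>g. \<forall>M\<in>\<Phi>. a \<in> M \<longrightarrow> M \<subseteq> N \<longrightarrow> vec.dim M = 3 \<longrightarrow> t a M = \<delta> (star a) g M"
    proof (rule star_exact[OF N(1)])
      show "a \<in> A" "a \<in> N" "2 \<le> vec.dim N" using a N(2) by simp_all
      show "\<delta> (star a) (t a) M = 0" if "M \<in> \<Phi>" "a \<in> M" "M \<subseteq> N" "vec.dim M = 3 + 1" for M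
        using top[OF that(1,3,4)] d a by simp
    qed
  qed
  from bchoice[OF this] obtain q where
    q: "\<forall>a\<in>A \<inter> N. \<forall>M\<in>\<Phi>. a \<in> M \<longrightarrow> M \<subseteq> N \<longrightarrow> vec.dim M = 3 \<longrightarrow> t a M = \<delta> (star a) (q a) M" by (elim exE) (rule that)
  have "D (syn q) M = 0" if "M \<in> \<Phi>" "M \<subseteq> N" "vec.dim M = 2 + 1" for M
  proof -
    have "D (syn q) M = syn t M" unfolding D_syn_as_syn
    proof (rule syn_cong)
      fix a assume "a \<in> A" "a \<in> M"
      then have "a \<in> A \<inter> N" using that(2) by blast
      then show "\<delta> (star a) (q a) M = t a M" using q that \<open>a \<in> M\<close> by simp
    qed
    then show ?thesis using t that by simp
  qed
  then obtain u where u: "\<forall>E\<in>\<Phi>. E \<subseteq> N \<longrightarrow> vec.dim E = 2 \<longrightarrow> syn q E = D (syn u) E"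
    using acyclic_at_syn[OF ac] by blast
  \<comment> \<open>On two-dimensional cones \<open>syn\<close> is injective by
    \<open>independent_rays\<close>, so equality of syntheses becomes equality of
    coefficients.\<close>
  have qu: "q a E = \<delta> (star a) (u a) E"
    if E: "E \<in> \<Phi>" "E \<subseteq> N" "vec.dim E = 2" and a: "a \<in> A" "a \<in> E" for a E
  proof -
    have "syn (\<lambda>a E. q a E - \<delta> (star a) (u a) E) E = 0"
      using u E unfolding syn_diff D_syn_as_syn by simp
    then have "(\<Sum>a\<in>A \<inter> E. (q a E - \<delta> (star a) (u a) E) *s a) = 0" unfolding syn_def .
    from vec.independentD[OF independent_rays[OF E(1,3)] _ subset_refl this] a finite_A
    show ?thesis by simp
  qed
  have "a \<in> A \<inter> N" using a V(2) by blast
  then have "t a V = \<delta> (star a) (q a) V" using q V a(2) by simp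
  also have "\<dots> = \<delta> (star a) (\<delta> (star a) (u a)) V"
    by (rule \<delta>_star_cong) (use qu V a in auto)
  also have "\<dots> = 0" by (rule \<delta>_star_\<delta>_star[OF V(1) a(2)])
  finally show ?thesis .
qed

text \<open>Surjectivity of the same map. Write \<open>r = \<delta> p\<close>; as \<open>r\<close>
  is a relation, \<open>syn p\<close> is a cocycle, hence the coboundary of some
  \<open>syn q\<close>. Subtracting \<open>\<delta> q\<close> turns \<open>p\<close> into relations
  on the facets without changing its image \<open>r\<close>.\<close>

lemma relation_surjective:
  assumes N: "N \<in> \<Phi>" "vec.dim N = 4" and ac: "acyclic_at 3 N"
    and r: "(\<Sum>a\<in>A \<inter> N. r a *s a) = 0"
  shows "\<exists>t. (\<forall>V\<in>\<Phi>. V \<subseteq> N \<longrightarrow> vec.dim V = 3 \<longrightarrow> syn t V = 0) \<and>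
    (\<forall>a\<in>A. a \<in> N \<longrightarrow> \<delta> (star a) (t a) N = r a)"
proof -
  have top: "M = N" if "M \<in> \<Phi>" "M \<subseteq> N" "vec.dim M = 3 + 1" for M
    using fan_dim[OF that(1) N(1)] that N(2) by (cases "M = N") auto
  have "\<forall>a\<in>A \<inter> N. \<exists>g. \<forall>M\<in>\<Phi>. a \<in> M \<longrightarrow> M \<subseteq> N \<longrightarrow> vec.dim M = 4 \<longrightarrow> r a = \<delta> (star a) g M"
  proof
    fix a assume a: "a \<in> A \<inter> N"
    show "\<exists>g. \<forall>M\<in>\<Phi>. a \<in> M \<longrightarrow> M \<subseteq> N \<longrightarrow> vec.dim M = 4 \<longrightarrow> r a = \<delta> (star a) g M"
    \<comment> \<open>In the top degree of \<open>N\<close> every function is a cocycle, there being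
      no face of dimension 5 in \<open>N\<close>.\<close>
    proof (rule star_exact[OF N(1), of a 4 "\<lambda>_. r a"])
      show "a \<in> A" "a \<in> N" "2 \<le> vec.dim N" using a N(2) by simp_all
      show "\<delta> (star a) (\<lambda>_. r a) M = 0" if "M \<in> \<Phi>" "a \<in> M" "M \<subseteq> N" "vec.dim M = 4 + 1" for M
        using vec.dim_subset[OF that(3)] that(4) N(2) by simp
    qed
  qed
  from bchoice[OF this] obtain p where
    p: "\<forall>a\<in>A \<inter> N. \<forall>M\<in>\<Phi>. a \<in> M \<longrightarrow> M \<subseteq> N \<longrightarrow> vec.dim M = 4 \<longrightarrow> r a = \<delta> (star a) (p a) M" by (elim exE) (rule that)
  have pN: "\<delta> (star a) (p a) N = r a" if "a \<in> A" "a \<in> N" for a using p that N by auto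
  have "D (syn p) M = 0" if M: "M \<in> \<Phi>" "M \<subseteq> N" "vec.dim M = 3 + 1" for M
  proof -
    have "D (syn p) N = (\<Sum>a\<in>A \<inter> N. r a *s a)" unfolding D_syn
      using pN by (intro sum.cong refl) simp
    then show ?thesis using r top[OF M] by simp
  qed
  then obtain q where q: "\<forall>V\<in>\<Phi>. V \<subseteq> N \<longrightarrow> vec.dim V = 3 \<longrightarrow> syn p V = D (syn q) V"
    using acyclic_at_syn[OF ac] by blast
  let ?t = "\<lambda>a V. p a V - \<delta> (star a) (q a) V"
  have "syn ?t V = 0" if "V \<in> \<Phi>" "V \<subseteq> N" "vec.dim V = 3" for V
    using q that unfolding syn_diff D_syn_as_syn by simp
  moreover have "\<delta> (star a) (?t a) N = r a" if "a \<in> A" "a \<in> N" for a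
    unfolding \<delta>_star_diff using pN[OF that] \<delta>_star_\<delta>_star[OF N(1) that(2)] by simp
  ultimately show ?thesis by (intro exI[of _ ?t]) blast
qed

end

section \<open>The connecting isomorphism\<close>

text \<open>Cones have dimension one more than faces: 3, 4, 5 stand for V, M, F, and
  \<open>mv\<close> is the choice M(V). \<open>acyclic2\<close> and \<open>acyclic3\<close> express
  D^1(M) = 0 and D^2(M) = 0.\<close>

locale vanishing_fan = rayed_fan \<sigma> \<omega> A
  for \<sigma> :: "('k::linordered_field ^ 'm) set" and \<omega> A +
  fixes mv :: "('k ^ 'm) set \<Rightarrow> ('k ^ 'm) set"
  assumes acyclic2: "N \<in> face_fan \<sigma> \<Longrightarrow> vec.dim N = 4 \<Longrightarrow> acyclic_at 2 N"
    and acyclic3: "N \<in> face_fan \<sigma> \<Longrightarrow> vec.dim N = 4 \<Longrightarrow> acyclic_at 3 N"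
    and mv: "V \<in> face_fan \<sigma> \<Longrightarrow> vec.dim V = 3 \<Longrightarrow>
      mv V \<in> face_fan \<sigma> \<and> vec.dim (mv V) = 4 \<and> V \<subset> mv V"
    and dim_top: "vec.dim \<sigma> \<ge> 4"
begin

definition flag :: "'k ^ 'm \<Rightarrow> ('k ^ 'm) set \<Rightarrow> ('k ^ 'm) set \<Rightarrow> bool" where
  "flag a V N \<longleftrightarrow> a \<in> A \<and> V \<in> \<Phi> \<and> N \<in> \<Phi> \<and> vec.dim V = 3 \<and> vec.dim N = 4 \<and> a \<in> V \<and> V \<subset> N"

definition cocycle :: "(('k ^ 'm) set \<Rightarrow> 'k ^ 'm) \<Rightarrow> bool" where
  "cocycle f \<longleftrightarrow> (\<forall>V\<in>\<Phi>. vec.dim V = 3 \<longrightarrow> f V \<in> vec.span V) \<and> (\<forall>N\<in>\<Phi>. vec.dim N = 4 \<longrightarrow> D f N = 0)"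

definition bounds :: "(('k ^ 'm) set \<Rightarrow> 'k ^ 'm) \<Rightarrow> (('k ^ 'm) set \<Rightarrow> 'k ^ 'm) \<Rightarrow> bool" where
  "bounds e f \<longleftrightarrow> (\<forall>E\<in>\<Phi>. vec.dim E = 2 \<longrightarrow> e E \<in> vec.span E) \<and> (\<forall>V\<in>\<Phi>. vec.dim V = 3 \<longrightarrow> f V = D e V)"

text \<open>The coefficient at \<open>a\<close> of the relation on \<open>N\<close> assembled from
  the relations \<open>t(., V, N)\<close>, with incidence signs.\<close>

abbreviation face_sum :: "('k ^ 'm \<Rightarrow> ('k ^ 'm) set \<Rightarrow> ('k ^ 'm) set \<Rightarrow> 'k) \<Rightarrow> 'k ^ 'm \<Rightarrow> ('k ^ 'm) set \<Rightarrow> 'k" where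
  "face_sum t a N \<equiv> \<delta> (star a) (\<lambda>V. t a V N) N"

text \<open>The clauses are equations (1), (2), (3) of the theorem, in this order, with the
  orientations of the cones in place of those of the faces.\<close>

definition normalised :: "('k ^ 'm \<Rightarrow> ('k ^ 'm) set \<Rightarrow> ('k ^ 'm) set \<Rightarrow> 'k) \<Rightarrow> bool" where
  "normalised t \<longleftrightarrow>
     (\<forall>F\<in>\<Phi>. vec.dim F = 5 \<longrightarrow> (\<forall>a\<in>A. a \<in> F \<longrightarrow> \<delta> (star a) (face_sum t a) F = 0)) \<and>
     (\<forall>V\<in>\<Phi>. \<forall>N\<in>\<Phi>. vec.dim V = 3 \<longrightarrow> vec.dim N = 4 \<longrightarrow> V \<subset> N \<longrightarrow> syn (\<lambda>a V. t a V N) V = 0) \<and>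
     (\<forall>V\<in>\<Phi>. vec.dim V = 3 \<longrightarrow> (\<forall>a\<in>A. a \<in> V \<longrightarrow> t a V (mv V) = 0))"

text \<open>
  The graph of the connecting isomorphism of the sequence of systems
  relations \<open>\<rightarrow>\<close> functions on vertices \<open>\<rightarrow>\<close> span; \<open>p\<close> lifts \<open>f\<close> to functions on vertices.
\<close>

definition corresponds :: "(('k ^ 'm) set \<Rightarrow> 'k ^ 'm) \<Rightarrow> ('k ^ 'm \<Rightarrow> ('k ^ 'm) set \<Rightarrow> ('k ^ 'm) set \<Rightarrow> 'k) \<Rightarrow> bool" where
  "corresponds f t \<longleftrightarrow> (\<exists>p. (\<forall>V\<in>\<Phi>. vec.dim V = 3 \<longrightarrow> syn p V = f V) \<and>
     (\<forall>N\<in>\<Phi>. vec.dim N = 4 \<longrightarrow> (\<forall>a\<in>A. a \<in> N \<longrightarrow> \<delta> (star a) (p a) N = face_sum t a N)))"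

lemma normalised_cocycle:
  "normalised t \<Longrightarrow> F \<in> \<Phi> \<Longrightarrow> vec.dim F = 5 \<Longrightarrow> a \<in> A \<Longrightarrow> a \<in> F \<Longrightarrow>
    \<delta> (star a) (face_sum t a) F = 0"
  unfolding normalised_def by blast

lemma normalised_relation:
  "normalised t \<Longrightarrow> V \<in> \<Phi> \<Longrightarrow> N \<in> \<Phi> \<Longrightarrow> vec.dim V = 3 \<Longrightarrow> vec.dim N = 4 \<Longrightarrow> V \<subset> N \<Longrightarrow>
    syn (\<lambda>a V. t a V N) V = 0"
  unfolding normalised_def by blast

lemma normalised_mv:
  "normalised t \<Longrightarrow> V \<in> \<Phi> \<Longrightarrow> vec.dim V = 3 \<Longrightarrow> a \<in> A \<Longrightarrow> a \<in> V \<Longrightarrow> t a V (mv V) = 0"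
  unfolding normalised_def by blast

lemma face_psubset: "V \<in> \<Phi> \<Longrightarrow> V \<subseteq> N \<Longrightarrow> vec.dim V = 3 \<Longrightarrow> vec.dim N = 4 \<Longrightarrow> V \<subset> N"
  by auto

text \<open>For a lift \<open>p0\<close> of \<open>f\<close>, \<open>\<delta> p0\<close> is a
  relation on each \<open>N\<close> because \<open>f\<close> is a cocycle. Surjectivity decomposes
  it into relations \<open>T N\<close> on the facets of \<open>N\<close>.\<close>

lemma cocycle_corresponds:
  assumes "cocycle f"
  shows "\<exists>t. normalised t \<and> corresponds f t \<and> (\<forall>a V N. \<not> flag a V N \<longrightarrow> t a V N = 0)"
proof -
  have fs: "f V \<in> vec.span V" if "V \<in> \<Phi>" "vec.dim V = 3" for V
    using assms that unfolding cocycle_def by blast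
  have fD: "D f N = 0" if "N \<in> \<Phi>" "vec.dim N = 4" for N
    using assms that unfolding cocycle_def by blast
  obtain p0 where p0: "\<forall>V\<in>\<Phi>. vec.dim V = 3 \<longrightarrow> syn p0 V = f V"
    using span_syn[of "\<lambda>V. vec.dim V = 3" f, OF fs] by blast
  have "\<forall>N\<in>{N \<in> \<Phi>. vec.dim N = 4}. \<exists>t. (\<forall>V\<in>\<Phi>. V \<subseteq> N \<longrightarrow> vec.dim V = 3 \<longrightarrow> syn t V = 0) \<and>
    (\<forall>a\<in>A. a \<in> N \<longrightarrow> \<delta> (star a) (t a) N = \<delta> (star a) (p0 a) N)"
  proof
    fix N assume "N \<in> {N \<in> \<Phi>. vec.dim N = 4}"
    then have N: "N \<in> \<Phi>" "vec.dim N = 4" by simp_all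
    show "\<exists>t. (\<forall>V\<in>\<Phi>. V \<subseteq> N \<longrightarrow> vec.dim V = 3 \<longrightarrow> syn t V = 0) \<and>
      (\<forall>a\<in>A. a \<in> N \<longrightarrow> \<delta> (star a) (t a) N = \<delta> (star a) (p0 a) N)"
    proof (rule relation_surjective[OF N acyclic3[OF N]])
      have "D (syn p0) N = D f N" by (rule D_cong) (use p0 N in simp)
      then show "(\<Sum>a\<in>A \<inter> N. \<delta> (star a) (p0 a) N *s a) = 0" using fD[OF N] unfolding D_syn by simp
    qed
  qed
  from bchoice[OF this] obtain T where "\<forall>N\<in>{N \<in> \<Phi>. vec.dim N = 4}. (\<forall>V\<in>\<Phi>. V \<subseteq> N \<longrightarrow> vec.dim V = 3 \<longrightarrow> syn (T N) V = 0) \<and>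
    (\<forall>a\<in>A. a \<in> N \<longrightarrow> \<delta> (star a) (T N a) N = \<delta> (star a) (p0 a) N)" by (elim exE) (rule that)
  note T = bspec[OF this]
  have Tsyn: "syn (T N) V = 0" if "N \<in> \<Phi>" "vec.dim N = 4" "V \<in> \<Phi>" "V \<subseteq> N" "vec.dim V = 3" for N V
    using T[of N] that by simp
  have Td: "\<delta> (star a) (T N a) N = \<delta> (star a) (p0 a) N"
    if "N \<in> \<Phi>" "vec.dim N = 4" "a \<in> A" "a \<in> N" for N a
    using T[of N] that by simp
  \<comment> \<open>Subtracting \<open>T (mv V)\<close> on \<open>V\<close> from both
    \<open>T N\<close> and \<open>p0\<close> achieves (3). It preserves the equality of
    \<open>\<delta> p\<close> with the face sums, and \<open>p\<close> still lifts \<open>f\<close>,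
    since only relations are subtracted.\<close>
  define t where "t = (\<lambda>a V N. if flag a V N then T N a V - T (mv V) a V else 0)"
  define p where "p = (\<lambda>a V. p0 a V - T (mv V) a V)"
  have mv': "mv V \<in> \<Phi>" "vec.dim (mv V) = 4" "V \<subset> mv V" if "V \<in> \<Phi>" "vec.dim V = 3" for V
    using mv[OF that] by simp_all
  have synT: "syn (\<lambda>a V. T (mv V) a V) V = 0" if "V \<in> \<Phi>" "vec.dim V = 3" for V
  proof -
    have "syn (\<lambda>a V. T (mv V) a V) V = syn (T (mv V)) V" unfolding syn_def ..
    also have "\<dots> = 0" using mv'[OF that] that by (intro Tsyn) auto
    finally show ?thesis .
  qed
  have psyn: "syn p V = f V" if "V \<in> \<Phi>" "vec.dim V = 3" for V
    unfolding p_def syn_diff using synT[OF that] p0 that by simp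
  have pd: "\<delta> (star a) (p a) N = face_sum t a N"
    if N: "N \<in> \<Phi>" "vec.dim N = 4" "a \<in> A" "a \<in> N" for N a
  proof -
    have "face_sum t a N = \<delta> (star a) (\<lambda>V. T N a V - T (mv V) a V) N"
      by (rule \<delta>_star_cong) (use N in \<open>simp add: t_def flag_def\<close>)
    also have "\<dots> = \<delta> (star a) (p a) N"
      unfolding p_def \<delta>_star_diff using Td[OF N] by simp
    finally show ?thesis by simp
  qed
  have "\<delta> (star a) (face_sum t a) F = 0"
    if F: "F \<in> \<Phi>" "vec.dim F = 5" "a \<in> A" "a \<in> F" for F a
  proof -
    have "\<delta> (star a) (face_sum t a) F = \<delta> (star a) (\<delta> (star a) (p a)) F"
      by (rule \<delta>_star_cong) (use F pd in simp)
    then show ?thesis using \<delta>_star_\<delta>_star[OF F(1,4)] by simp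
  qed
  moreover have "syn (\<lambda>a V. t a V N) V = 0"
    if V: "V \<in> \<Phi>" "N \<in> \<Phi>" "vec.dim V = 3" "vec.dim N = 4" "V \<subset> N" for V N
  proof -
    have "syn (\<lambda>a V. t a V N) V = syn (\<lambda>a V. T N a V - T (mv V) a V) V"
      by (rule syn_cong) (use V in \<open>simp add: t_def flag_def\<close>)
    also have "\<dots> = syn (T N) V - syn (\<lambda>a V. T (mv V) a V) V" by (rule syn_diff)
    also have "\<dots> = 0" using synT[OF V(1,3)] Tsyn[OF V(2,4,1) _ V(3)] V(5) by simp
    finally show ?thesis .
  qed
  moreover have "t a V (mv V) = 0" for a V by (simp add: t_def)
  ultimately have "normalised t" unfolding normalised_def by (intro conjI ballI impI)
  moreover have "corresponds f t" unfolding corresponds_def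
    by (intro exI[of _ p] conjI ballI impI) (erule (1) psyn, rule pd)
  moreover have "\<forall>a V N. \<not> flag a V N \<longrightarrow> t a V N = 0" by (simp add: t_def)
  ultimately show ?thesis by (intro exI[of _ t] conjI)
qed

lemma normalised_corresponds:
  assumes t: "normalised t"
  shows "\<exists>f. cocycle f \<and> corresponds f t \<and> (\<forall>V. \<not> (V \<in> \<Phi> \<and> vec.dim V = 3) \<longrightarrow> f V = 0)"
proof -
  have "\<forall>a\<in>A. \<exists>g. \<forall>N\<in>\<Phi>. a \<in> N \<longrightarrow> N \<subseteq> \<sigma> \<longrightarrow> vec.dim N = 4 \<longrightarrow> face_sum t a N = \<delta> (star a) g N"
  proof
    fix a assume a: "a \<in> A"
    show "\<exists>g. \<forall>N\<in>\<Phi>. a \<in> N \<longrightarrow> N \<subseteq> \<sigma> \<longrightarrow> vec.dim N = 4 \<longrightarrow> face_sum t a N = \<delta> (star a) g N"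
    proof (rule star_exact[OF top_in_fan a])
      show "a \<in> \<sigma>" using in_ray fan_subset[OF ray_face[OF a]] by blast
      show "2 \<le> vec.dim \<sigma>" using dim_top by simp
      show "\<delta> (star a) (face_sum t a) F = 0" if "F \<in> \<Phi>" "a \<in> F" "F \<subseteq> \<sigma>" "vec.dim F = 4 + 1" for F
        by (rule normalised_cocycle[OF t that(1) _ a that(2)]) (use that(4) in simp)
    qed
  qed
  from bchoice[OF this] obtain p where
    p: "\<forall>a\<in>A. \<forall>N\<in>\<Phi>. a \<in> N \<longrightarrow> N \<subseteq> \<sigma> \<longrightarrow> vec.dim N = 4 \<longrightarrow> face_sum t a N = \<delta> (star a) (p a) N"
    by (elim exE) (rule that)
  have pd: "\<delta> (star a) (p a) N = face_sum t a N" if "N \<in> \<Phi>" "vec.dim N = 4" "a \<in> A" "a \<in> N" for a N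
    using p that fan_subset[OF that(1)] by simp
  define f where "f = (\<lambda>V. if V \<in> \<Phi> \<and> vec.dim V = 3 then syn p V else 0)"
  have "D f N = 0" if N: "N \<in> \<Phi>" "vec.dim N = 4" for N
  proof -
    have "D f N = D (syn p) N" by (rule D_cong) (use N in \<open>simp add: f_def\<close>)
    also have "\<dots> = (\<Sum>a\<in>A \<inter> N. face_sum t a N *s a)"
      unfolding D_syn by (intro sum.cong refl) (use pd N in simp)
    also have "\<dots> = syn (\<lambda>a N. face_sum t a N) N" unfolding syn_def ..
    \<comment> \<open>For fixed \<open>N\<close> the face sum is the coboundary of
      \<open>t(., V, N)\<close>, so its synthesis is the coboundary of the syntheses on the facets
      \<open>V\<close>, each of which vanishes by (2).\<close>
    also have "\<dots> = D (\<lambda>V. syn (\<lambda>a V. t a V N) V) N"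
      using D_syn_as_syn[of "\<lambda>a V. t a V N" N] unfolding syn_def by simp
    also have "\<dots> = D (\<lambda>_. 0) N"
      by (rule D_cong, rule normalised_relation[OF t _ N(1) _ N(2)]) (use N(2) in simp_all)
    also have "\<dots> = 0" unfolding D_def by simp
    finally show ?thesis .
  qed
  then have "cocycle f" unfolding cocycle_def by (simp add: f_def syn_in_span)
  moreover have "corresponds f t" unfolding corresponds_def
    by (intro exI[of _ p] conjI ballI impI) (simp add: f_def, rule pd)
  ultimately show ?thesis by (intro exI[of _ f]) (simp add: f_def)
qed

text \<open>Correcting \<open>p\<close> by the lift of \<open>e\<close> gives a family
  \<open>r\<close> of relations on the V with the same face sums as \<open>t\<close>. Injectivity
  forces \<open>t(., V, N) = r(., V)\<close>, independently of \<open>N\<close>; at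
  \<open>N = mv V\<close> this is zero.\<close>

lemma corresponds_boundary:
  assumes c: "corresponds f t" and t: "normalised t" and b: "bounds e f" and fl: "flag a V N"
  shows "t a V N = 0"
proof -
  obtain p where p: "\<forall>V\<in>\<Phi>. vec.dim V = 3 \<longrightarrow> syn p V = f V"
    and pd: "\<forall>N\<in>\<Phi>. vec.dim N = 4 \<longrightarrow> (\<forall>a\<in>A. a \<in> N \<longrightarrow> \<delta> (star a) (p a) N = face_sum t a N)"
    using c unfolding corresponds_def by (elim exE conjE) (rule that)
  have es: "e E \<in> vec.span E" if "E \<in> \<Phi>" "vec.dim E = 2" for E
    using b that unfolding bounds_def by blast
  obtain q where q: "\<forall>E\<in>\<Phi>. vec.dim E = 2 \<longrightarrow> syn q E = e E"
    using span_syn[of "\<lambda>E. vec.dim E = 2" e, OF es] by blast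
  define r where "r = (\<lambda>a V. p a V - \<delta> (star a) (q a) V)"
  have rsyn: "syn r V = 0" if V: "V \<in> \<Phi>" "vec.dim V = 3" for V
  proof -
    have "D (syn q) V = D e V" by (rule D_cong) (use q V in simp)
    moreover have "syn p V = D e V" using p b V unfolding bounds_def by simp
    ultimately show ?thesis unfolding r_def syn_diff D_syn_as_syn[symmetric] by simp
  qed
  have rd: "\<delta> (star a) (r a) N = face_sum t a N" if "N \<in> \<Phi>" "vec.dim N = 4" "a \<in> A" "a \<in> N" for a N
    unfolding r_def \<delta>_star_diff using \<delta>_star_\<delta>_star[OF that(1,4)] pd that by simp
  have eq: "t a V N = r a V" if fl: "flag a V N" for a V N
  proof -
    have f: "a \<in> A" "V \<in> \<Phi>" "N \<in> \<Phi>" "vec.dim V = 3" "vec.dim N = 4" "a \<in> V" "V \<subset> N" "V \<subseteq> N"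
      using fl unfolding flag_def by auto
    have "t a V N - r a V = 0"
    proof (rule relation_injective[OF f(3,5) acyclic2[OF f(3,5)] _ _ f(2,8,4,1,6)])
      fix W assume W: "W \<in> \<Phi>" "W \<subseteq> N" "vec.dim W = 3"
      have "syn (\<lambda>a V. t a V N) W = 0"
        by (rule normalised_relation[OF t W(1) f(3) W(3) f(5) face_psubset[OF W f(5)]])
      then show "syn (\<lambda>a V. t a V N - r a V) W = 0" unfolding syn_diff using rsyn W by simp
    next
      fix a assume "a \<in> A" "a \<in> N"
      then show "\<delta> (star a) (\<lambda>V. t a V N - r a V) N = 0"
        unfolding \<delta>_star_diff using rd f(3,5) by simp
    qed
    then show ?thesis by simp
  qed
  have f: "a \<in> A" "V \<in> \<Phi>" "vec.dim V = 3" "a \<in> V" using fl unfolding flag_def by auto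
  have "flag a V (mv V)" using f mv[OF f(2,3)] unfolding flag_def by blast
  then have "r a V = t a V (mv V)" using eq by simp
  also have "\<dots> = 0" by (rule normalised_mv[OF t f(2,3,1,4)])
  finally show ?thesis using eq[OF fl] by simp
qed

text \<open>Zero face sums make the lift \<open>p\<close> a cocycle on every star, so
  \<open>p = \<delta> q\<close> and \<open>f\<close> is the coboundary of
  \<open>syn q\<close>.\<close>

lemma corresponds_zero:
  assumes c: "corresponds f t" and t: "\<And>a V N. flag a V N \<Longrightarrow> t a V N = 0"
  shows "\<exists>e. bounds e f \<and> (\<forall>E. \<not> (E \<in> \<Phi> \<and> vec.dim E = 2) \<longrightarrow> e E = 0)"
proof -
  obtain p where p: "\<forall>V\<in>\<Phi>. vec.dim V = 3 \<longrightarrow> syn p V = f V"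
    and pd: "\<forall>N\<in>\<Phi>. vec.dim N = 4 \<longrightarrow> (\<forall>a\<in>A. a \<in> N \<longrightarrow> \<delta> (star a) (p a) N = face_sum t a N)"
    using c unfolding corresponds_def by (elim exE conjE) (rule that)
  have z: "\<delta> (star a) (p a) N = 0" if N: "N \<in> \<Phi>" "vec.dim N = 4" "a \<in> A" "a \<in> N" for a N
  proof -
    have "face_sum t a N = \<delta> (star a) (\<lambda>_. 0) N"
      by (rule \<delta>_star_cong) (use N t in \<open>simp add: flag_def\<close>)
    then show ?thesis using pd N by (simp add: \<delta>_def)
  qed
  have "\<forall>a\<in>A. \<exists>g. \<forall>V\<in>\<Phi>. a \<in> V \<longrightarrow> V \<subseteq> \<sigma> \<longrightarrow> vec.dim V = 3 \<longrightarrow> p a V = \<delta> (star a) g V"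
  proof
    fix a assume a: "a \<in> A"
    show "\<exists>g. \<forall>V\<in>\<Phi>. a \<in> V \<longrightarrow> V \<subseteq> \<sigma> \<longrightarrow> vec.dim V = 3 \<longrightarrow> p a V = \<delta> (star a) g V"
    proof (rule star_exact[OF top_in_fan a])
      show "a \<in> \<sigma>" using in_ray fan_subset[OF ray_face[OF a]] by blast
      show "2 \<le> vec.dim \<sigma>" using dim_top by simp
      show "\<delta> (star a) (p a) N = 0" if "N \<in> \<Phi>" "a \<in> N" "N \<subseteq> \<sigma>" "vec.dim N = 3 + 1" for N
        using z that a by simp
    qed
  qed
  from bchoice[OF this] obtain q where
    q: "\<forall>a\<in>A. \<forall>V\<in>\<Phi>. a \<in> V \<longrightarrow> V \<subseteq> \<sigma> \<longrightarrow> vec.dim V = 3 \<longrightarrow> p a V = \<delta> (star a) (q a) V"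
    by (elim exE) (rule that)
  define e where "e = (\<lambda>E. if E \<in> \<Phi> \<and> vec.dim E = 2 then syn q E else 0)"
  have "f V = D e V" if V: "V \<in> \<Phi>" "vec.dim V = 3" for V
  proof -
    have "D e V = D (syn q) V" by (rule D_cong) (use V in \<open>simp add: e_def\<close>)
    also have "\<dots> = syn p V" unfolding D_syn_as_syn
      by (rule syn_cong) (use q V fan_subset[OF V(1)] in simp)
    finally show ?thesis using p V by simp
  qed
  then have "bounds e f" unfolding bounds_def by (simp add: e_def syn_in_span)
  then show ?thesis by (intro exI[of _ e]) (simp add: e_def)
qed

lemma corresponds_linear:
  assumes "corresponds f t" "corresponds f' t'"
  shows "corresponds (\<lambda>V. f V + c *s f' V) (\<lambda>a V N. t a V N + c * t' a V N)"
proof -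
  obtain p where p: "\<forall>V\<in>\<Phi>. vec.dim V = 3 \<longrightarrow> syn p V = f V"
    "\<forall>N\<in>\<Phi>. vec.dim N = 4 \<longrightarrow> (\<forall>a\<in>A. a \<in> N \<longrightarrow> \<delta> (star a) (p a) N = face_sum t a N)"
    using assms(1) unfolding corresponds_def by (elim exE conjE) (rule that)
  obtain p' where p': "\<forall>V\<in>\<Phi>. vec.dim V = 3 \<longrightarrow> syn p' V = f' V"
    "\<forall>N\<in>\<Phi>. vec.dim N = 4 \<longrightarrow> (\<forall>a\<in>A. a \<in> N \<longrightarrow> \<delta> (star a) (p' a) N = face_sum t' a N)"
    using assms(2) unfolding corresponds_def by (elim exE conjE) (rule that)
  have s: "syn (\<lambda>a V. p a V + c * p' a V) V = syn p V + c *s syn p' V" for V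
    unfolding syn_def by (simp add: vec.scale_left_distrib sum.distrib vec.scale_sum_right)
  have d: "\<delta> (star a) (\<lambda>V. g V + c * g' V) N = \<delta> (star a) g N + c * \<delta> (star a) g' N" for a g g' N
    unfolding \<delta>_def by (simp add: algebra_simps sum.distrib sum_distrib_left)
  show ?thesis unfolding corresponds_def
  proof (intro exI[of _ "\<lambda>a V. p a V + c * p' a V"] conjI ballI impI)
    fix V assume "V \<in> \<Phi>" "vec.dim V = 3"
    then show "syn (\<lambda>a V. p a V + c * p' a V) V = f V + c *s f' V" unfolding s using p(1) p'(1) by simp
  next
    fix N a assume "N \<in> \<Phi>" "vec.dim N = 4" "a \<in> A" "a \<in> N"
    then have "\<delta> (star a) (p a) N = face_sum t a N" "\<delta> (star a) (p' a) N = face_sum t' a N"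
      using p(2) p'(2) by blast+
    then show "\<delta> (star a) (\<lambda>V. p a V + c * p' a V) N = face_sum (\<lambda>a V N. t a V N + c * t' a V N) a N"
      unfolding d by simp
  qed
qed

end

section \<open>Cones over polytopes\<close>

lemma UNIV_option_sum: "(\<Sum>i\<in>(UNIV :: 'n::finite option set). f i) = f None + (\<Sum>j\<in>UNIV. f (Some j))"
  by (simp add: UNIV_option_conv sum.reindex)

lemma lift_None [simp]: "lift a $ None = 1"
  by (simp add: lift_def)

lemma lift_Some [simp]: "lift a $ Some j = a $ j"
  by (simp add: lift_def)

lemma lift_inject: "lift a = lift b \<longleftrightarrow> a = b"
proof
  assume "lift a = lift b"
  then have "a $ j = b $ j" for j by (metis lift_Some)
  then show "a = b" by (simp add: vec_eq_iff)
qed simp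

lemma lift_nonzero: "lift a \<noteq> 0"
proof
  assume "lift a = 0"
  then have "lift a $ None = (0 :: 'a ^ 'b option) $ None" by simp
  then show False by simp
qed

text \<open>Vectors at height 0. Differences of lifted points have this form, so the direction of a
  face sits inside the span of its cone.\<close>

definition emb :: "'k::field ^ 'm \<Rightarrow> 'k ^ 'm option" where
  "emb a = (\<chi> i. case i of None \<Rightarrow> 0 | Some j \<Rightarrow> a $ j)"

lemma emb_None [simp]: "emb a $ None = 0"
  by (simp add: emb_def)

lemma emb_Some [simp]: "emb a $ Some j = a $ j"
  by (simp add: emb_def)

lemma vec_option_eqI: "x $ None = y $ None \<Longrightarrow> (\<And>j. x $ Some j = y $ Some j) \<Longrightarrow> x = y"
  unfolding vec_eq_iff by (metis option.exhaust)

lemma linear_emb: "Vector_Spaces.linear (*s) (*s) (emb :: 'k::field ^ 'm \<Rightarrow> 'k ^ 'm option)"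
proof (unfold_locales)
  show "emb (x + y) = emb x + emb y" for x y :: "'k ^ 'm" by (rule vec_option_eqI) simp_all
  show "emb (r *s x) = r *s emb x" for r and x :: "'k ^ 'm" by (rule vec_option_eqI) simp_all
qed

lemma inj_emb: "inj emb"
  by (rule injI) (metis emb_Some vec_eq_iff)

lemma inj_on_emb: "inj_on emb S"
  using inj_emb by (rule inj_on_subset) simp

lemma emb_diff: "emb (x - y) = lift x - lift y"
  by (rule vec_option_eqI) simp_all

lemma lift_sum:
  assumes "finite S" "sum u S = 1"
  shows "lift (\<Sum>x\<in>S. u x *s x) = (\<Sum>x\<in>S. u x *s lift x)"
  by (rule vec_option_eqI) (simp_all add: assms(2))

lemma sum_lift_image:
  "(\<Sum>y\<in>lift ` S. c y *s y) = (\<Sum>x\<in>S. c (lift x) *s lift x)"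
  by (subst sum.reindex) (auto intro: inj_onI simp: lift_inject)

lemma cone_over_Khull:
  fixes S :: "('k::linordered_field ^ 'm) set"
  assumes "finite S" shows "cone_over (Khull S) = gencone (lift ` S)"
proof (intro subset_antisym subsetI)
  fix y assume "y \<in> cone_over (Khull S)"
  then consider "y = 0" | t x where "y = t *s lift x" "0 \<le> t" "x \<in> Khull S"
    unfolding cone_over_def by blast
  then show "y \<in> gencone (lift ` S)"
  proof cases
    case 1 then show ?thesis by (simp add: zero_in_gencone)
  next
    case 2
    then obtain u where u: "x = (\<Sum>x\<in>S. u x *s x)" "\<forall>x\<in>S. 0 \<le> u x" "sum u S = 1"
      unfolding Khull_def by blast
    have "lift x = (\<Sum>x\<in>S. u x *s lift x)" unfolding u(1) by (rule lift_sum[OF assms u(3)])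
    also have "\<dots> \<in> gencone (lift ` S)"
    proof -
      define c where "c = (\<lambda>y. u (inv_into S lift y))"
      have c: "c (lift x) = u x" if "x \<in> S" for x
        unfolding c_def using that by (subst inv_into_f_f) (auto intro: inj_onI simp: lift_inject)
      have "(\<Sum>x\<in>S. u x *s lift x) = (\<Sum>y\<in>lift ` S. c y *s y)"
        unfolding sum_lift_image using c by simp
      moreover have "\<forall>y\<in>lift ` S. 0 \<le> c y" using c u(2) by auto
      ultimately show ?thesis unfolding gencone_def by blast
    qed
    finally show ?thesis using 2 gencone_scale by blast
  qed
next
  fix y assume "y \<in> gencone (lift ` S)"
  then obtain c where c: "y = (\<Sum>y\<in>lift ` S. c y *s y)" "\<forall>y\<in>lift ` S. 0 \<le> c y"
    unfolding gencone_def by blast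
  define d where "d = (\<lambda>x. c (lift x))"
  have y: "y = (\<Sum>x\<in>S. d x *s lift x)" unfolding c(1) sum_lift_image d_def ..
  have d: "0 \<le> d x" if "x \<in> S" for x using c(2) that by (simp add: d_def)
  show "y \<in> cone_over (Khull S)"
  proof (cases "sum d S = 0")
    case True
    then have "d x = 0" if "x \<in> S" for x using that d assms by (simp add: sum_nonneg_eq_0_iff)
    then have "y = 0" unfolding y by simp
    then show ?thesis unfolding cone_over_def by simp
  next
    case False
    \<comment> \<open>Dividing by the total weight turns a conic combination of lifted points into
      the lift of a convex combination.\<close>
    define T where "T = sum d S"
    have T: "T > 0" using False d unfolding T_def by (simp add: order_less_le sum_nonneg)
    define x where "x = (\<Sum>x\<in>S. (d x / T) *s x)"
    have s1: "(\<Sum>x\<in>S. d x / T) = 1" using False by (simp add: sum_divide_distrib[symmetric] T_def)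
    then have "lift x = (\<Sum>x\<in>S. (d x / T) *s lift x)" unfolding x_def by (rule lift_sum[OF assms])
    then have "T *s lift x = y" unfolding y using T by (simp add: vec.scale_sum_right)
    moreover have "x \<in> Khull S" unfolding Khull_def x_def using s1 d T
      by (intro CollectI exI[of _ "\<lambda>x. d x / T"]) simp
    ultimately show ?thesis unfolding cone_over_def using T by (auto intro!: exI[of _ T] exI[of _ x])
  qed
qed

lemma fgcone_cone_over: "Kpolytope P \<Longrightarrow> fgcone (cone_over P)"
  unfolding Kpolytope_def fgcone_def using cone_over_Khull by (metis finite_imageI)

lemma lift_in_cone_over: "lift x \<in> cone_over P \<longleftrightarrow> x \<in> P"
proof
  assume "lift x \<in> cone_over P"
  then obtain t y where y: "lift x = t *s lift y" "y \<in> P"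
    unfolding cone_over_def using lift_nonzero[of x] by blast
  have "lift x $ None = (t *s lift y) $ None" using y(1) by simp
  then have "t = 1" by simp
  then show "x \<in> P" using y by (simp add: lift_inject)
next
  assume "x \<in> P"
  then show "lift x \<in> cone_over P" unfolding cone_over_def by (auto intro!: exI[of _ 1] exI[of _ x])
qed

lemma cone_over_mono_iff: "cone_over P \<subseteq> cone_over Q \<longleftrightarrow> P \<subseteq> Q"
proof
  assume "cone_over P \<subseteq> cone_over Q"
  then show "P \<subseteq> Q" using lift_in_cone_over by blast
next
  assume "P \<subseteq> Q"
  then show "cone_over P \<subseteq> cone_over Q" unfolding cone_over_def by blast
qed

lemma cone_over_eq_iff: "cone_over P = cone_over Q \<longleftrightarrow> P = Q"
  using cone_over_mono_iff by (metis subset_antisym order_refl)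

lemma cone_over_psubset_iff: "cone_over P \<subset> cone_over Q \<longleftrightarrow> P \<subset> Q"
  by (simp add: psubset_eq cone_over_mono_iff cone_over_eq_iff)

lemma cone_over_singleton: "cone_over {a} = ray (lift a)"
proof -
  have "0 = 0 *s lift a" by simp
  then have "0 \<in> ray (lift a)" unfolding ray_def by blast
  moreover have "cone_over {a} = insert 0 (ray (lift a))" unfolding cone_over_def ray_def by simp
  ultimately show ?thesis by (simp add: insert_absorb)
qed

lemma dot_lift: "dot w (lift x) = w $ None + dot (\<chi> j. w $ Some j) x"
  unfolding dot_def by (simp add: UNIV_option_sum)

lemma cone_over_face:
  assumes "face Q P" shows "cone_over Q \<in> face_fan (cone_over P)"
proof -
  obtain u c where u: "\<forall>x\<in>P. dot u x \<le> c" "Q = {x \<in> P. dot u x = c}"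
    using assms unfolding face_def by blast
  \<comment> \<open>A face of a polytope is where a functional is maximal, a face of a cone where
    one is minimal with value 0; \<open>w\<close> has the value \<open>c - dot u x\<close> at
    \<open>lift x\<close>.\<close>
  define w where "w = (\<chi> i. case i of None \<Rightarrow> c | Some j \<Rightarrow> - (u $ j))"
  have "(\<chi> j. w $ Some j) = - u" by (simp add: vec_eq_iff w_def)
  then have w: "dot w (lift x) = c - dot u x" for x
    unfolding dot_lift by (simp add: dot_simps w_def)
  have "\<forall>y\<in>cone_over P. 0 \<le> dot w y"
    unfolding cone_over_def using u(1) by (auto simp: dot_simps w)
  moreover have "cone_over Q = {y \<in> cone_over P. dot w y = 0}"
  proof (intro subset_antisym subsetI)
    fix y assume "y \<in> cone_over Q"
    then show "y \<in> {y \<in> cone_over P. dot w y = 0}"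
      unfolding cone_over_def u(2) by (auto simp: dot_simps w)
  next
    fix y assume "y \<in> {y \<in> cone_over P. dot w y = 0}"
    then have y: "y \<in> cone_over P" "dot w y = 0" by simp_all
    then consider "y = 0" | t x where "y = t *s lift x" "0 \<le> t" "x \<in> P"
      unfolding cone_over_def by blast
    then show "y \<in> cone_over Q"
    proof cases
      case 1 then show ?thesis unfolding cone_over_def by simp
    next
      case 2
      then have "t * (c - dot u x) = 0" using y(2) by (simp add: dot_simps w)
      then consider "t = 0" | "x \<in> Q" using 2(3) u(2) by auto
      then show ?thesis using 2 unfolding cone_over_def by cases auto
    qed
  qed
  ultimately show ?thesis unfolding face_fan_def cone_face_def by blast
qed

text \<open>The face \<open>Q\<close> is empty exactly for the apex \<open>{0}\<close>;
  \<open>cone_faces\<close> rules this out by dimension.\<close>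

lemma face_of_cone:
  assumes "\<tau> \<in> face_fan (cone_over P)"
  shows "\<exists>Q. face Q P \<and> \<tau> = cone_over Q"
proof -
  obtain w where w: "\<forall>y\<in>cone_over P. 0 \<le> dot w y" "\<tau> = {y \<in> cone_over P. dot w y = 0}"
    using assms unfolding face_fan_def cone_face_def by blast
  define u where "u = - (\<chi> j. w $ Some j)"
  have d: "dot w (lift x) = w $ None - dot u x" for x unfolding dot_lift u_def by (simp add: dot_simps)
  define Q where "Q = {x \<in> P. dot u x = w $ None}"
  have "face Q P" unfolding face_def
  proof (intro exI[of _ u] exI[of _ "w $ None"] conjI ballI)
    fix x assume "x \<in> P"
    then have "0 \<le> dot w (lift x)" using w(1) by (simp add: lift_in_cone_over)
    then show "dot u x \<le> w $ None" using d[of x] by simp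
  qed (simp add: Q_def)
  moreover have "\<tau> = cone_over Q"
  proof (intro subset_antisym subsetI)
    fix y assume "y \<in> \<tau>"
    then have y: "y \<in> cone_over P" "dot w y = 0" unfolding w(2) by simp_all
    then consider "y = 0" | t x where "y = t *s lift x" "0 \<le> t" "x \<in> P"
      unfolding cone_over_def by blast
    then show "y \<in> cone_over Q"
    proof cases
      case 1 then show ?thesis unfolding cone_over_def by simp
    next
      case 2
      then have "t * (w $ None - dot u x) = 0" using y(2) by (simp add: dot_simps d)
      then consider "t = 0" | "x \<in> Q" using 2(3) unfolding Q_def by auto
      then show ?thesis using 2 unfolding cone_over_def by cases auto
    qed
  next
    fix y assume "y \<in> cone_over Q"
    then show "y \<in> \<tau>" unfolding w(2) cone_over_def Q_def by (auto simp: dot_simps d)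
  qed
  ultimately show ?thesis by blast
qed

text \<open>A point of \<open>Q\<close> supplies the height coordinate, directions have height 0,
  and \<open>lift z = lift x + emb (z - x)\<close>. This carries an orientation of a face to one of
  its cone and gives the dimension shift by one.\<close>

lemma ordered_basis_lift:
  fixes Q :: "('k::linordered_field ^ 'm) set"
  assumes b: "ordered_basis bs (direction Q)" and x: "x \<in> Q"
  shows "ordered_basis (lift x # map emb bs) (vec.span (cone_over Q))"
proof -
  have b': "distinct bs" "vec.independent (set bs)" "vec.span (set bs) = direction Q"
    using b unfolding ordered_basis_def by auto
  have si: "vec.span (emb ` S) = emb ` vec.span S" for S :: "('k ^ 'm) set"
    by (rule vec.linear_span_image[OF linear_emb])
  have sp: "vec.span (set (map emb bs)) = emb ` direction Q" using si b'(3) by simp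
  have ind: "vec.independent (emb ` set bs)"
    by (rule vec.linear_independent_injective_image[OF linear_emb b'(2)])
      (rule inj_on_emb)
  have ob: "ordered_basis (map emb bs) (emb ` direction Q)"
    unfolding ordered_basis_def sp using b'(1) ind
    by (simp add: distinct_map inj_on_emb)
  have nin: "lift x \<notin> emb ` direction Q"
  proof
    assume "lift x \<in> emb ` direction Q"
    then obtain v where "lift x = emb v" by blast
    then have "lift x $ None = emb v $ None" by simp
    then show False by simp
  qed
  have "vec.span (insert (lift x) (emb ` direction Q)) = vec.span (cone_over Q)"
  proof (rule subset_antisym; rule vec.span_minimal[OF _ vec.subspace_span])
    have lq: "lift y \<in> vec.span (cone_over Q)" if "y \<in> Q" for y
      using that by (intro vec.span_base) (simp add: lift_in_cone_over)
    have "emb ` {y - z |y z. y \<in> Q \<and> z \<in> Q} \<subseteq> vec.span (cone_over Q)"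
      by (auto simp: emb_diff intro!: vec.span_diff lq)
    then have "vec.span (emb ` {y - z |y z. y \<in> Q \<and> z \<in> Q}) \<subseteq> vec.span (cone_over Q)"
      by (rule vec.span_minimal[OF _ vec.subspace_span])
    then have "emb ` direction Q \<subseteq> vec.span (cone_over Q)" unfolding si direction_def .
    then show "insert (lift x) (emb ` direction Q) \<subseteq> vec.span (cone_over Q)" using lq[OF x] by simp
    show "cone_over Q \<subseteq> vec.span (insert (lift x) (emb ` direction Q))"
    proof
      fix y assume "y \<in> cone_over Q"
      then consider "y = 0" | t z where "y = t *s lift z" "z \<in> Q" unfolding cone_over_def by blast
      then show "y \<in> vec.span (insert (lift x) (emb ` direction Q))"
      proof cases
        case 1 then show ?thesis by (simp add: vec.span_zero)
      next
        case 2
        have "z - x \<in> direction Q" unfolding direction_def using 2(2) x by (intro vec.span_base) blast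
        then have "emb (z - x) \<in> vec.span (insert (lift x) (emb ` direction Q))"
          by (intro vec.span_base) simp
        moreover have "lift x \<in> vec.span (insert (lift x) (emb ` direction Q))"
          by (intro vec.span_base) simp
        ultimately have "emb (z - x) + lift x \<in> vec.span (insert (lift x) (emb ` direction Q))"
          by (rule vec.span_add)
        then have "lift z \<in> vec.span (insert (lift x) (emb ` direction Q))" by (simp add: emb_diff)
        then show ?thesis unfolding 2(1) by (rule vec.span_scale)
      qed
    qed
  qed
  then show ?thesis using ordered_basis_Cons[OF ob nin] by simp
qed

lemma ordered_basis_exists: "\<exists>bs. ordered_basis bs (direction Q)"
proof -
  obtain B where B': "B \<subseteq> direction Q" "vec.independent B" "direction Q \<subseteq> vec.span B"
    by (rule vec.maximal_independent_subset)
  have "vec.span B \<subseteq> direction Q"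
    unfolding direction_def
    by (rule vec.span_minimal[OF B'(1)[unfolded direction_def] vec.subspace_span])
  then have B: "vec.independent B" "vec.span B = direction Q" using B' by blast+
  obtain bs where "set bs = B" "distinct bs"
    using finite_distinct_list[OF vec.finiteI_independent[OF B(1)]] by blast
  then show ?thesis using B unfolding ordered_basis_def by (intro exI[of _ bs]) simp
qed

lemma dim_cone_over:
  assumes "Q \<noteq> {}" shows "vec.dim (cone_over Q) = vec.dim (direction Q) + 1"
proof -
  obtain x where x: "x \<in> Q" using assms by blast
  obtain bs where bs: "ordered_basis bs (direction Q)" using ordered_basis_exists[of Q] by (elim exE) (rule that)
  from ordered_basis_length[OF ordered_basis_lift[OF bs x]] ordered_basis_length[OF bs]
  show ?thesis by (simp add: vec.dim_span)
qed

lemma cone_over_empty: "cone_over {} = {0}"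
  by (simp add: cone_over_def)

lemma faces_cone:
  "Q \<in> faces P d \<Longrightarrow> cone_over Q \<in> face_fan (cone_over P) \<and> vec.dim (cone_over Q) = d + 1"
  unfolding faces_def by (simp add: cone_over_face dim_cone_over)

lemma cone_faces:
  assumes t: "\<tau> \<in> face_fan (cone_over P)" and d: "vec.dim \<tau> = d + 1"
  shows "\<exists>Q\<in>faces P d. \<tau> = cone_over Q"
proof -
  obtain Q where Q: "face Q P" "\<tau> = cone_over Q"
    using face_of_cone[OF t] by (elim exE conjE) (rule that)
  have "Q \<noteq> {}"
  proof
    assume "Q = {}"
    then have "vec.dim \<tau> = 0" unfolding Q(2) by (simp add: cone_over_empty vec.dim_insert vec.span_zero)
    then show False using d by simp
  qed
  moreover have "vec.dim (direction Q) = d" using dim_cone_over[OF \<open>Q \<noteq> {}\<close>] d Q(2) by simp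
  ultimately show ?thesis using Q by (intro bexI[of _ Q]) (simp_all add: faces_def)
qed

lemma zero_cone_face: "{0} \<in> face_fan (cone_over P)"
proof -
  have "face {} P" unfolding face_def by (intro exI[of _ 0] exI[of _ 1]) (simp add: dot_simps)
  from cone_over_face[OF this] show ?thesis by (simp add: cone_over_empty)
qed

lemma vertex_of_faces:
  assumes Q: "Q \<in> faces P 0" shows "\<exists>a\<in>vertices P. Q = {a}"
proof -
  have Qne: "Q \<noteq> {}" "vec.dim (direction Q) = 0" using Q unfolding faces_def by simp_all
  obtain a where a: "a \<in> Q" using Qne(1) by (metis all_not_in_conv)
  have dQ: "direction Q \<subseteq> {0}" using Qne(2) unfolding vec.dim_eq_0 .
  have xa: "x = a" if "x \<in> Q" for x
  proof -
    have "x - a \<in> direction Q"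
      unfolding direction_def using that a by (intro vec.span_base) (rule CollectI, intro exI conjI, rule refl)
    then have "x - a \<in> {0}" by (rule subsetD[OF dQ])
    then show ?thesis by simp
  qed
  have "Q = {a}" using xa a by blast
  then show ?thesis using Q unfolding vertices_def by (intro bexI[of _ a]) simp_all
qed

lemma rayed_fan_cone_over:
  assumes P: "Kpolytope P"
    and or: "\<And>\<tau>. \<tau> \<in> face_fan (cone_over P) \<Longrightarrow> ordered_basis (\<omega> \<tau>) (vec.span \<tau>)"
  shows "rayed_fan (cone_over P) \<omega> (lift ` vertices P)"
proof -
  have fg: "fgcone (cone_over P)" by (rule fgcone_cone_over[OF P])
  have rf: "ray (lift a) \<in> face_fan (cone_over P)" if "a \<in> vertices P" for a
    using that faces_cone[of "{a}" P 0] unfolding vertices_def by (simp add: cone_over_singleton)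
  have rinj: "a = b" if "ray (lift a) = ray (lift b)" for a b :: "'a ^ 'b"
    using that cone_over_eq_iff[of "{a}" "{b}"] by (simp add: cone_over_singleton)
  show ?thesis
  proof (unfold_locales)
    show "fgcone (cone_over P)" by (rule fg)
    show "ordered_basis (\<omega> \<tau>) (vec.span \<tau>)" if "\<tau> \<in> face_fan (cone_over P)" for \<tau> by (rule or[OF that])
    have "finite ((\<lambda>a. ray (lift a)) ` vertices P)"
      by (rule finite_subset[OF _ finite_face_fan[OF fg]]) (rule image_subsetI, rule rf)
    then have "finite (vertices P)" by (rule finite_imageD) (rule inj_onI, rule rinj)
    then show "finite (lift ` vertices P)" by simp
    show "{0} \<in> face_fan (cone_over P)" by (rule zero_cone_face)
    show "ray a \<in> face_fan (cone_over P)" if "a \<in> lift ` vertices P" for a using that by (elim imageE) (simp add: rf)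
    show "a \<noteq> 0" if "a \<in> lift ` vertices P" for a using that by (elim imageE) (simp add: lift_nonzero)
    show "a = b" if "a \<in> lift ` vertices P" "b \<in> lift ` vertices P" "ray a = ray b" for a b
      using that by (elim imageE) (auto dest: rinj)
    show "\<exists>a\<in>lift ` vertices P. \<tau> = ray a"
      if t: "\<tau> \<in> face_fan (cone_over P)" "vec.dim \<tau> = 1" for \<tau>
    proof -
      have "vec.dim \<tau> = 0 + 1" using t(2) by simp
      from cone_faces[OF t(1) this] obtain Q where Q: "Q \<in> faces P 0" "\<tau> = cone_over Q"
        by (elim bexE) (rule that)
      obtain a where a: "a \<in> vertices P" "Q = {a}" using vertex_of_faces[OF Q(1)] by (elim bexE) (rule that)
      have "\<tau> = ray (lift a)" using Q(2) a(2) by (simp only: cone_over_singleton)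
      moreover have "lift a \<in> lift ` vertices P" using a(1) by (rule imageI)
      ultimately show ?thesis by (intro bexI)
    qed
  qed
qed

section \<open>The ordered pairs of intermediate faces\<close>

lemma rel_det_emb:
  assumes "rel_det bs cs d" shows "rel_det (map emb bs) (map emb cs) d"
proof -
  let ?n = "length bs"
  obtain A where A: "length cs = ?n" "\<forall>j<?n. cs ! j = (\<Sum>i<?n. A i j *s bs ! i)"
    "d = Determinant.det (Matrix.mat ?n ?n (\<lambda>(i, j). A i j))"
    using assms unfolding rel_det_def by auto
  have "map emb cs ! j = (\<Sum>i<?n. A i j *s map emb bs ! i)" if "j < ?n" for j
  proof (rule vec_option_eqI)
    have "cs ! j = (\<Sum>i<?n. A i j *s bs ! i)" using A(2) that by blast
    then show "(map emb cs ! j) $ Some k = (\<Sum>i<?n. A i j *s map emb bs ! i) $ Some k" for k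
      using that A(1) by simp
    show "(map emb cs ! j) $ None = (\<Sum>i<?n. A i j *s map emb bs ! i) $ None"
      using that A(1) by simp
  qed
  then show ?thesis unfolding rel_det_def using A(1,3)
    by (intro conjI exI[of _ A]) simp_all
qed

lemma diff_in_direction: "x \<in> P \<Longrightarrow> y \<in> P \<Longrightarrow> x - y \<in> direction P"
  unfolding direction_def by (intro vec.span_base CollectI exI[of _ x] exI[of _ y] conjI refl)

lemma direction_mono: "P \<subseteq> Q \<Longrightarrow> direction P \<subseteq> direction Q"
  unfolding direction_def
  by (intro vec.span_mono subsetI, elim CollectE exE conjE, intro CollectI exI conjI)
    (assumption | erule (1) subsetD)+

lemma face_diff_notin_direction:
  assumes V: "face V P" and x: "x \<in> V" and q: "q \<in> P" "q \<notin> V"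
  shows "q - x \<notin> direction V"
proof
  assume d: "q - x \<in> direction V"
  obtain u c where u: "\<forall>x\<in>P. dot u x \<le> c" "V = {x \<in> P. dot u x = c}"
    using V unfolding face_def by (elim exE conjE) (rule that)
  have uV: "dot u y = c" if "y \<in> V" for y using that unfolding u(2) by simp
  have "dot u (q - x) = 0"
    by (rule dot_zero_on_span[OF _ d[unfolded direction_def]]) (auto simp: dot_simps uV)
  then have "dot u q = c" using uV[OF x] by (simp add: dot_simps)
  then show False using q unfolding u(2) by simp
qed

locale oriented_polytope =
  fixes \<Delta> :: "('k::linordered_field ^ 'n) set"
    and \<omega> :: "('k ^ 'n option) set \<Rightarrow> ('k ^ 'n option) list"
    and \<theta> :: "('k ^ 'n) set \<Rightarrow> ('k ^ 'n) list"
  assumes polytope: "Kpolytope \<Delta>"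
    and cone_orientation: "\<And>\<tau>. \<tau> \<in> face_fan (cone_over \<Delta>) \<Longrightarrow> ordered_basis (\<omega> \<tau>) (vec.span \<tau>)"
    and face_orientation: "\<And>Q. Q \<in> faces \<Delta> 2 \<union> faces \<Delta> 4 \<Longrightarrow> ordered_basis (\<theta> Q) (direction Q)"

sublocale oriented_polytope \<subseteq> rayed_fan "cone_over \<Delta>" \<omega> "lift ` vertices \<Delta>"
  by (rule rayed_fan_cone_over[OF polytope cone_orientation])

context oriented_polytope begin

text \<open>The comparison of the two orientations must not depend on the point \<open>x\<close> of
  \<open>Q\<close>, so that one sign per face is well defined.\<close>

lemma orientation_sign_exists:
  assumes Q: "Q \<in> faces \<Delta> 2 \<union> faces \<Delta> 4"
  shows "\<exists>e. (e = 1 \<or> e = - 1) \<and>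
    (\<forall>x\<in>Q. \<exists>d. d \<noteq> 0 \<and> rel_det (\<omega> (cone_over Q)) (lift x # map emb (\<theta> Q)) d \<and> sgn d = (e :: 'k))"
proof -
  have ne: "Q \<noteq> {}" using Q unfolding faces_def by auto
  then obtain x0 where x0: "x0 \<in> Q" by (metis all_not_in_conv)
  have QPhi: "cone_over Q \<in> \<Phi>" using Q by (elim UnE) (simp_all add: faces_cone)
  obtain d where d: "rel_det (\<omega> (cone_over Q)) (lift x0 # map emb (\<theta> Q)) d" "d \<noteq> 0"
    by (rule rel_det_bases[OF orient[OF QPhi] ordered_basis_lift[OF face_orientation[OF Q] x0]])
  have sp: "vec.span (set (\<theta> Q)) = direction Q" using face_orientation[OF Q] unfolding ordered_basis_def by simp
  \<comment> \<open>Moving the base point adds a direction vector of \<open>Q\<close> to the first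
    basis vector, a transvection with factor 1.\<close>
  have "rel_det (\<omega> (cone_over Q)) (lift x # map emb (\<theta> Q)) d" if x: "x \<in> Q" for x
  proof -
    have "emb (x - x0) \<in> emb ` vec.span (set (\<theta> Q))" unfolding sp
      by (rule imageI, rule diff_in_direction[OF x x0])
    then have "emb (x - x0) \<in> vec.span (set (map emb (\<theta> Q)))"
      using vec.linear_span_image[OF linear_emb, of "set (\<theta> Q)"] by simp
    from rel_det_trans[OF d(1) rel_det_transvection[OF this, of "lift x0" 1]]
    show ?thesis by (simp add: emb_diff)
  qed
  moreover have "sgn d = 1 \<or> sgn d = - 1" using d(2) by (simp add: sgn_if)
  ultimately show ?thesis using d(2) by (intro exI[of _ "sgn d"] exI[of _ d] conjI ballI refl)
qed

text \<open>\<open>\<eta> Q\<close> compares the orientations \<open>\<theta>\<close> of \<open>Q\<close> and \<open>\<omega>\<close> of its cone.\<close>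

definition \<eta> :: "('k ^ 'n) set \<Rightarrow> 'k" where
  "\<eta> Q = (SOME e. (e = 1 \<or> e = - 1) \<and>
    (\<forall>x\<in>Q. \<exists>d. d \<noteq> 0 \<and> rel_det (\<omega> (cone_over Q)) (lift x # map emb (\<theta> Q)) d \<and> sgn d = e))"

lemma \<eta>_spec:
  assumes Q: "Q \<in> faces \<Delta> 2 \<union> faces \<Delta> 4"
  shows "\<eta> Q = 1 \<or> \<eta> Q = - 1"
    and "x \<in> Q \<Longrightarrow> \<exists>d. d \<noteq> 0 \<and> rel_det (\<omega> (cone_over Q)) (lift x # map emb (\<theta> Q)) d \<and> sgn d = \<eta> Q"
proof -
  note spec = someI_ex[OF orientation_sign_exists[OF Q], folded \<eta>_def]
  show "\<eta> Q = 1 \<or> \<eta> Q = - 1" by (rule conjunct1[OF spec])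
  show "x \<in> Q \<Longrightarrow> \<exists>d. d \<noteq> 0 \<and> rel_det (\<omega> (cone_over Q)) (lift x # map emb (\<theta> Q)) d \<and> sgn d = \<eta> Q"
    by (rule bspec[OF conjunct2[OF spec]])
qed

lemma faces_subset_cone:
  assumes "Q \<in> faces \<Delta> d" "R \<in> faces \<Delta> e"
  shows "cone_face (cone_over Q) (cone_over R) \<longleftrightarrow> Q \<subseteq> R"
  using cone_face_in_fan[OF conjunct1[OF faces_cone[OF assms(1)]] conjunct1[OF faces_cone[OF assms(2)]]]
  by (simp add: cone_over_mono_iff)

text \<open>The orientation of \<open>lift x # E @ [P, Q']\<close> in the cone over \<open>F\<close>
  is computed twice: along V, N, F with outward vectors first, and through
  \<open>\<theta> F\<close>. Comparing the two expresses the sign used in equation (1) by incidence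
  numbers.\<close>

lemma theta_sign:
  assumes V: "V \<in> faces \<Delta> 2" and F: "F \<in> faces \<Delta> 4" and N: "N \<in> faces \<Delta> 3"
    and sub: "V \<subset> N" "N \<subset> F"
    and x: "x \<in> V" and p: "p \<in> F" "p \<notin> N" and q: "q \<in> N" "q \<notin> V"
  shows "\<exists>g. rel_det (\<theta> F) (\<theta> V @ [p - x, q - x]) g \<and>
    sgn g = \<eta> F * \<eta> V * (incidence \<omega> (cone_over V) (cone_over N) * incidence \<omega> (cone_over N) (cone_over F))"
proof -
  have V': "V \<in> faces \<Delta> 2 \<union> faces \<Delta> 4" and F': "F \<in> faces \<Delta> 2 \<union> faces \<Delta> 4" using V F by simp_all
  have xF: "x \<in> F" "x \<in> N" "q \<in> F" using x q sub by blast+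
  have Ph: "cone_over V \<in> \<Phi>" "cone_over F \<in> \<Phi>" "cone_over N \<in> \<Phi>"
    using faces_cone[OF V] faces_cone[OF F] faces_cone[OF N] by simp_all
  have dims: "vec.dim (cone_over F) = vec.dim (cone_over N) + 1" "vec.dim (cone_over N) = vec.dim (cone_over V) + 1"
    using faces_cone[OF V] faces_cone[OF F] faces_cone[OF N] by simp_all
  have cf: "cone_face (cone_over N) (cone_over F)" "cone_face (cone_over V) (cone_over N)"
    using faces_subset_cone[OF N F] faces_subset_cone[OF V N] sub by simp_all
  have lp: "lift p \<in> cone_over F" "lift p \<notin> cone_over N" and lq: "lift q \<in> cone_over N" "lift q \<notin> cone_over V"
    using p q by (simp_all add: lift_in_cone_over)
  define E P Q' where "E = map emb (\<theta> V)" and "P = emb (p - x)" and "Q' = emb (q - x)"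
  have lV: "length (\<theta> V) = 2" "length (\<theta> F) = 4"
    using ordered_basis_length[OF face_orientation[OF V']] ordered_basis_length[OF face_orientation[OF F']] V F
    unfolding faces_def by simp_all
  obtain d where d: "rel_det (\<omega> (cone_over F)) (- lift p # \<omega> (cone_over N)) d" "d \<noteq> 0"
    "incidence \<omega> (cone_over N) (cone_over F) = sgn d"
    by (rule incidence_rel_det[OF cf(1) dims(1) orient[OF Ph(2)] orient[OF Ph(3)] lp])
  obtain e where e: "rel_det (\<omega> (cone_over N)) (- lift q # \<omega> (cone_over V)) e" "e \<noteq> 0"
    "incidence \<omega> (cone_over V) (cone_over N) = sgn e"
    by (rule incidence_rel_det[OF cf(2) dims(2) orient[OF Ph(3)] orient[OF Ph(1)] lq])
  obtain v where v: "v \<noteq> 0" "rel_det (\<omega> (cone_over V)) (lift x # E) v" "sgn v = \<eta> V"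
    using \<eta>_spec(2)[OF V' x, folded E_def] by (elim exE conjE) (rule that)
  obtain f where f: "f \<noteq> 0" "rel_det (\<omega> (cone_over F)) (lift x # map emb (\<theta> F)) f" "sgn f = \<eta> F"
    using \<eta>_spec(2)[OF F' xF(1)] by (elim exE conjE) (rule that)
  have r2: "rel_det (\<omega> (cone_over F)) (- lift p # - lift q # lift x # E) (d * (e * v))"
    by (rule rel_det_trans[OF d(1) rel_det_Cons[OF rel_det_trans[OF e(1) rel_det_Cons[OF v(2)]]]])
  \<comment> \<open>Adding \<open>- lift x\<close> after the sign change turns the outward vectors
    \<open>- lift q\<close> and \<open>- lift p\<close> into \<open>q - x\<close> and
    \<open>p - x\<close>; each replacement has factor -1, so together they cost nothing.\<close>
  have mx: "- lift x \<in> vec.span (set (lift x # E))" by (rule vec.span_neg, rule vec.span_base) simp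
  have mx': "- lift x \<in> vec.span (set (Q' # lift x # E))" by (rule vec.span_neg, rule vec.span_base) simp
  have tq: "rel_det (- lift q # lift x # E) (Q' # lift x # E) (- 1)"
    using rel_det_transvection[OF mx, of "- lift q" "- 1"] by (simp add: Q'_def emb_diff)
  have tp: "rel_det (- lift p # Q' # lift x # E) (P # Q' # lift x # E) (- 1)"
    using rel_det_transvection[OF mx', of "- lift p" "- 1"] by (simp add: P_def emb_diff)
  have t: "rel_det (- lift p # - lift q # lift x # E) (P # Q' # lift x # E) 1"
    using rel_det_trans[OF rel_det_Cons[OF tq] tp] by simp
  \<comment> \<open>Each of the two vectors moves past four others, so neither rotation changes the
    sign.\<close>
  have rot1: "rel_det (P # Q' # lift x # E) (Q' # lift x # E @ [P]) 1"
    using rel_det_rotate[of P "Q' # lift x # E"] lV by (simp add: E_def)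
  have rot2: "rel_det (Q' # lift x # E @ [P]) (lift x # E @ [P, Q']) 1"
    using rel_det_rotate[of Q' "lift x # E @ [P]"] lV by (simp add: E_def)
  have r5: "rel_det (\<omega> (cone_over F)) (lift x # E @ [P, Q']) (d * (e * v))"
    using rel_det_trans[OF rel_det_trans[OF rel_det_trans[OF r2 t] rot1] rot2] by simp
  have spF: "vec.span (set (\<theta> F)) = direction F" and spV: "vec.span (set (\<theta> V)) = direction V"
    using face_orientation[OF F'] face_orientation[OF V'] unfolding ordered_basis_def by simp_all
  have "set (\<theta> V) \<subseteq> direction V" unfolding spV[symmetric] by (rule vec.span_superset)
  also have "direction V \<subseteq> direction F" using sub by (intro direction_mono) blast
  finally have sF: "set (\<theta> V @ [p - x, q - x]) \<subseteq> vec.span (set (\<theta> F))"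
    unfolding spF using diff_in_direction[OF p(1) xF(1)] diff_in_direction[OF xF(3,1)] by simp
  have "length (\<theta> V @ [p - x, q - x]) = length (\<theta> F)" using lV by simp
  from rel_det_exists[OF this sF] obtain g where g: "rel_det (\<theta> F) (\<theta> V @ [p - x, q - x]) g"
    by (elim exE) (rule that)
  have "rel_det (map emb (\<theta> F)) (E @ [P, Q']) g"
    using rel_det_emb[OF g] by (simp add: E_def P_def Q'_def)
  from rel_det_trans[OF f(2) rel_det_Cons[OF this]]
  have r6: "rel_det (\<omega> (cone_over F)) (lift x # E @ [P, Q']) (f * g)" .
  have "f * g = d * (e * v)"
    using rel_det_unique[OF _ _ r6 r5] orient[OF Ph(2)] unfolding ordered_basis_def by simp
  then have "sgn f * sgn g = sgn d * (sgn e * sgn v)" by (simp add: sgn_mult[symmetric])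
  \<comment> \<open>A sign is its own inverse, which solves the equation for the sign of
    \<open>g\<close>.\<close>
  moreover have "sgn f * sgn f = 1" using f(1) by (simp add: sgn_if)
  then have "sgn g = sgn f * (sgn f * sgn g)" by (simp add: mult.assoc[symmetric])
  ultimately have "sgn g = sgn f * (sgn d * (sgn e * sgn v))" by simp
  then have "sgn g = \<eta> F * \<eta> V * (incidence \<omega> (cone_over V) (cone_over N) * incidence \<omega> (cone_over N) (cone_over F))"
    unfolding f(3) d(3) e(3) v(3) by (simp only: mult_ac)
  then show ?thesis using g by (intro exI conjI)
qed

text \<open>Two points of the same three-dimensional face give one ray modulo V, so the list is
  dependent. This excludes the pair with equal members in the definite description of
  \<open>intermediate_pair\<close>.\<close>

lemma theta_degenerate:
  assumes V: "V \<in> faces \<Delta> 2" and F: "F \<in> faces \<Delta> 4" and M: "M \<in> faces \<Delta> 3"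
    and sub: "V \<subset> M" "M \<subset> F"
    and x: "x \<in> V" and p: "p \<in> M" and q: "q \<in> M" "q \<notin> V"
    and g: "rel_det (\<theta> F) (\<theta> V @ [p - x, q - x]) g"
  shows "g = 0"
proof -
  have V': "V \<in> faces \<Delta> 2 \<union> faces \<Delta> 4" and F': "F \<in> faces \<Delta> 2 \<union> faces \<Delta> 4" using V F by simp_all
  have xM: "x \<in> M" "x \<in> F" "p \<in> F" "q \<in> F" using x sub p q by blast+
  have lV: "length (\<theta> V) = 2" "length (\<theta> F) = 4"
    using ordered_basis_length[OF face_orientation[OF V']] ordered_basis_length[OF face_orientation[OF F']] V F
    unfolding faces_def by simp_all
  have spF: "vec.span (set (\<theta> F)) = direction F" and spV: "vec.span (set (\<theta> V)) = direction V"
    and indF: "distinct (\<theta> F)" "vec.independent (set (\<theta> F))"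
    using face_orientation[OF F'] face_orientation[OF V'] unfolding ordered_basis_def by simp_all
  have fV: "face V \<Delta>" "face M \<Delta>" and dV: "vec.dim (direction V) = 2" "vec.dim (direction M) = 3"
    using V M unfolding faces_def by simp_all
  have "M \<subseteq> \<Delta>" using fV(2) unfolding face_def by blast
  then have "q \<in> \<Delta>" using q(1) by blast
  then have nd: "q - x \<notin> direction V" using face_diff_notin_direction[OF fV(1) x _ q(2)] by blast
  have dVM: "direction V \<subseteq> direction M" using sub by (intro direction_mono) blast
  have s: "insert (q - x) (direction V) \<subseteq> direction M"
    using dVM diff_in_direction[OF q(1) xM(1)] by simp
  have "q - x \<notin> vec.span (direction V)" using nd unfolding direction_def vec.span_span .
  then have "vec.dim (direction M) \<le> vec.dim (insert (q - x) (direction V))"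
    using dV by (simp add: vec.dim_insert)
  from vec.dim_eq_span[OF s this] have "vec.span (insert (q - x) (direction V)) = vec.span (direction M)" .
  moreover have "p - x \<in> vec.span (direction M)" by (rule vec.span_base, rule diff_in_direction[OF p xM(1)])
  ultimately have "p - x \<in> vec.span (insert (q - x) (direction V))" by simp
  then have "p - x \<in> vec.span (set ((q - x) # \<theta> V))"
    unfolding spV[symmetric] by (simp only: list.set vec.span_insert vec.span_span)
  \<comment> \<open>With factor 0 and the zero vector in first position, the transvection lemma says
    that a list whose first vector depends on the rest has determinant 0.\<close>
  from rel_det_transvection[OF this, of 0 0]
  have r0: "rel_det (0 # (q - x) # \<theta> V) ((p - x) # (q - x) # \<theta> V) 0" by simp
  have "set (\<theta> V) \<subseteq> direction V" unfolding spV[symmetric] by (rule vec.span_superset)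
  also have "direction V \<subseteq> direction F" using sub by (intro direction_mono) blast
  finally have sF: "set (0 # (q - x) # \<theta> V) \<subseteq> vec.span (set (\<theta> F))"
    unfolding spF using diff_in_direction[OF xM(4,2)] by (simp add: direction_def vec.span_zero)
  have "length (0 # (q - x) # \<theta> V) = length (\<theta> F)" using lV by simp
  from rel_det_exists[OF this sF] obtain h where h: "rel_det (\<theta> F) (0 # (q - x) # \<theta> V) h"
    by (elim exE) (rule that)
  have rot1: "rel_det ((p - x) # (q - x) # \<theta> V) ((q - x) # \<theta> V @ [p - x]) ((- 1) ^ 3)"
    using rel_det_rotate[of "p - x" "(q - x) # \<theta> V"] lV by (simp add: numeral_3_eq_3)
  have rot2: "rel_det ((q - x) # \<theta> V @ [p - x]) (\<theta> V @ [p - x, q - x]) ((- 1) ^ 3)"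
    using rel_det_rotate[of "q - x" "\<theta> V @ [p - x]"] lV by (simp add: numeral_3_eq_3)
  have "rel_det (\<theta> F) (\<theta> V @ [p - x, q - x]) 0"
    using rel_det_trans[OF rel_det_trans[OF rel_det_trans[OF h r0] rot1] rot2] by simp
  from rel_det_unique[OF indF g this] show ?thesis .
qed

text \<open>The sign is read off the second member \<open>N\<close> alone; \<open>M\<close> only
  supplies a point of \<open>F\<close> off \<open>N\<close>.\<close>

lemma positive_pair_iff:
  assumes V: "V \<in> faces \<Delta> 2" and F: "F \<in> faces \<Delta> 4" and N: "N \<in> faces \<Delta> 3"
    and sub: "V \<subset> N" "N \<subset> F" "V \<subset> M" "M \<subset> F" and int: "M \<inter> N \<subseteq> V"
  shows "positive_pair \<theta> V F M N \<longleftrightarrow>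
    \<eta> F * \<eta> V * (incidence \<omega> (cone_over V) (cone_over N) * incidence \<omega> (cone_over N) (cone_over F)) = 1"
    (is "_ \<longleftrightarrow> ?e = 1")
proof
  assume "positive_pair \<theta> V F M N"
  then obtain x p q where x: "x \<in> V" and p: "p \<in> M - V" and q: "q \<in> N - V"
    and so: "same_orientation (\<theta> F) (\<theta> V @ [p - x, q - x])"
    unfolding positive_pair_def by (elim bexE) (rule that)
  obtain g' where g': "g' > 0" "rel_det (\<theta> F) (\<theta> V @ [p - x, q - x]) g'"
    using so unfolding same_orientation_rel_det by (elim exE conjE) (rule that)
  have p': "p \<in> F" "p \<notin> N" and q': "q \<in> N" "q \<notin> V" using p q sub int by blast+
  obtain g where g: "rel_det (\<theta> F) (\<theta> V @ [p - x, q - x]) g" "sgn g = ?e"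
    using theta_sign[OF V F N sub(1,2) x p' q'] by (elim exE conjE) (rule that)
  have "g = g'" using rel_det_unique[OF _ _ g(1) g'(2)] face_orientation[of F] F
    unfolding ordered_basis_def by simp
  then show "?e = 1" using g(2) g'(1) by simp
next
  assume e: "?e = 1"
  have "V \<noteq> {}" using V unfolding faces_def by simp
  then obtain x where x: "x \<in> V" by (metis all_not_in_conv)
  obtain p where p: "p \<in> M" "p \<notin> V" using sub by blast
  obtain q where q: "q \<in> N" "q \<notin> V" using sub by blast
  have p': "p \<in> F" "p \<notin> N" using p sub int by blast+
  obtain g where g: "rel_det (\<theta> F) (\<theta> V @ [p - x, q - x]) g" "sgn g = ?e"
    using theta_sign[OF V F N sub(1,2) x p' q] by (elim exE conjE) (rule that)
  then have "g > 0" using e by (simp add: sgn_1_pos)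
  then have "same_orientation (\<theta> F) (\<theta> V @ [p - x, q - x])"
    unfolding same_orientation_rel_det using g(1) by (intro exI conjI)
  then show "positive_pair \<theta> V F M N" unfolding positive_pair_def
    using x p q by (intro bexI[of _ x] bexI[of _ p] bexI[of _ q]) simp_all
qed

lemma not_positive_pair_refl:
  assumes "V \<in> faces \<Delta> 2" "F \<in> faces \<Delta> 4" "M \<in> faces \<Delta> 3" "V \<subset> M" "M \<subset> F"
  shows "\<not> positive_pair \<theta> V F M M"
proof
  assume "positive_pair \<theta> V F M M"
  then obtain x p q where x: "x \<in> V" and p: "p \<in> M - V" and q: "q \<in> M - V"
    and so: "same_orientation (\<theta> F) (\<theta> V @ [p - x, q - x])"
    unfolding positive_pair_def by (elim bexE) (rule that)
  obtain g where g: "g > 0" "rel_det (\<theta> F) (\<theta> V @ [p - x, q - x]) g"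
    using so unfolding same_orientation_rel_det by (elim exE conjE) (rule that)
  have pq: "p \<in> M" "q \<in> M" "q \<notin> V" using p q by simp_all
  have "g = 0" by (rule theta_degenerate[OF assms x pq g(2)])
  then show False using g(1) by simp
qed

text \<open>The diamond provides two middle faces with opposite signs, so exactly one of their two
  orders is positive and the definite description is meaningful.\<close>

lemma intermediate_pair_spec:
  assumes V: "V \<in> faces \<Delta> 2" and F: "F \<in> faces \<Delta> 4" and VF: "V \<subseteq> F"
  defines "\<epsilon> \<equiv> \<lambda>M. incidence \<omega> (cone_over V) (cone_over M) * incidence \<omega> (cone_over M) (cone_over F)"
  defines "U \<equiv> M_upper \<Delta> \<theta> V F" and "L \<equiv> M_lower \<Delta> \<theta> V F"
  shows "U \<in> faces \<Delta> 3 \<and> L \<in> faces \<Delta> 3 \<and> U \<noteq> L \<and>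
    {\<mu> \<in> \<Phi>. cone_over V \<subset> \<mu> \<and> \<mu> \<subset> cone_over F} = {cone_over U, cone_over L} \<and>
    \<epsilon> L = \<eta> F * \<eta> V \<and> \<epsilon> U = - (\<eta> F * \<eta> V)"
proof -
  have VP: "cone_over V \<in> \<Phi>" "vec.dim (cone_over V) = 3" and FP: "cone_over F \<in> \<Phi>" "vec.dim (cone_over F) = 5"
    using faces_cone[OF V] faces_cone[OF F] by simp_all
  have sub: "cone_over V \<subseteq> cone_over F" using VF by (simp add: cone_over_mono_iff)
  have d2: "vec.dim (cone_over F) = vec.dim (cone_over V) + 2" using VP FP by simp
  obtain \<mu>1 \<mu>2 where m: "\<mu>1 \<noteq> \<mu>2" "{\<mu> \<in> \<Phi>. cone_over V \<subset> \<mu> \<and> \<mu> \<subset> cone_over F} = {\<mu>1, \<mu>2}"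
    "\<mu>1 \<inter> \<mu>2 = cone_over V"
    and d: "vec.dim \<mu>1 = vec.dim (cone_over V) + 1" "vec.dim \<mu>2 = vec.dim (cone_over V) + 1"
    and sg: "incidence \<omega> (cone_over V) \<mu>1 * incidence \<omega> \<mu>1 (cone_over F) =
      - (incidence \<omega> (cone_over V) \<mu>2 * incidence \<omega> \<mu>2 (cone_over F))"
    by (rule diamond_incidence[OF VP(1) FP(1) sub d2])
  have in12: "\<mu>1 \<in> {\<mu> \<in> \<Phi>. cone_over V \<subset> \<mu> \<and> \<mu> \<subset> cone_over F}"
    "\<mu>2 \<in> {\<mu> \<in> \<Phi>. cone_over V \<subset> \<mu> \<and> \<mu> \<subset> cone_over F}" unfolding m(2) by simp_all
  have dim4: "vec.dim \<mu>1 = 3 + 1" "vec.dim \<mu>2 = 3 + 1" using d VP(2) by simp_all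
  have P12: "\<mu>1 \<in> \<Phi>" "\<mu>2 \<in> \<Phi>" using in12 by simp_all
  obtain M1 where M1: "M1 \<in> faces \<Delta> 3" "\<mu>1 = cone_over M1"
    using cone_faces[OF P12(1) dim4(1)] by (elim bexE) (rule that)
  obtain M2 where M2: "M2 \<in> faces \<Delta> 3" "\<mu>2 = cone_over M2"
    using cone_faces[OF P12(2) dim4(2)] by (elim bexE) (rule that)
  have s1: "V \<subset> M1" "M1 \<subset> F" and s2: "V \<subset> M2" "M2 \<subset> F"
    using in12 unfolding M1(2) M2(2) by (simp_all add: cone_over_psubset_iff)
  have ne: "M1 \<noteq> M2" using m(1) M1(2) M2(2) by auto
  have int: "M1 \<inter> M2 \<subseteq> V"
  proof
    fix x assume "x \<in> M1 \<inter> M2"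
    then have "lift x \<in> \<mu>1 \<inter> \<mu>2" unfolding M1(2) M2(2) by (simp add: lift_in_cone_over)
    then show "x \<in> V" unfolding m(3) by (simp add: lift_in_cone_over)
  qed
  have either: "M = M1 \<or> M = M2" if "M \<in> faces \<Delta> 3" "V \<subset> M" "M \<subset> F" for M
  proof -
    have "cone_over M \<in> {\<mu> \<in> \<Phi>. cone_over V \<subset> \<mu> \<and> \<mu> \<subset> cone_over F}"
      using faces_cone[OF that(1)] that(2,3) by (simp add: cone_over_psubset_iff)
    then show ?thesis unfolding m(2) M1(2) M2(2) by (simp add: cone_over_eq_iff)
  qed
  have neg: "\<epsilon> M1 = - \<epsilon> M2" using sg unfolding \<epsilon>_def M1(2) M2(2) .
  have \<eta>1: "\<eta> F = 1 \<or> \<eta> F = - 1" "\<eta> V = 1 \<or> \<eta> V = - 1" using \<eta>_spec(1) V F by simp_all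
  have \<epsilon>1: "\<epsilon> M1 = 1 \<or> \<epsilon> M1 = - 1"
    using incidence_cases[of "cone_over V" "cone_over M1"] incidence_cases[of "cone_over M1" "cone_over F"]
    unfolding \<epsilon>_def by auto
  have pair: "intermediate_pair \<Delta> \<theta> V F = (M, N)"
    if MN: "M = M1 \<and> N = M2 \<or> M = M2 \<and> N = M1" and pos: "\<eta> F * \<eta> V * \<epsilon> N = 1" for M N
  proof -
    have M: "M \<in> faces \<Delta> 3" "V \<subset> M" "M \<subset> F" and N: "N \<in> faces \<Delta> 3" "V \<subset> N" "N \<subset> F"
      and i: "M \<inter> N \<subseteq> V" "N \<inter> M \<subseteq> V" and ng: "\<epsilon> M = - \<epsilon> N"
      using MN M1(1) M2(1) s1 s2 int neg by (auto simp: Int_commute)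
    have pp: "positive_pair \<theta> V F M N"
      using positive_pair_iff[OF V F N M(2,3) i(1)] pos unfolding \<epsilon>_def by simp
    have np: "\<not> positive_pair \<theta> V F N M"
      using positive_pair_iff[OF V F M N(2,3) i(2)] pos ng unfolding \<epsilon>_def by simp
    have "(M', N') = (M, N)"
      if h: "M' \<in> faces \<Delta> 3 \<and> V \<subset> M' \<and> M' \<subset> F \<and> N' \<in> faces \<Delta> 3 \<and> V \<subset> N' \<and> N' \<subset> F \<and>
        positive_pair \<theta> V F M' N'" for M' N'
    proof -
      have "M' = M \<or> M' = N" "N' = M \<or> N' = N" using either[of M'] either[of N'] h MN by auto
      moreover have "M' \<noteq> N'" using h not_positive_pair_refl[OF V F, of M'] by auto
      ultimately show ?thesis using h np by auto
    qed
    then have uniq: "y = (M, N)" if "case y of (M', N') \<Rightarrow> M' \<in> faces \<Delta> 3 \<and> V \<subset> M' \<and> M' \<subset> F \<and>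
        N' \<in> faces \<Delta> 3 \<and> V \<subset> N' \<and> N' \<subset> F \<and> positive_pair \<theta> V F M' N'" for y
      using that by (cases y) simp
    show ?thesis unfolding intermediate_pair_def
      by (rule the_equality[OF _ uniq]) (use M N pp in simp_all)
  qed
  have "\<exists>M N. (M = M1 \<and> N = M2 \<or> M = M2 \<and> N = M1) \<and> \<eta> F * \<eta> V * \<epsilon> N = 1"
  proof (cases "\<eta> F * \<eta> V * \<epsilon> M1 = 1")
    case True then show ?thesis by (intro exI[of _ M2] exI[of _ M1]) simp
  next
    case False
    then have "\<eta> F * \<eta> V * \<epsilon> M2 = 1" using \<eta>1 \<epsilon>1 neg by auto
    then show ?thesis by (intro exI[of _ M1] exI[of _ M2]) simp
  qed
  then obtain M N where MN: "M = M1 \<and> N = M2 \<or> M = M2 \<and> N = M1" and pos: "\<eta> F * \<eta> V * \<epsilon> N = 1"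
    by (elim exE conjE) (rule that)
  have UL: "U = M" "L = N" using pair[OF MN pos] unfolding U_def L_def M_upper_def M_lower_def by simp_all
  have "\<epsilon> N = \<eta> F * \<eta> V" using pos \<eta>1 by auto
  moreover have "\<epsilon> M = - \<epsilon> N" using MN neg by auto
  moreover have "{\<mu>1, \<mu>2} = {cone_over M, cone_over N}" using MN M1(2) M2(2) by auto
  ultimately show ?thesis unfolding UL m(2) using MN M1(1) M2(1) ne by auto
qed

end

section \<open>The solution space\<close>

text \<open>A linear relation that is total on \<open>Z\<close>, onto \<open>S\<close>, and relates
  exactly the elements of \<open>B\<close> to zero induces an isomorphism of \<open>Z/B\<close> with
  \<open>S\<close>. This fits \<open>corresponds\<close>, which depends on a choice of lift and is
  not given as a function.\<close>

lemma viso_quotient: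
  fixes Z B :: "('x \<Rightarrow> 'k::field ^ 'w) set" and S :: "('y \<Rightarrow> 'k) set"
  assumes Z_lin: "\<And>c f g. f \<in> Z \<Longrightarrow> g \<in> Z \<Longrightarrow> (\<lambda>x. f x + c *s g x) \<in> Z"
    and S_lin: "\<And>c s t. s \<in> S \<Longrightarrow> t \<in> S \<Longrightarrow> (\<lambda>y. s y + c * t y) \<in> S"
    and R_lin: "\<And>c f g s t. R f s \<Longrightarrow> R g t \<Longrightarrow> R (\<lambda>x. f x + c *s g x) (\<lambda>y. s y + c * t y)"
    and total: "\<And>f. f \<in> Z \<Longrightarrow> \<exists>s\<in>S. R f s"
    and surj: "\<And>s. s \<in> S \<Longrightarrow> \<exists>f\<in>Z. R f s"
    and BZ: "B \<subseteq> Z" and zero: "(\<lambda>_. 0) \<in> B"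
    and ker: "\<And>f s. f \<in> Z \<Longrightarrow> s \<in> S \<Longrightarrow> R f s \<Longrightarrow> f \<in> B \<longleftrightarrow> s = (\<lambda>_. 0)"
  shows "viso (vquotient \<lparr> vcarrier = Z, vplus = (\<lambda>f g x. f x + g x), vscale = (\<lambda>c f x. c *s f x) \<rparr> B)
    \<lparr> vcarrier = S, vplus = (\<lambda>s t y. s y + t y), vscale = (\<lambda>c s y. c * s y) \<rparr>"
    (is "viso (vquotient ?VZ B) ?VS")
proof -
  \<comment> \<open>The difference of two partners of \<open>f\<close> is a partner of 0, which lies
    in \<open>B\<close>, so the difference vanishes.\<close>
  have uniq: "s = t" if "f \<in> Z" "s \<in> S" "t \<in> S" "R f s" "R f t" for f s t
  proof -
    have "R (\<lambda>x. f x + (- 1) *s f x) (\<lambda>y. s y + (- 1) * t y)" by (rule R_lin[OF that(4,5)])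
    then have r: "R (\<lambda>_. 0) (\<lambda>y. s y - t y)" by simp
    have "(\<lambda>y. s y + (- 1) * t y) \<in> S" by (rule S_lin[OF that(2,3)])
    then have "(\<lambda>y. s y - t y) \<in> S" by simp
    from ker[OF subsetD[OF BZ zero] this r] zero have "(\<lambda>y. s y - t y) = (\<lambda>_. 0)" by simp
    then have "s y - t y = 0" for y by (rule fun_cong)
    then show ?thesis by (intro ext) simp
  qed
  define F where "F = (\<lambda>f. THE s. s \<in> S \<and> R f s)"
  have Feq: "F f = s" if "f \<in> Z" "s \<in> S" "R f s" for f s
    unfolding F_def using that uniq[OF that(1)] by (intro the_equality) simp_all
  have FS: "F f \<in> S" "R f (F f)" if "f \<in> Z" for f
    using total[OF that] Feq[OF that] by auto
  have Flin: "F (\<lambda>x. f x + c *s g x) = (\<lambda>y. F f y + c * F g y)" if "f \<in> Z" "g \<in> Z" for f g c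
    by (rule Feq[OF Z_lin[OF that] S_lin[OF FS(1)[OF that(1)] FS(1)[OF that(2)]]
          R_lin[OF FS(2)[OF that(1)] FS(2)[OF that(2)]]])
  have FB: "f \<in> B \<longleftrightarrow> F f = (\<lambda>_. 0)" if "f \<in> Z" for f by (rule ker[OF that FS[OF that]])
  have Zp: "(\<lambda>x. f x + g x) \<in> Z" "F (\<lambda>x. f x + g x) = (\<lambda>y. F f y + F g y)" if "f \<in> Z" "g \<in> Z" for f g
    using Z_lin[OF that, of 1] Flin[OF that, of 1] by simp_all
  have zZ: "(\<lambda>_. 0) \<in> Z" by (rule subsetD[OF BZ zero])
  have Fz: "F (\<lambda>_. 0) = (\<lambda>_. 0)" using FB[OF zZ] zero by simp
  have Zs: "(\<lambda>x. c *s f x) \<in> Z" "F (\<lambda>x. c *s f x) = (\<lambda>y. c * F f y)" if "f \<in> Z" for f c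
    using Z_lin[OF zZ that, of c] Flin[OF zZ that, of c] Fz by simp_all
  \<comment> \<open>The coset of \<open>f\<close>, in the form in which \<open>vquotient\<close>
    builds its carrier.\<close>
  define cl where "cl = (\<lambda>f. (\<lambda>b x. f x + b x) ` B)"
  have clF: "g \<in> Z" "F g = F f" if "f \<in> Z" "g \<in> cl f" for f g
  proof -
    note fZ = that(1) and gcl = that(2)
    obtain b where b: "b \<in> B" "g = (\<lambda>x. f x + b x)" using gcl unfolding cl_def by (elim imageE) (rule that)
    have bZ: "b \<in> Z" by (rule subsetD[OF BZ b(1)])
    show "g \<in> Z" "F g = F f" using Zp[OF fZ bZ] FB[OF bZ] b by simp_all
  qed
  have clself: "f \<in> cl f" for f unfolding cl_def by (rule image_eqI[OF _ zero]) simp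
  \<comment> \<open>Any representative may be chosen, because \<open>F\<close> is constant on
    cosets.\<close>
  define \<phi> where "\<phi> = (\<lambda>X. F (SOME f. f \<in> X))"
  have \<phi>: "\<phi> X = s" if "f \<in> X" "\<And>g. g \<in> X \<Longrightarrow> F g = s" for X f s
    unfolding \<phi>_def by (rule that(2), rule someI[where P = "\<lambda>f. f \<in> X"], rule that(1))
  have \<phi>cl: "\<phi> (cl f) = F f" if "f \<in> Z" for f by (rule \<phi>[OF clself clF(2)[OF that]])
  have clsub: "cl f \<subseteq> cl g" if f: "f \<in> Z" and g: "g \<in> Z" and e: "F f = F g" for f g
  proof
    fix h assume h: "h \<in> cl f"
    have hZ: "h \<in> Z" and hF: "F h = F g" using clF[OF f h] e by simp_all
    have "F (\<lambda>x. h x + (- 1) *s g x) = (\<lambda>_. 0)" unfolding Flin[OF hZ g] hF by simp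
    then have "(\<lambda>x. h x + (- 1) *s g x) \<in> B" by (simp only: FB[OF Z_lin[OF hZ g]])
    then have "(\<lambda>x. g x + (h x + (- 1) *s g x)) \<in> cl g" unfolding cl_def by (rule imageI)
    then show "h \<in> cl g" by simp
  qed
  have carrier: "vcarrier (vquotient ?VZ B) = cl ` Z"
    unfolding vquotient_def cl_def by simp
  show ?thesis unfolding viso_def
  proof (intro exI[of _ \<phi>] conjI ballI allI)
    show "bij_betw \<phi> (vcarrier (vquotient ?VZ B))
      (vcarrier ?VS)"
      unfolding carrier bij_betw_def
    proof (rule conjI)
      show "inj_on \<phi> (cl ` Z)"
      proof (rule inj_onI)
        fix X Y assume "X \<in> cl ` Z" "Y \<in> cl ` Z" and e: "\<phi> X = \<phi> Y"
        then obtain f g where f: "f \<in> Z" "X = cl f" and g: "g \<in> Z" "Y = cl g"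
          by (elim imageE) (rule that)
        have "F f = F g" using e \<phi>cl f g by simp
        then show "X = Y" unfolding f(2) g(2) using clsub[OF f(1) g(1)] clsub[OF g(1) f(1)] by simp
      qed
      show "\<phi> ` cl ` Z = vcarrier ?VS"
      proof (intro subset_antisym subsetI)
        fix s assume "s \<in> \<phi> ` cl ` Z"
        then obtain f where "f \<in> Z" "s = \<phi> (cl f)" by (elim imageE) simp
        then show "s \<in> vcarrier ?VS"
          using \<phi>cl FS(1) by simp
      next
        fix s assume "s \<in> vcarrier ?VS"
        then have s: "s \<in> S" by simp
        obtain f where f: "f \<in> Z" "R f s" using surj[OF s] by (elim bexE) (rule that)
        have "s = \<phi> (cl f)" using \<phi>cl[OF f(1)] Feq[OF f(1) s f(2)] by simp
        then show "s \<in> \<phi> ` cl ` Z" using f(1) by (intro image_eqI[OF _ imageI])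
      qed
    qed
  next
    fix X Y
    assume "X \<in> vcarrier (vquotient ?VZ B)"
      "Y \<in> vcarrier (vquotient ?VZ B)"
    then obtain f g where f: "f \<in> Z" "X = cl f" and g: "g \<in> Z" "Y = cl g"
      unfolding carrier by (elim imageE) (rule that)
    have "\<phi> {\<lambda>x. a x + b x |a b. a \<in> X \<and> b \<in> Y} = (\<lambda>y. F f y + F g y)"
    proof (rule \<phi>)
      show "(\<lambda>x. f x + g x) \<in> {\<lambda>x. a x + b x |a b. a \<in> X \<and> b \<in> Y}"
        using clself f(2) g(2) by (intro CollectI exI[of _ f] exI[of _ g]) simp
      fix h assume "h \<in> {\<lambda>x. a x + b x |a b. a \<in> X \<and> b \<in> Y}"
      then obtain a b where h: "h = (\<lambda>x. a x + b x)" and a: "a \<in> cl f" and b: "b \<in> cl g"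
        unfolding f(2) g(2) by (elim CollectE exE conjE) (rule that)
      show "F h = (\<lambda>y. F f y + F g y)" unfolding h
        using Zp(2)[OF clF(1)[OF f(1) a] clF(1)[OF g(1) b]] clF(2)[OF f(1) a] clF(2)[OF g(1) b] by simp
    qed
    then show "\<phi> (vplus (vquotient ?VZ B) X Y) =
      vplus ?VS (\<phi> X) (\<phi> Y)"
      using \<phi>cl f g by (simp add: vquotient_def)
  next
    fix c X
    assume "X \<in> vcarrier (vquotient ?VZ B)"
    then obtain f where f: "f \<in> Z" "X = cl f"
      unfolding carrier by (elim imageE) (rule that)
    have "\<phi> {\<lambda>x. c *s a x + b x |a b. a \<in> X \<and> b \<in> B} = (\<lambda>y. c * F f y)"
    proof (rule \<phi>)
      show "(\<lambda>x. c *s f x) \<in> {\<lambda>x. c *s a x + b x |a b. a \<in> X \<and> b \<in> B}"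
        using clself f(2) zero by (intro CollectI exI[of _ f] exI[of _ "\<lambda>_. 0"]) simp
      fix h assume "h \<in> {\<lambda>x. c *s a x + b x |a b. a \<in> X \<and> b \<in> B}"
      then obtain a b where h: "h = (\<lambda>x. c *s a x + b x)" and a: "a \<in> cl f" and b: "b \<in> B"
        unfolding f(2) by (elim CollectE exE conjE) (rule that)
      have bZ: "b \<in> Z" by (rule subsetD[OF BZ b])
      note aZ = clF(1)[OF f(1) a]
      show "F h = (\<lambda>y. c * F f y)" unfolding h
        using Zp(2)[OF Zs(1)[OF aZ] bZ] Zs(2)[OF aZ] clF(2)[OF f(1) a] FB[OF bZ] b by simp
    qed
    then show "\<phi> (vscale (vquotient ?VZ B) c X) =
      vscale ?VS c (\<phi> X)"
      using \<phi>cl f by (simp add: vquotient_def)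
  qed
qed

section \<open>Cohomology of the face fans in terms of \<open>D\<close>\<close>

context rayed_fan begin

lemma face_fan_of_face: "N \<in> \<Phi> \<Longrightarrow> face_fan N = {\<tau> \<in> \<Phi>. \<tau> \<subseteq> N}"
proof (intro subset_antisym subsetI)
  fix \<tau> assume N: "N \<in> \<Phi>"
  show "\<tau> \<in> face_fan N \<Longrightarrow> \<tau> \<in> {\<tau> \<in> \<Phi>. \<tau> \<subseteq> N}"
    using fan_trans[OF N, of \<tau>] cone_face_subset[of \<tau> N] unfolding face_fan_def[of N] by simp
  show "\<tau> \<in> {\<tau> \<in> \<Phi>. \<tau> \<subseteq> N} \<Longrightarrow> \<tau> \<in> face_fan N"
    using fan_face[OF _ N, of \<tau>] unfolding face_fan_def[of N] by simp
qed

text \<open>Faces of a face of \<open>N\<close> are faces of \<open>N\<close>, so the differential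
  of the smaller fan is \<open>D\<close> cut off outside \<open>N\<close>. Thus one operator serves
  for all M and for the whole polytope.\<close>

lemma coboundary_D:
  assumes N: "N \<in> \<Phi>"
  shows "coboundary \<omega> (face_fan N) (\<lambda>\<tau> \<sigma> x. x) k f M =
    (if M \<in> \<Phi> \<and> M \<subseteq> N \<and> vec.dim M = Suc k then D f M else 0)"
proof (cases "M \<in> \<Phi> \<and> M \<subseteq> N \<and> vec.dim M = Suc k")
  case True
  then have M: "M \<in> \<Phi>" "M \<subseteq> N" "vec.dim M = Suc k" by simp_all
  have eq: "{\<tau>. \<tau> \<in> face_fan N \<and> cone_face \<tau> M \<and> vec.dim \<tau> = k} = {\<tau> \<in> \<Phi>. \<tau> \<subset> M \<and> vec.dim M = vec.dim \<tau> + 1}"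
  proof (intro subset_antisym subsetI)
    fix \<tau> assume "\<tau> \<in> {\<tau>. \<tau> \<in> face_fan N \<and> cone_face \<tau> M \<and> vec.dim \<tau> = k}"
    then have t: "\<tau> \<in> \<Phi>" "cone_face \<tau> M" "vec.dim \<tau> = k" unfolding face_fan_of_face[OF N] by simp_all
    have "\<tau> \<noteq> M" using t(3) M(3) by auto
    then show "\<tau> \<in> {\<tau> \<in> \<Phi>. \<tau> \<subset> M \<and> vec.dim M = vec.dim \<tau> + 1}"
      using t M(3) cone_face_subset[OF t(2)] by simp
  next
    fix \<tau> assume "\<tau> \<in> {\<tau> \<in> \<Phi>. \<tau> \<subset> M \<and> vec.dim M = vec.dim \<tau> + 1}"
    then have t: "\<tau> \<in> \<Phi>" "\<tau> \<subseteq> M" "vec.dim \<tau> = k" using M(3) by auto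
    then show "\<tau> \<in> {\<tau>. \<tau> \<in> face_fan N \<and> cone_face \<tau> M \<and> vec.dim \<tau> = k}"
      unfolding face_fan_of_face[OF N] using fan_face[OF t(1) M(1) t(2)] M(2) by simp
  qed
  have "D f M = (\<Sum>\<tau>\<in>{\<tau> \<in> \<Phi>. \<tau> \<subset> M \<and> vec.dim M = vec.dim \<tau> + 1}. incidence \<omega> \<tau> M *s f \<tau>)"
    unfolding D_def
    by (rule sum.mono_neutral_cong_right) (auto simp: inc_def finite_fan)
  moreover have "M \<in> face_fan N" unfolding face_fan_of_face[OF N] using M by simp
  ultimately show ?thesis using True unfolding coboundary_def eq by simp
next
  case False
  then have "\<not> (M \<in> face_fan N \<and> vec.dim M = Suc k)" unfolding face_fan_of_face[OF N] by simp
  then show ?thesis using False by (simp only: coboundary_def if_False)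
qed

lemma coboundary_zero: "coboundary \<omega> \<Sigma> (\<lambda>\<tau> \<sigma> x. x) k (\<lambda>_. 0) = (\<lambda>_. 0)"
  unfolding coboundary_def by (rule ext) simp

text \<open>If the quotient has only one element, every cocycle lies in the coset of 0 and is a
  coboundary.\<close>

lemma acyclic_at_of_vanishing:
  assumes N: "N \<in> \<Phi>" and z: "vzero_space (cohomology \<omega> (face_fan N) vec.span (\<lambda>\<tau> \<sigma> x. x) (Suc j))"
  shows "acyclic_at (Suc j) N"
  unfolding acyclic_at_def
proof (intro allI impI)
  fix e
  assume e: "\<forall>\<tau>\<in>\<Phi>. \<tau> \<subseteq> N \<longrightarrow> vec.dim \<tau> = Suc j \<longrightarrow> e \<tau> \<in> vec.span \<tau>"
    and d: "\<forall>M\<in>\<Phi>. M \<subseteq> N \<longrightarrow> vec.dim M = Suc j + 1 \<longrightarrow> D e M = 0"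
  let ?Z = "cocycles \<omega> (face_fan N) vec.span (\<lambda>\<tau> \<sigma> x. x) (Suc j)"
  let ?C = "cochains (face_fan N) vec.span j"
  let ?B = "coboundary \<omega> (face_fan N) (\<lambda>\<tau> \<sigma> x. x) j ` ?C"
  have "(\<lambda>_. 0) \<in> ?C" unfolding cochains_def by (simp add: vec.span_zero)
  then have "coboundary \<omega> (face_fan N) (\<lambda>\<tau> \<sigma> x. x) j (\<lambda>_. 0) \<in> ?B" by (rule imageI)
  then have zB: "(\<lambda>_. 0) \<in> ?B" unfolding coboundary_zero .
  \<comment> \<open>\<open>e\<close> is cut off to the faces of \<open>N\<close> of dimension
    \<open>Suc j\<close>, since formal cochains must vanish elsewhere; \<open>D\<close> does not
    notice the change.\<close>
  define f where "f = (\<lambda>\<tau>. if \<tau> \<in> face_fan N \<and> vec.dim \<tau> = Suc j then e \<tau> else 0)"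
  have f_e: "f \<tau> = e \<tau>" if "\<tau> \<in> \<Phi>" "\<tau> \<subseteq> N" "vec.dim \<tau> = Suc j" for \<tau>
    using that unfolding f_def face_fan_of_face[OF N] by simp
  have "f \<in> cochains (face_fan N) vec.span (Suc j)"
    unfolding cochains_def f_def face_fan_of_face[OF N] using e by simp
  moreover have "coboundary \<omega> (face_fan N) (\<lambda>\<tau> \<sigma> x. x) (Suc j) f = (\<lambda>_. 0)"
  proof
    fix M
    show "coboundary \<omega> (face_fan N) (\<lambda>\<tau> \<sigma> x. x) (Suc j) f M = 0"
      unfolding coboundary_D[OF N]
    proof (split if_split, intro conjI impI)
      assume M: "M \<in> \<Phi> \<and> M \<subseteq> N \<and> vec.dim M = Suc (Suc j)"
      have "D f M = D e M" by (rule D_cong) (use M f_e in auto)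
      then show "D f M = 0" using d M by simp
    qed simp
  qed
  ultimately have fZ: "f \<in> ?Z" unfolding cocycles_def by simp
  have zZ: "(\<lambda>_. 0) \<in> ?Z" unfolding cocycles_def cochains_def by (simp add: vec.span_zero coboundary_zero)
  obtain c where c: "(\<lambda>g. (\<lambda>b \<sigma>. g \<sigma> + b \<sigma>) ` ?B) ` ?Z = {c}"
    using z unfolding vzero_space_def cohomology_def vquotient_def coboundaries.simps vspace.simps
    by (elim exE) (rule that)
  have coset: "(\<lambda>b \<sigma>. g \<sigma> + b \<sigma>) ` ?B = c" if "g \<in> ?Z" for g
    using imageI[OF that, of "\<lambda>g. (\<lambda>b \<sigma>. g \<sigma> + b \<sigma>) ` ?B"] unfolding c by (rule singletonD)
  have "(\<lambda>b \<sigma>. (\<lambda>_. 0) \<sigma> + b \<sigma>) ` ?B = (\<lambda>b \<sigma>. f \<sigma> + b \<sigma>) ` ?B"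
    using coset[OF zZ] coset[OF fZ] by (rule trans[OF _ sym])
  moreover have "f \<in> (\<lambda>b \<sigma>. f \<sigma> + b \<sigma>) ` ?B" by (rule image_eqI[OF _ zB]) simp
  ultimately have "f \<in> (\<lambda>b \<sigma>. (\<lambda>_. 0) \<sigma> + b \<sigma>) ` ?B" by simp
  then have "f \<in> ?B" by simp
  then obtain h where h: "f = coboundary \<omega> (face_fan N) (\<lambda>\<tau> \<sigma> x. x) j h" "h \<in> ?C"
    by (elim imageE) (rule that)
  show "\<exists>h. (\<forall>\<tau>\<in>\<Phi>. \<tau> \<subseteq> N \<longrightarrow> vec.dim \<tau> + 1 = Suc j \<longrightarrow> h \<tau> \<in> vec.span \<tau>) \<and>
    (\<forall>E\<in>\<Phi>. E \<subseteq> N \<longrightarrow> vec.dim E = Suc j \<longrightarrow> e E = D h E)"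
  proof (intro exI[of _ h] conjI ballI impI)
    fix \<tau> assume t: "\<tau> \<in> \<Phi>" "\<tau> \<subseteq> N" "vec.dim \<tau> + 1 = Suc j"
    have "if \<tau> \<in> face_fan N \<and> vec.dim \<tau> = j then h \<tau> \<in> vec.span \<tau> else h \<tau> = 0"
      using h(2) unfolding cochains_def by simp
    then show "h \<tau> \<in> vec.span \<tau>" using t unfolding face_fan_of_face[OF N] by simp
  next
    fix E assume E: "E \<in> \<Phi>" "E \<subseteq> N" "vec.dim E = Suc j"
    have "e E = f E" using f_e[OF E] by simp
    also have "\<dots> = D h E" unfolding h(1) coboundary_D[OF N] using E by simp
    finally show "e E = D h E" .
  qed
qed

end

context vanishing_fan begin

text \<open>That \<open>D\<close> squares to zero is inherited from \<open>\<delta>\<close> on the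
  stars, after lifting \<open>e\<close> to functions on the vertices.\<close>

lemma bounds_cocycle:
  assumes b: "bounds e f" shows "cocycle f"
proof -
  have es: "e E \<in> vec.span E" if "E \<in> \<Phi>" "vec.dim E = 2" for E
    using b that unfolding bounds_def by simp
  have fe: "f V = D e V" if "V \<in> \<Phi>" "vec.dim V = 3" for V
    using b that unfolding bounds_def by simp
  have "\<exists>q. \<forall>E\<in>\<Phi>. vec.dim E = 2 \<longrightarrow> syn q E = e E"
    by (rule span_syn[of "\<lambda>E. vec.dim E = 2" e]) (rule es)
  then obtain q where q: "\<forall>E\<in>\<Phi>. vec.dim E = 2 \<longrightarrow> syn q E = e E" by (elim exE) (rule that)
  have fs: "f V = syn (\<lambda>a. \<delta> (star a) (q a)) V" if V: "V \<in> \<Phi>" "vec.dim V = 3" for V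
  proof -
    have "D e V = D (syn q) V" by (rule D_cong) (use q V in simp)
    then show ?thesis using fe[OF V] D_syn_as_syn[of q V] by simp
  qed
  have "D f N = 0" if N: "N \<in> \<Phi>" "vec.dim N = 4" for N
  proof -
    have "D f N = D (syn (\<lambda>a. \<delta> (star a) (q a))) N" by (rule D_cong) (use fs N in simp)
    also have "\<dots> = (\<Sum>a\<in>A \<inter> N. \<delta> (star a) (\<delta> (star a) (q a)) N *s a)" by (rule D_syn)
    also have "\<dots> = 0" by (rule sum.neutral) (simp add: \<delta>_star_\<delta>_star[OF N(1)])
    finally show ?thesis .
  qed
  then show ?thesis unfolding cocycle_def using fs syn_in_span by simp
qed

text \<open>The 2 is the degree of D, which is degree 3 for cones; the form \<open>Suc 2\<close>
  lets the recursive equation of \<open>coboundaries\<close> apply.\<close>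

abbreviation "Z2 \<equiv> cocycles \<omega> \<Phi> vec.span (\<lambda>\<tau> \<sigma> x. x) (Suc 2)"
abbreviation "B2 \<equiv> coboundaries \<omega> \<Phi> vec.span (\<lambda>\<tau> \<sigma> x. x) (Suc 2)"

lemma cocycles_iff:
  "f \<in> Z2 \<longleftrightarrow>
    cocycle f \<and> (\<forall>V. \<not> (V \<in> \<Phi> \<and> vec.dim V = 3) \<longrightarrow> f V = 0)"
proof -
  have "coboundary \<omega> \<Phi> (\<lambda>\<tau> \<sigma> x. x) (Suc 2) f = (\<lambda>_. 0) \<longleftrightarrow> (\<forall>N\<in>\<Phi>. vec.dim N = 4 \<longrightarrow> D f N = 0)"
    unfolding fun_eq_iff coboundary_D[OF top_in_fan] using fan_subset by auto
  moreover have "f \<in> cochains \<Phi> vec.span (Suc 2) \<longleftrightarrow> (\<forall>V\<in>\<Phi>. vec.dim V = 3 \<longrightarrow> f V \<in> vec.span V) \<and>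
    (\<forall>V. \<not> (V \<in> \<Phi> \<and> vec.dim V = 3) \<longrightarrow> f V = 0)"
    unfolding cochains_def by (auto split: if_splits)
  ultimately show ?thesis unfolding cocycles_def cocycle_def by auto
qed

lemma coboundaries_iff:
  "f \<in> B2 \<longleftrightarrow>
    (\<exists>e. bounds e f) \<and> (\<forall>V. \<not> (V \<in> \<Phi> \<and> vec.dim V = 3) \<longrightarrow> f V = 0)"
proof
  assume "f \<in> B2"
  then obtain e where e: "f = coboundary \<omega> \<Phi> (\<lambda>\<tau> \<sigma> x. x) 2 e" "e \<in> cochains \<Phi> vec.span 2"
    unfolding coboundaries.simps by (elim imageE) (rule that)
  have "bounds e f" unfolding bounds_def
  proof (intro conjI ballI impI)
    fix E assume "E \<in> \<Phi>" "vec.dim E = 2"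
    then show "e E \<in> vec.span E" using e(2) unfolding cochains_def by simp
  next
    fix V assume "V \<in> \<Phi>" "vec.dim V = 3"
    then show "f V = D e V" unfolding e(1) coboundary_D[OF top_in_fan] using fan_subset[of V] by simp
  qed
  moreover have "\<forall>V. \<not> (V \<in> \<Phi> \<and> vec.dim V = 3) \<longrightarrow> f V = 0"
    unfolding e(1) coboundary_D[OF top_in_fan] by simp
  ultimately show "(\<exists>e. bounds e f) \<and> (\<forall>V. \<not> (V \<in> \<Phi> \<and> vec.dim V = 3) \<longrightarrow> f V = 0)"
    by (intro conjI exI)
next
  assume "(\<exists>e. bounds e f) \<and> (\<forall>V. \<not> (V \<in> \<Phi> \<and> vec.dim V = 3) \<longrightarrow> f V = 0)"
  then obtain e where e: "bounds e f" and z: "\<forall>V. \<not> (V \<in> \<Phi> \<and> vec.dim V = 3) \<longrightarrow> f V = 0"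
    by (elim conjE exE) (rule that)
  define e' where "e' = (\<lambda>E. if E \<in> \<Phi> \<and> vec.dim E = 2 then e E else 0)"
  have "e' \<in> cochains \<Phi> vec.span 2"
    using e unfolding cochains_def e'_def bounds_def by simp
  moreover have "f = coboundary \<omega> \<Phi> (\<lambda>\<tau> \<sigma> x. x) 2 e'"
  proof
    fix V
    show "f V = coboundary \<omega> \<Phi> (\<lambda>\<tau> \<sigma> x. x) 2 e' V"
    proof (cases "V \<in> \<Phi> \<and> vec.dim V = 3")
      case True
      have "f V = D e V" using e True unfolding bounds_def by simp
      also have "\<dots> = D e' V" by (rule D_cong) (use True in \<open>simp add: e'_def\<close>)
      finally show ?thesis unfolding coboundary_D[OF top_in_fan] using True fan_subset[of V] by simp
    next
      case False
      then have "\<not> (V \<in> \<Phi> \<and> V \<subseteq> \<sigma> \<and> vec.dim V = Suc 2)" by auto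
      then show ?thesis unfolding coboundary_D[OF top_in_fan] using z False by auto
    qed
  qed
  ultimately show "f \<in> B2"
    unfolding coboundaries.simps by (intro image_eqI)
qed

end

section \<open>Translation between cones and faces of the polytope\<close>

definition uncone :: "('k::linordered_field ^ 'm option) set \<Rightarrow> ('k ^ 'm) set" where
  "uncone \<tau> = {x. lift x \<in> \<tau>}"

definition unlift :: "'k ^ 'm option \<Rightarrow> 'k ^ 'm" where
  "unlift y = (\<chi> j. y $ Some j)"

lemma uncone_cone_over [simp]: "uncone (cone_over Q) = Q"
  by (simp add: uncone_def lift_in_cone_over)

lemma unlift_lift [simp]: "unlift (lift a) = a"
  by (simp add: unlift_def vec_eq_iff)

locale vanishing_polytope = oriented_polytope \<Delta> \<omega> \<theta>
  for \<Delta> :: "('k::linordered_field ^ 'n) set" and \<omega> \<theta> +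
  fixes MV :: "('k ^ 'n) set \<Rightarrow> ('k ^ 'n) set"
  assumes dim_ge_3: "vec.dim (direction \<Delta>) \<ge> 3"
    and D1: "\<And>M. M \<in> faces \<Delta> 3 \<Longrightarrow> vzero_space (Dspace \<omega> 1 M)"
    and D2: "\<And>M. M \<in> faces \<Delta> 3 \<Longrightarrow> vzero_space (Dspace \<omega> 2 M)"
    and MV: "\<And>V. V \<in> faces \<Delta> 2 \<Longrightarrow> MV V \<in> faces \<Delta> 3 \<and> V \<subset> MV V"

text \<open>D in degree k is cohomology in degree k + 1, so \<open>D1\<close> and \<open>D2\<close>
  give acyclicity in degrees 2 and 3 on the four-dimensional cones.\<close>

sublocale vanishing_polytope \<subseteq>
  vanishing_fan "cone_over \<Delta>" \<omega> "lift ` vertices \<Delta>" "\<lambda>\<tau>. cone_over (MV (uncone \<tau>))"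
proof unfold_locales
  fix N assume N: "N \<in> face_fan (cone_over \<Delta>)" "vec.dim N = 4"
  have "vec.dim N = 3 + 1" using N(2) by simp
  from cone_faces[OF N(1) this] obtain M where M: "M \<in> faces \<Delta> 3" "N = cone_over M"
    by (elim bexE) (rule that)
  show "acyclic_at 2 N"
    using acyclic_at_of_vanishing[OF N(1), of 1] D1[OF M(1)] unfolding Dspace_def M(2)
    by (simp add: numeral_2_eq_2)
  show "acyclic_at 3 N"
    using acyclic_at_of_vanishing[OF N(1), of 2] D2[OF M(1)] unfolding Dspace_def M(2)
    by (simp add: numeral_3_eq_3 numeral_2_eq_2)
next
  fix V assume V: "V \<in> face_fan (cone_over \<Delta>)" "vec.dim V = 3"
  have "vec.dim V = 2 + 1" using V(2) by simp
  from cone_faces[OF V(1) this] obtain Q where Q: "Q \<in> faces \<Delta> 2" "V = cone_over Q"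
    by (elim bexE) (rule that)
  show "cone_over (MV (uncone V)) \<in> face_fan (cone_over \<Delta>) \<and> vec.dim (cone_over (MV (uncone V))) = 4 \<and>
    V \<subset> cone_over (MV (uncone V))"
    using MV[OF Q(1)] faces_cone[of "MV Q" \<Delta> 3] unfolding Q(2) by (simp add: cone_over_psubset_iff)
next
  have "\<Delta> \<noteq> {}"
  proof
    assume "\<Delta> = {}"
    then have "direction \<Delta> = {0}" unfolding direction_def by simp
    then show False using dim_ge_3 by (simp add: vec.dim_insert vec.span_zero)
  qed
  from dim_cone_over[OF this] show "4 \<le> vec.dim (cone_over \<Delta>)" using dim_ge_3 by simp
qed

context vanishing_polytope begin

lemma cone_over_faces_iff:
  "Q \<in> faces \<Delta> d \<longleftrightarrow> cone_over Q \<in> \<Phi> \<and> vec.dim (cone_over Q) = d + 1"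
proof
  assume "cone_over Q \<in> \<Phi> \<and> vec.dim (cone_over Q) = d + 1"
  then obtain R where "R \<in> faces \<Delta> d" "cone_over Q = cone_over R"
    using cone_faces[of "cone_over Q" \<Delta> d] by (elim conjE) (metis (no_types))
  then show "Q \<in> faces \<Delta> d" by (simp add: cone_over_eq_iff)
qed (rule faces_cone)

lemma lift_in_vertices: "lift a \<in> lift ` vertices \<Delta> \<longleftrightarrow> a \<in> vertices \<Delta>"
  using lift_inject[of a] by (auto simp: image_iff)

lemma flag_iff: "flag (lift a) (cone_over V) (cone_over N) \<longleftrightarrow> (a, V, N) \<in> flags023 \<Delta>"
  unfolding flag_def flags023_def
  using cone_over_faces_iff[of V 2] cone_over_faces_iff[of N 3]
  by (auto simp: lift_in_vertices lift_in_cone_over cone_over_psubset_iff)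

lemma flag_cases:
  assumes "flag a' V' N'"
  obtains a V N where "a' = lift a" "V' = cone_over V" "N' = cone_over N" "(a, V, N) \<in> flags023 \<Delta>"
proof -
  have f: "a' \<in> lift ` vertices \<Delta>" "V' \<in> \<Phi>" "N' \<in> \<Phi>" "vec.dim V' = 2 + 1" "vec.dim N' = 3 + 1"
    using assms unfolding flag_def by simp_all
  obtain a where a: "a' = lift a" using f(1) by (elim imageE) (rule that)
  obtain V where V: "V' = cone_over V" using cone_faces[OF f(2,4)] by (elim bexE) (rule that)
  obtain N where N: "N' = cone_over N" using cone_faces[OF f(3,5)] by (elim bexE) (rule that)
  show ?thesis by (rule that[OF a V N]) (use assms flag_iff in \<open>simp add: a V N\<close>)
qed

text \<open>Multiplication by \<open>\<eta> V\<close> converts the signs of equation (1) into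
  incidence numbers. The factor depends on V only, so (2) and (3) are unaffected. The value off
  flags makes the passage from \<open>s\<close> injective and onto the families supported on
  flags.\<close>

definition signed :: "(('k ^ 'n) \<times> ('k ^ 'n) set \<times> ('k ^ 'n) set \<Rightarrow> 'k) \<Rightarrow>
    'k ^ 'n option \<Rightarrow> ('k ^ 'n option) set \<Rightarrow> ('k ^ 'n option) set \<Rightarrow> 'k" where
  "signed s a V N = (if flag a V N then \<eta> (uncone V) * s (unlift a, uncone V, uncone N) else 0)"

lemma signed_flag: "(a, V, N) \<in> flags023 \<Delta> \<Longrightarrow> signed s (lift a) (cone_over V) (cone_over N) = \<eta> V * s (a, V, N)"
  by (simp add: signed_def flag_iff)

lemma \<eta>_square:
  assumes "Q \<in> faces \<Delta> 2 \<union> faces \<Delta> 4" shows "\<eta> Q * \<eta> Q = 1"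
  using \<eta>_spec(1)[OF assms] by auto

lemma inc_eq_incidence:
  "\<tau> \<subset> \<mu> \<Longrightarrow> vec.dim \<mu> = vec.dim \<tau> + 1 \<Longrightarrow> inc \<tau> \<mu> = incidence \<omega> \<tau> \<mu>"
  by (simp add: inc_def)

text \<open>The double sum over V and N below F is regrouped by V. For each V only the two middle
  faces remain, with signs \<open>- \<eta> F * \<eta> V\<close> for the upper and
  \<open>\<eta> F * \<eta> V\<close> for the lower one; the factor \<open>\<eta> V\<close> cancels
  against the one in \<open>signed\<close>.\<close>

lemma signed_four_face:
  assumes a: "a \<in> vertices \<Delta>" and F: "F \<in> faces \<Delta> 4" and aF: "a \<in> F"
  shows "\<delta> (star (lift a)) (face_sum (signed s) (lift a)) (cone_over F) =
    - \<eta> F * (\<Sum>V | V \<in> faces \<Delta> 2 \<and> a \<in> V \<and> V \<subseteq> F.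
      s (a, V, M_upper \<Delta> \<theta> V F) - s (a, V, M_lower \<Delta> \<theta> V F))"
proof -
  let ?S = "star (lift a)" and ?F = "cone_over F"
  let ?W = "\<lambda>V. \<Sum>N\<in>?S. inc V N * inc N ?F * signed s (lift a) V N"
  have finS: "finite ?S" by (rule interval_closed_finite[OF interval_closed_star])
  have FP: "?F \<in> \<Phi>" "vec.dim ?F = 5" using faces_cone[OF F] by simp_all
  have "\<delta> ?S (face_sum (signed s) (lift a)) ?F = (\<Sum>N\<in>?S. \<Sum>V\<in>?S. inc V N * inc N ?F * signed s (lift a) V N)"
    unfolding \<delta>_def sum_distrib_left by (intro sum.cong refl) (simp only: mult_ac)
  also have "\<dots> = (\<Sum>V\<in>?S. ?W V)" by (rule sum.swap)
  also have "\<dots> = (\<Sum>V\<in>cone_over ` {V. V \<in> faces \<Delta> 2 \<and> a \<in> V \<and> V \<subseteq> F}. ?W V)"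
  proof (rule sum.mono_neutral_right[OF finS])
    show "cone_over ` {V. V \<in> faces \<Delta> 2 \<and> a \<in> V \<and> V \<subseteq> F} \<subseteq> ?S"
    proof (rule image_subsetI)
      fix V assume "V \<in> {V. V \<in> faces \<Delta> 2 \<and> a \<in> V \<and> V \<subseteq> F}"
      then have "V \<in> faces \<Delta> 2" "a \<in> V" by simp_all
      then show "cone_over V \<in> ?S" unfolding star_def using faces_cone[of V \<Delta> 2] by (simp add: lift_in_cone_over)
    qed
    show "\<forall>V\<in>?S - cone_over ` {V. V \<in> faces \<Delta> 2 \<and> a \<in> V \<and> V \<subseteq> F}. ?W V = 0"
    proof
      fix V' assume V': "V' \<in> ?S - cone_over ` {V. V \<in> faces \<Delta> 2 \<and> a \<in> V \<and> V \<subseteq> F}"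
      show "?W V' = 0"
      proof (rule sum.neutral, rule ballI, rule ccontr)
        fix N assume "inc V' N * inc N ?F * signed s (lift a) V' N \<noteq> 0"
        then have "inc V' N \<noteq> 0" "inc N ?F \<noteq> 0" by auto
        then have h: "V' \<subset> N" "N \<subset> ?F" "vec.dim N = vec.dim V' + 1" "vec.dim ?F = vec.dim N + 1"
          unfolding inc_def by (simp_all split: if_splits)
        have V'P: "V' \<in> \<Phi>" "lift a \<in> V'" using V' unfolding star_def by simp_all
        have "vec.dim V' = 2 + 1" using h FP(2) by simp
        from cone_faces[OF V'P(1) this] obtain V where V: "V \<in> faces \<Delta> 2" "V' = cone_over V"
          by (elim bexE) (rule that)
        have "a \<in> V" using V'P(2) unfolding V(2) by (simp add: lift_in_cone_over)
        moreover have "V \<subseteq> F"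
          using psubset_imp_subset[OF psubset_trans[OF h(1,2)]] unfolding V(2) cone_over_mono_iff .
        ultimately have "V' \<in> cone_over ` {V. V \<in> faces \<Delta> 2 \<and> a \<in> V \<and> V \<subseteq> F}"
          unfolding V(2) using V(1) by (intro imageI) simp
        then show False using V' by simp
      qed
    qed
  qed
  also have "\<dots> = (\<Sum>V | V \<in> faces \<Delta> 2 \<and> a \<in> V \<and> V \<subseteq> F. ?W (cone_over V))"
    by (subst sum.reindex) (simp_all add: inj_on_def cone_over_eq_iff)
  also have "\<dots> = (\<Sum>V | V \<in> faces \<Delta> 2 \<and> a \<in> V \<and> V \<subseteq> F.
      - \<eta> F * (s (a, V, M_upper \<Delta> \<theta> V F) - s (a, V, M_lower \<Delta> \<theta> V F)))"
  proof (rule sum.cong[OF refl])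
    fix V assume "V \<in> {V. V \<in> faces \<Delta> 2 \<and> a \<in> V \<and> V \<subseteq> F}"
    then have V: "V \<in> faces \<Delta> 2" "a \<in> V" "V \<subseteq> F" by simp_all
    define U L where "U = M_upper \<Delta> \<theta> V F" and "L = M_lower \<Delta> \<theta> V F"
    have UL: "U \<in> faces \<Delta> 3" "L \<in> faces \<Delta> 3" "U \<noteq> L"
      and mid: "{\<mu> \<in> \<Phi>. cone_over V \<subset> \<mu> \<and> \<mu> \<subset> ?F} = {cone_over U, cone_over L}"
      and eL: "incidence \<omega> (cone_over V) (cone_over L) * incidence \<omega> (cone_over L) ?F = \<eta> F * \<eta> V"
      and eU: "incidence \<omega> (cone_over V) (cone_over U) * incidence \<omega> (cone_over U) ?F = - (\<eta> F * \<eta> V)"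
      using intermediate_pair_spec[OF V(1) F V(3)] unfolding U_def L_def by simp_all
    have VP: "vec.dim (cone_over V) = 3" using faces_cone[OF V(1)] by simp
    have inS: "cone_over M \<in> ?S \<and> cone_over V \<subset> cone_over M \<and> cone_over M \<subset> ?F \<and> (a, V, M) \<in> flags023 \<Delta> \<and>
      vec.dim (cone_over M) = 4"
      if M: "M = U \<or> M = L" for M
    proof -
      have M3: "M \<in> faces \<Delta> 3" using M UL by auto
      have "cone_over M \<in> {\<mu> \<in> \<Phi>. cone_over V \<subset> \<mu> \<and> \<mu> \<subset> ?F}" unfolding mid using M by auto
      then have m: "cone_over M \<in> \<Phi>" "cone_over V \<subset> cone_over M" "cone_over M \<subset> ?F" by simp_all
      have VM: "V \<subset> M" using m(2) by (simp add: cone_over_psubset_iff)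
      then have "a \<in> M" using V(2) by blast
      then show ?thesis using m VM M3 a V(1,2) faces_cone[OF M3] unfolding star_def flags023_def
        by (simp add: lift_in_cone_over)
    qed
    have "?W (cone_over V) = (\<Sum>N\<in>{cone_over U, cone_over L}. inc (cone_over V) N * inc N ?F * signed s (lift a) (cone_over V) N)"
    proof (rule sum.mono_neutral_right[OF finS])
      show "{cone_over U, cone_over L} \<subseteq> ?S" using inS[of U] inS[of L] by simp
      show "\<forall>N\<in>?S - {cone_over U, cone_over L}. inc (cone_over V) N * inc N ?F * signed s (lift a) (cone_over V) N = 0"
      proof
        fix N assume N: "N \<in> ?S - {cone_over U, cone_over L}"
        then have "N \<in> \<Phi>" "N \<notin> {\<mu> \<in> \<Phi>. cone_over V \<subset> \<mu> \<and> \<mu> \<subset> ?F}" unfolding mid star_def by simp_all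
        then have "\<not> (cone_over V \<subset> N \<and> N \<subset> ?F)" by simp
        then show "inc (cone_over V) N * inc N ?F * signed s (lift a) (cone_over V) N = 0"
          unfolding inc_def by auto
      qed
    qed
    also have "\<dots> = inc (cone_over V) (cone_over U) * inc (cone_over U) ?F * (\<eta> V * s (a, V, U)) +
      inc (cone_over V) (cone_over L) * inc (cone_over L) ?F * (\<eta> V * s (a, V, L))"
      using UL(3) inS[of U] inS[of L] by (simp add: signed_flag cone_over_eq_iff)
    also have "\<dots> = - (\<eta> F * \<eta> V) * (\<eta> V * s (a, V, U)) + \<eta> F * \<eta> V * (\<eta> V * s (a, V, L))"
      using inS[of U] inS[of L] VP FP(2) by (simp add: inc_eq_incidence eU eL)
    also have "\<dots> = (\<eta> V * \<eta> V) * (- \<eta> F * (s (a, V, U) - s (a, V, L)))" by (simp add: algebra_simps)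
    also have "\<dots> = - \<eta> F * (s (a, V, U) - s (a, V, L))" using \<eta>_square V(1) by simp
    finally show "?W (cone_over V) = - \<eta> F * (s (a, V, M_upper \<Delta> \<theta> V F) - s (a, V, M_lower \<Delta> \<theta> V F))"
      unfolding U_def L_def .
  qed
  finally show ?thesis unfolding sum_distrib_left .
qed

lemma syn_signed:
  assumes V: "V \<in> faces \<Delta> 2" and N: "N \<in> faces \<Delta> 3" and VN: "V \<subset> N"
  shows "syn (\<lambda>a V. signed s a V (cone_over N)) (cone_over V) =
    \<eta> V *s (\<Sum>a | a \<in> vertices \<Delta> \<and> a \<in> V. s (a, V, N) *s lift a)"
proof -
  have eq: "lift ` vertices \<Delta> \<inter> cone_over V = lift ` {a. a \<in> vertices \<Delta> \<and> a \<in> V}"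
    by (auto simp: lift_in_cone_over)
  have "syn (\<lambda>a V. signed s a V (cone_over N)) (cone_over V) =
    (\<Sum>a | a \<in> vertices \<Delta> \<and> a \<in> V. signed s (lift a) (cone_over V) (cone_over N) *s lift a)"
    unfolding syn_def eq by (rule sum_lift_image)
  also have "\<dots> = (\<Sum>a | a \<in> vertices \<Delta> \<and> a \<in> V. \<eta> V *s (s (a, V, N) *s lift a))"
    by (intro sum.cong refl) (use assms in \<open>simp add: signed_flag flags023_def\<close>)
  finally show ?thesis by (simp add: vec.scale_sum_right)
qed

lemma signed_MV:
  assumes V: "V \<in> faces \<Delta> 2" and a: "a \<in> vertices \<Delta>" "a \<in> V"
  shows "signed s (lift a) (cone_over V) (cone_over (MV V)) = \<eta> V * s (a, V, MV V)"
  by (rule signed_flag) (use assms MV[OF V] in \<open>simp add: flags023_def\<close>)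

text \<open>The three equations match the three clauses of \<open>normalised\<close> one by one, up
  to the nonzero factors \<open>- \<eta> F\<close>, \<open>\<eta> V\<close> and
  \<open>\<eta> V\<close>.\<close>

lemma solution_iff:
  "s \<in> vcarrier (solution_space \<Delta> \<theta> MV) \<longleftrightarrow> (\<forall>\<phi>. \<phi> \<notin> flags023 \<Delta> \<longrightarrow> s \<phi> = 0) \<and> normalised (signed s)"
proof -
  have \<eta>0: "\<eta> Q \<noteq> 0" if "Q \<in> faces \<Delta> 2 \<union> faces \<Delta> 4" for Q using \<eta>_spec(1)[OF that] by auto
  let ?e1 = "\<forall>a\<in>vertices \<Delta>. \<forall>F\<in>faces \<Delta> 4. a \<in> F \<longrightarrow>
            (\<Sum>V | V \<in> faces \<Delta> 2 \<and> a \<in> V \<and> V \<subseteq> F.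
               s (a, V, M_upper \<Delta> \<theta> V F) - s (a, V, M_lower \<Delta> \<theta> V F)) = 0"
  let ?n1 = "\<forall>F\<in>\<Phi>. vec.dim F = 5 \<longrightarrow> (\<forall>a\<in>lift ` vertices \<Delta>. a \<in> F \<longrightarrow> \<delta> (star a) (face_sum (signed s) a) F = 0)"
  let ?e2 = "\<forall>V\<in>faces \<Delta> 2. \<forall>M\<in>faces \<Delta> 3. V \<subset> M \<longrightarrow>
            (\<Sum>a | a \<in> vertices \<Delta> \<and> a \<in> V. s (a, V, M) *s lift a) = 0"
  let ?n2 = "\<forall>V\<in>\<Phi>. \<forall>N\<in>\<Phi>. vec.dim V = 3 \<longrightarrow> vec.dim N = 4 \<longrightarrow> V \<subset> N \<longrightarrow> syn (\<lambda>a V. signed s a V N) V = 0"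
  let ?e3 = "\<forall>a\<in>vertices \<Delta>. \<forall>V\<in>faces \<Delta> 2. a \<in> V \<longrightarrow> s (a, V, MV V) = 0"
  let ?n3 = "\<forall>V\<in>\<Phi>. vec.dim V = 3 \<longrightarrow> (\<forall>a\<in>lift ` vertices \<Delta>. a \<in> V \<longrightarrow> signed s a V (cone_over (MV (uncone V))) = 0)"
  have cf: "\<exists>Q\<in>faces \<Delta> d. \<tau> = cone_over Q" if "\<tau> \<in> \<Phi>" "vec.dim \<tau> = Suc d" for \<tau> d
    by (rule cone_faces[OF that(1)]) (use that(2) in simp)
  have 1: "?e1 \<longleftrightarrow> ?n1"
  proof
    assume e: ?e1
    show ?n1
    proof (intro ballI impI)
      fix F' a' assume F': "F' \<in> \<Phi>" "vec.dim F' = 5" "a' \<in> lift ` vertices \<Delta>" "a' \<in> F'"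
      have dF: "vec.dim F' = Suc 4" using F'(2) by simp
      obtain F where F: "F \<in> faces \<Delta> 4" "F' = cone_over F"
        using cf[OF F'(1) dF] by (elim bexE) (rule that)
      obtain a where a: "a \<in> vertices \<Delta>" "a' = lift a" using F'(3) by (elim imageE) (rule that)
      have aF: "a \<in> F" using F'(4) unfolding F(2) a(2) by (simp add: lift_in_cone_over)
      show "\<delta> (star a') (face_sum (signed s) a') F' = 0"
        unfolding F(2) a(2) signed_four_face[OF a(1) F(1) aF] using e a(1) F(1) aF by simp
    qed
  next
    assume n: ?n1
    show ?e1
    proof (intro ballI impI)
      fix a F assume h: "a \<in> vertices \<Delta>" "F \<in> faces \<Delta> 4" "a \<in> F"
      have "\<delta> (star (lift a)) (face_sum (signed s) (lift a)) (cone_over F) = 0"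
        using n faces_cone[OF h(2)] h by (simp add: lift_in_cone_over)
      then show "(\<Sum>V | V \<in> faces \<Delta> 2 \<and> a \<in> V \<and> V \<subseteq> F.
          s (a, V, M_upper \<Delta> \<theta> V F) - s (a, V, M_lower \<Delta> \<theta> V F)) = 0"
        unfolding signed_four_face[OF h] using \<eta>0[of F] h(2) by simp
    qed
  qed
  have 2: "?e2 \<longleftrightarrow> ?n2"
  proof
    assume e: ?e2
    show ?n2
    proof (intro ballI impI)
      fix V' N' assume h: "V' \<in> \<Phi>" "N' \<in> \<Phi>" "vec.dim V' = 3" "vec.dim N' = 4" "V' \<subset> N'"
      have d: "vec.dim V' = Suc 2" "vec.dim N' = Suc 3" using h(3,4) by simp_all
      obtain V where V: "V \<in> faces \<Delta> 2" "V' = cone_over V"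
        using cf[OF h(1) d(1)] by (elim bexE) (rule that)
      obtain N where N: "N \<in> faces \<Delta> 3" "N' = cone_over N"
        using cf[OF h(2) d(2)] by (elim bexE) (rule that)
      have VN: "V \<subset> N" using h(5) unfolding V(2) N(2) by (simp add: cone_over_psubset_iff)
      show "syn (\<lambda>a V. signed s a V N') V' = 0"
        unfolding V(2) N(2) syn_signed[OF V(1) N(1) VN] using e V(1) N(1) VN by simp
    qed
  next
    assume n: ?n2
    show ?e2
    proof (intro ballI impI)
      fix V M assume h: "V \<in> faces \<Delta> 2" "M \<in> faces \<Delta> 3" "V \<subset> M"
      have "syn (\<lambda>a V. signed s a V (cone_over M)) (cone_over V) = 0"
        using n faces_cone[OF h(1)] faces_cone[OF h(2)] h(3) by (simp add: cone_over_psubset_iff)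
      then show "(\<Sum>a | a \<in> vertices \<Delta> \<and> a \<in> V. s (a, V, M) *s lift a) = 0"
        unfolding syn_signed[OF h] using \<eta>0[of V] h(1) by simp
    qed
  qed
  have 3: "?e3 \<longleftrightarrow> ?n3"
  proof
    assume e: ?e3
    show ?n3
    proof (intro ballI impI)
      fix V' a' assume h: "V' \<in> \<Phi>" "vec.dim V' = 3" "a' \<in> lift ` vertices \<Delta>" "a' \<in> V'"
      have d: "vec.dim V' = Suc 2" using h(2) by simp
      obtain V where V: "V \<in> faces \<Delta> 2" "V' = cone_over V"
        using cf[OF h(1) d] by (elim bexE) (rule that)
      obtain a where a: "a \<in> vertices \<Delta>" "a' = lift a" using h(3) by (elim imageE) (rule that)
      have aV: "a \<in> V" using h(4) unfolding V(2) a(2) by (simp add: lift_in_cone_over)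
      show "signed s a' V' (cone_over (MV (uncone V'))) = 0"
        unfolding V(2) a(2) uncone_cone_over signed_MV[OF V(1) a(1) aV] using e a(1) V(1) aV by simp
    qed
  next
    assume n: ?n3
    show ?e3
    proof (intro ballI impI)
      fix a V assume h: "a \<in> vertices \<Delta>" "V \<in> faces \<Delta> 2" "a \<in> V"
      have "signed s (lift a) (cone_over V) (cone_over (MV (uncone (cone_over V)))) = 0"
        using bspec[OF n, of "cone_over V"] faces_cone[OF h(2)] h(1,3) by (simp add: lift_in_cone_over)
      then show "s (a, V, MV V) = 0"
        unfolding uncone_cone_over signed_MV[OF h(2,1,3)] using \<eta>0[of V] h(2) by simp
    qed
  qed
  show ?thesis unfolding solution_space_def normalised_def 1[symmetric] 2[symmetric] 3[symmetric]
    by simp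
qed

lemma signed_linear: "signed (\<lambda>\<phi>. s \<phi> + c * s' \<phi>) = (\<lambda>a V N. signed s a V N + c * signed s' a V N)"
  by (intro ext) (simp add: signed_def algebra_simps)

lemma signed_surj:
  assumes "\<And>a V N. \<not> flag a V N \<Longrightarrow> t a V N = 0"
  shows "\<exists>s. (\<forall>\<phi>. \<phi> \<notin> flags023 \<Delta> \<longrightarrow> s \<phi> = 0) \<and> signed s = t"
proof -
  \<comment> \<open>As \<open>\<eta> V\<close> squares to 1, the inverse of \<open>signed\<close>
    multiplies by \<open>\<eta> V\<close> once more.\<close>
  define s where "s = (\<lambda>(a, V, N). if (a, V, N) \<in> flags023 \<Delta> then \<eta> V * t (lift a) (cone_over V) (cone_over N) else 0)"
  have "signed s a' V' N' = t a' V' N'" for a' V' N'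
  proof (cases "flag a' V' N'")
    case True
    then obtain a V N where e: "a' = lift a" "V' = cone_over V" "N' = cone_over N" and f: "(a, V, N) \<in> flags023 \<Delta>"
      by (rule flag_cases)
    have "V \<in> faces \<Delta> 2 \<union> faces \<Delta> 4" using f unfolding flags023_def by simp
    then show ?thesis unfolding e signed_flag[OF f] using f \<eta>_square[of V]
      by (simp add: s_def mult.assoc[symmetric])
  next
    case False then show ?thesis using assms by (simp add: signed_def)
  qed
  then have "signed s = t" by (intro ext)
  moreover have "\<forall>\<phi>. \<phi> \<notin> flags023 \<Delta> \<longrightarrow> s \<phi> = 0" by (auto simp: s_def)
  ultimately show ?thesis by (intro exI conjI)
qed

lemma signed_eq_zero_iff:
  assumes "\<forall>\<phi>. \<phi> \<notin> flags023 \<Delta> \<longrightarrow> s \<phi> = 0"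
  shows "(\<forall>a V N. flag a V N \<longrightarrow> signed s a V N = 0) \<longleftrightarrow> s = (\<lambda>_. 0)"
proof
  assume z: "\<forall>a V N. flag a V N \<longrightarrow> signed s a V N = 0"
  show "s = (\<lambda>_. 0)"
  proof (rule ext)
    fix \<phi> :: "('k ^ 'n) \<times> ('k ^ 'n) set \<times> ('k ^ 'n) set"
    obtain a V N where \<phi>: "\<phi> = (a, V, N)" by (cases \<phi>)
    show "s \<phi> = 0"
    proof (cases "\<phi> \<in> flags023 \<Delta>")
      case True
      then have f: "(a, V, N) \<in> flags023 \<Delta>" unfolding \<phi> .
      have "V \<in> faces \<Delta> 2 \<union> faces \<Delta> 4" using f unfolding flags023_def by simp
      from \<eta>_spec(1)[OF this] have "\<eta> V \<noteq> 0" by auto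
      moreover have "signed s (lift a) (cone_over V) (cone_over N) = 0"
        by (rule mp[OF spec[OF spec[OF spec[OF z]]] iffD2[OF flag_iff f]])
      then have "\<eta> V * s (a, V, N) = 0" unfolding signed_flag[OF f] .
      ultimately show ?thesis unfolding \<phi> by simp
    next
      case False
      show ?thesis by (rule mp[OF spec[OF assms] False])
    qed
  qed
next
  assume "s = (\<lambda>_. 0)"
  then show "\<forall>a V N. flag a V N \<longrightarrow> signed s a V N = 0" by (simp add: signed_def)
qed

lemma coboundary_imp_zero:
  assumes s: "s \<in> vcarrier (solution_space \<Delta> \<theta> MV)" and R: "corresponds f (signed s)" and e: "bounds e f"
  shows "s = (\<lambda>_. 0)"
proof -
  have z: "\<forall>\<phi>. \<phi> \<notin> flags023 \<Delta> \<longrightarrow> s \<phi> = 0" and n: "normalised (signed s)"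
    using s unfolding solution_iff by simp_all
  have "\<forall>a V N. flag a V N \<longrightarrow> signed s a V N = 0"
    by (intro allI impI) (rule corresponds_boundary[OF R n e])
  then show ?thesis by (rule iffD1[OF signed_eq_zero_iff[OF z]])
qed

lemma zero_imp_coboundary:
  assumes R: "corresponds f (signed (\<lambda>_. 0))" shows "\<exists>e. bounds e f"
proof -
  have "signed (\<lambda>_. 0) a V N = 0" for a V N by (simp add: signed_def)
  from corresponds_zero[OF R this] show ?thesis by (elim exE conjE) (rule exI)
qed

text \<open>This supplies the kernel condition of \<open>viso_quotient\<close>. The forward
  direction rests on D^1(M) = 0 through \<open>corresponds_boundary\<close>, the backward one on
  exactness of the stars.\<close>

lemma coboundary_iff_zero:
  assumes f: "f \<in> Z2"
    and s: "s \<in> vcarrier (solution_space \<Delta> \<theta> MV)" and R: "corresponds f (signed s)"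
  shows "f \<in> B2 \<longleftrightarrow> s = (\<lambda>_. 0)"
proof -
  have off: "\<forall>V. \<not> (V \<in> \<Phi> \<and> vec.dim V = 3) \<longrightarrow> f V = 0" using f unfolding cocycles_iff by (rule conjunct2)
  have 1: "s = (\<lambda>_. 0)" if "\<exists>e. bounds e f"
    using that by (elim exE) (rule coboundary_imp_zero[OF s R])
  have 2: "\<exists>e. bounds e f" if "s = (\<lambda>_. 0)"
    using R unfolding that by (rule zero_imp_coboundary)
  show ?thesis unfolding coboundaries_iff using off 1 2 by (intro iffI conjI) (elim conjE, assumption+)
qed

lemma zero_coboundary: "(\<lambda>_. 0) \<in> B2"
proof -
  have "D (\<lambda>_. 0) V = 0" for V unfolding D_def by simp
  then have "bounds (\<lambda>_. 0) (\<lambda>_. 0)" unfolding bounds_def by (simp add: vec.span_zero)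
  then show ?thesis unfolding coboundaries_iff by (intro conjI exI[of _ "\<lambda>_. 0"]) simp_all
qed

lemma coboundaries_subset_cocycles:
  "B2 \<subseteq> Z2"
  unfolding subset_iff coboundaries_iff cocycles_iff using bounds_cocycle by (intro allI impI conjI) auto

lemma solution_corresponds:
  assumes "s \<in> vcarrier (solution_space \<Delta> \<theta> MV)"
  shows "\<exists>f\<in>Z2. corresponds f (signed s)"
proof -
  have "normalised (signed s)" using assms unfolding solution_iff by (rule conjunct2)
  from normalised_corresponds[OF this] obtain f where
    f: "cocycle f \<and> corresponds f (signed s) \<and> (\<forall>V. \<not> (V \<in> \<Phi> \<and> vec.dim V = 3) \<longrightarrow> f V = 0)"
    by (rule exE)
  have "f \<in> Z2"
    by (rule iffD2[OF cocycles_iff conjI[OF conjunct1[OF f] conjunct2[OF conjunct2[OF f]]]])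
  then show ?thesis using conjunct1[OF conjunct2[OF f]] by (intro bexI[of _ f])
qed

lemma cocycles_linear:
  assumes f: "f \<in> Z2"
    and g: "g \<in> Z2"
  shows "(\<lambda>x. f x + c *s g x) \<in> Z2"
proof -
  have D_lin: "D (\<lambda>x. f x + c *s g x) M = D f M + c *s D g M" for M
    unfolding D_def by (simp add: vec.scale_right_distrib sum.distrib vec.scale_sum_right mult.commute)
  show ?thesis using f g unfolding cocycles_iff cocycle_def D_lin
    by (simp add: vec.span_add vec.span_scale)
qed

lemma normalised_linear:
  assumes t: "normalised t" and t': "normalised t'"
  shows "normalised (\<lambda>a V N. t a V N + c * t' a V N)"
proof -
  have \<delta>_lin: "\<delta> T (\<lambda>x. f x + c * g x) M = \<delta> T f M + c * \<delta> T g M" for T f g M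
    unfolding \<delta>_def by (simp add: algebra_simps sum.distrib sum_distrib_left)
  have syn_lin: "syn (\<lambda>a V. p a V + c * q a V) M = syn p M + c *s syn q M" for p q M
    unfolding syn_def by (simp add: vec.scale_left_distrib sum.distrib vec.scale_sum_right)
  show ?thesis
    unfolding normalised_def
  proof (intro conjI ballI impI)
    fix F a assume h: "F \<in> \<Phi>" "vec.dim F = 5" "a \<in> lift ` vertices \<Delta>" "a \<in> F"
    have "\<delta> (star a) (face_sum (\<lambda>a V N. t a V N + c * t' a V N) a) F =
      \<delta> (star a) (\<lambda>N. face_sum t a N + c * face_sum t' a N) F"
      by (rule \<delta>_star_cong) (rule \<delta>_lin)
    also have "\<dots> = \<delta> (star a) (face_sum t a) F + c * \<delta> (star a) (face_sum t' a) F" by (rule \<delta>_lin)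
    also have "\<dots> = 0" using normalised_cocycle[OF t h] normalised_cocycle[OF t' h] by simp
    finally show "\<delta> (star a) (face_sum (\<lambda>a V N. t a V N + c * t' a V N) a) F = 0" .
  next
    fix V N assume h: "V \<in> \<Phi>" "N \<in> \<Phi>" "vec.dim V = 3" "vec.dim N = 4" "V \<subset> N"
    have "syn (\<lambda>a V. t a V N + c * t' a V N) V = syn (\<lambda>a V. t a V N) V + c *s syn (\<lambda>a V. t' a V N) V"
      by (rule syn_lin)
    then show "syn (\<lambda>a V. t a V N + c * t' a V N) V = 0"
      using normalised_relation[OF t h] normalised_relation[OF t' h] by simp
  next
    fix V a assume h: "V \<in> \<Phi>" "vec.dim V = 3" "a \<in> lift ` vertices \<Delta>" "a \<in> V"
    show "t a V (cone_over (MV (uncone V))) + c * t' a V (cone_over (MV (uncone V))) = 0"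
      using normalised_mv[OF t h] normalised_mv[OF t' h] by simp
  qed
qed

lemma solution_linear:
  assumes s: "s \<in> vcarrier (solution_space \<Delta> \<theta> MV)" and t: "t \<in> vcarrier (solution_space \<Delta> \<theta> MV)"
  shows "(\<lambda>y. s y + c * t y) \<in> vcarrier (solution_space \<Delta> \<theta> MV)"
proof (rule iffD2[OF solution_iff], rule conjI)
  show "\<forall>\<phi>. \<phi> \<notin> flags023 \<Delta> \<longrightarrow> s \<phi> + c * t \<phi> = 0"
    using s t unfolding solution_iff by simp
  have "normalised (\<lambda>a V N. signed s a V N + c * signed t a V N)"
    using s t unfolding solution_iff by (intro normalised_linear) simp_all
  then show "normalised (signed (\<lambda>y. s y + c * t y))" by (rule ssubst[OF signed_linear])
qed

lemma corresponds_signed_linear: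
  assumes "corresponds f (signed s)" "corresponds g (signed t)"
  shows "corresponds (\<lambda>x. f x + c *s g x) (signed (\<lambda>y. s y + c * t y))"
  by (rule ssubst[OF signed_linear], rule corresponds_linear[OF assms])

lemma cocycle_solution:
  assumes "f \<in> Z2"
  shows "\<exists>s\<in>vcarrier (solution_space \<Delta> \<theta> MV). corresponds f (signed s)"
proof -
  have "cocycle f" using assms unfolding cocycles_iff by (rule conjunct1)
  from cocycle_corresponds[OF this] obtain t where
    t: "normalised t \<and> corresponds f t \<and> (\<forall>a V N. \<not> flag a V N \<longrightarrow> t a V N = 0)" by (rule exE)
  have t0: "t a V N = 0" if "\<not> flag a V N" for a V N using t that by simp
  from signed_surj[OF t0] obtain s where
    s: "(\<forall>\<phi>. \<phi> \<notin> flags023 \<Delta> \<longrightarrow> s \<phi> = 0) \<and> signed s = t" by (rule exE)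
  have st: "t = signed s" by (rule conjunct2[OF s, symmetric])
  note t' = t[unfolded st]
  have "s \<in> vcarrier (solution_space \<Delta> \<theta> MV)"
    by (rule iffD2[OF solution_iff conjI[OF conjunct1[OF s] conjunct1[OF t']]])
  then show ?thesis using conjunct1[OF conjunct2[OF t']] by (intro bexI[of _ s])
qed

lemma viso_solution_space: "viso (Dspace \<omega> 2 \<Delta>) (solution_space \<Delta> \<theta> MV)"
proof -
  let ?Z = Z2
  let ?B = B2
  let ?S = "vcarrier (solution_space \<Delta> \<theta> MV)"
  let ?R = "\<lambda>f s. corresponds f (signed s)"
  have v: "viso (vquotient \<lparr> vcarrier = ?Z, vplus = (\<lambda>f g x. f x + g x), vscale = (\<lambda>c f x. c *s f x) \<rparr> ?B)
    \<lparr> vcarrier = ?S, vplus = (\<lambda>s t y. s y + t y), vscale = (\<lambda>c s y. c * s y) \<rparr>"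
  proof (rule viso_quotient[where R = ?R])
    show "\<And>c f g. f \<in> ?Z \<Longrightarrow> g \<in> ?Z \<Longrightarrow> (\<lambda>x. f x + c *s g x) \<in> ?Z" by (rule cocycles_linear)
  next
    show "\<And>c s t. s \<in> ?S \<Longrightarrow> t \<in> ?S \<Longrightarrow> (\<lambda>y. s y + c * t y) \<in> ?S" by (rule solution_linear)
  next
    show "\<And>c f g s t. ?R f s \<Longrightarrow> ?R g t \<Longrightarrow> ?R (\<lambda>x. f x + c *s g x) (\<lambda>y. s y + c * t y)"
      by (rule corresponds_signed_linear)
  next
    show "\<And>f. f \<in> ?Z \<Longrightarrow> \<exists>s\<in>?S. ?R f s" by (rule cocycle_solution)
  next
    show "\<And>s. s \<in> ?S \<Longrightarrow> \<exists>f\<in>?Z. ?R f s" by (rule solution_corresponds)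
  next
    show "?B \<subseteq> ?Z" by (rule coboundaries_subset_cocycles)
    show "(\<lambda>_. 0) \<in> ?B" by (rule zero_coboundary)
  next
    show "\<And>f s. f \<in> ?Z \<Longrightarrow> s \<in> ?S \<Longrightarrow> ?R f s \<Longrightarrow> f \<in> ?B \<longleftrightarrow> s = (\<lambda>_. 0)"
      by (rule coboundary_iff_zero)
  qed
  have S: "solution_space \<Delta> \<theta> MV = \<lparr> vcarrier = ?S, vplus = (\<lambda>s t y. s y + t y), vscale = (\<lambda>c s y. c * s y) \<rparr>"
    unfolding solution_space_def by simp
  show ?thesis using v unfolding Dspace_def cohomology_def S[symmetric] .
qed

end

theorem mainTheorem3:
  fixes \<iota> :: "'k::linordered_field \<Rightarrow> real"
    and \<Delta> :: "('k ^ 'n) set"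
    and \<omega> :: "('k ^ 'n option) set \<Rightarrow> ('k ^ 'n option) list"
    and \<theta> :: "('k ^ 'n) set \<Rightarrow> ('k ^ 'n) list"
    and MV :: "('k ^ 'n) set \<Rightarrow> ('k ^ 'n) set"
  assumes K: "subfield_of_reals \<iota>"
    and polytope: "Kpolytope \<Delta>"
    and full_dim: "vec.dim (direction \<Delta>) = CARD('n)"
    and n_ge_3: "CARD('n) \<ge> 3"
    and cone_orientations:
      "\<And>\<sigma>. \<sigma> \<in> face_fan (cone_over \<Delta>) \<Longrightarrow> ordered_basis (\<omega> \<sigma>) (vec.span \<sigma>)"
    and face_orientations:
      "\<And>Q. Q \<in> faces \<Delta> 2 \<union> faces \<Delta> 4 \<Longrightarrow> ordered_basis (\<theta> Q) (direction Q)"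
    and D1: "\<And>M. M \<in> faces \<Delta> 3 \<Longrightarrow> vzero_space (Dspace \<omega> 1 M)"
    and D2: "\<And>M. M \<in> faces \<Delta> 3 \<Longrightarrow> vzero_space (Dspace \<omega> 2 M)"
    and MV: "\<And>V. V \<in> faces \<Delta> 2 \<Longrightarrow> MV V \<in> faces \<Delta> 3 \<and> V \<subset> MV V"
  shows "viso (Dspace \<omega> 2 \<Delta>) (solution_space \<Delta> \<theta> MV)"
proof -
  have "oriented_polytope \<Delta> \<omega> \<theta>"
    by (rule oriented_polytope.intro[OF polytope cone_orientations face_orientations])
  moreover have "vanishing_polytope_axioms \<Delta> \<omega> MV"
    by (rule vanishing_polytope_axioms.intro[OF _ D1 D2 MV]) (use full_dim n_ge_3 in simp)
  ultimately interpret vanishing_polytope \<Delta> \<omega> \<theta> MV by (rule vanishing_polytope.intro)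
  show ?thesis by (rule viso_solution_space)
qed

end
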